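(* Let $\Lambda>0$, $\Phi_0>0$, $\Phi_0'\in\mathbb R$, and put $\sigma_0:=\Phi_0^2-(\Phi_0')^2$. Let $(\hat M,\hat g)$ be the universal cover of the generalized Nariai solution with parameters $\Lambda,\Phi_0,\Phi_0'$, and let $(M,g)$ be the universal cover of the standard Nariai solution with the same $\Lambda$. (1) There exists an analytic isometric embedding $(\hat M,\hat g)\to(M,g)$. If $\sigma_0>0$, then $(\hat M,\hat g)$ is (globally, analytically) isometric to $(M,g)$. In particular every generalized Nariai solution is locally isometric to the standard Nariai solution. (2) If $\sigma_0\le 0$, then $(\hat M,\hat g)$ is causal geodesically incomplete. (3) After a change of time direction ($t\mapsto-t$) if necessary, $(\hat M,\hat g)$ has Nariai asymptotics to the future.
   Context: The generalized Nariai solution with parameters $\Lambda>0$, $\Phi_0>0$, $\Phi_0'\in\mathbb R$ is the Lorentzian manifold $I\times(\mathbb S^1\times\mathbb S^2)$ with metric $$\frac1\Lambda\left(-dt^2+\Phi(t)^2\,d\rho^2+g_{\mathbb S^2}\right),\qquad \Phi(t)=\Phi_0\cosh t+\Phi_0'\sinh t,$$ where $t\in I$, $\rho$ is the standard coordinate on $\mathbb S^1$, $g_{\mathbb S^2}$ is the round unit metric on $\mathbb S^2$, and $I\subseteq\mathbb R$ is the unique maximal connected open interval with $0\in I$ and $\Phi|_I>0$. Its universal cover is $I\times(\mathbb R\times\mathbb S^2)$ with the metric given by the same formula. The standard Nariai solution is the case $\Phi_0=1$, $\Phi_0'=0$, so its universal cover is $\mathbb R\times(\mathbb R\times\mathbb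 S^2)$ with metric $\frac1\Lambda(-dt^2+\cosh^2t\,d\rho^2+g_{\mathbb S^2})$. All are time-oriented by $\partial_t$ and globally hyperbolic. Let a future causal geodesically complete, globally hyperbolic spacetime be given (future causal geodesically complete: all future directed causal geodesics are complete to the future). Future late time observers are "oblivious to topology" if there is a Cauchy surface $\Sigma$ such that there is no future directed inextendible causal curve whose causal past contains $\Sigma$. Future late time observers are "completely oblivious to topology" if there is a Cauchy surface $\Sigma$ such that for every future inextendible causal curve $\gamma$, the intersection of $\Sigma$ with the causal past $J^-(\gamma)$ is contained in a subset of $\Sigma$ homeomorphic to a Euclidean 3-ball. The spacetime has "Nariai asymptotics" (to the future) if future late time observers are oblivious to topology but not completely oblivious to topology. Causal geodesically incomplete means that some inextendible causal geodesic is incomplete. *)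

theory Defs
  imports "HOL-Analysis.Analysis"
begin

text \<open>
  Manifolds are embedded analytic submanifolds of a Euclidean space, given by their point sets.
  A map between two of them is analytic iff it is locally the restriction of an analytic map of the
  ambient spaces, and tangent vectors are vectors of the ambient space.
\<close>

subsection \<open>Real analytic maps\<close>

text \<open>The index set of the sum is the set of multi-indices: one exponent per basis vector.\<close>

definition real_analytic_on ::
  "('a::euclidean_space \<Rightarrow> 'b::real_normed_vector) \<Rightarrow> 'a set \<Rightarrow> bool" where
  "real_analytic_on f U \<longleftrightarrow> open U \<and>
     (\<forall>x\<in>U. \<exists>r>0. \<exists>c :: ('a \<Rightarrow> nat) \<Rightarrow> 'b. \<forall>y\<in>ball x r.
        ((\<lambda>\<alpha>. (\<Prod>b\<in>Basis. ((y - x) \<bullet> b) ^ \<alpha> b) *\<^sub>R c \<alpha>) has_sum f y)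
          (Basis \<rightarrow>\<^sub>E UNIV))"

definition analytic_map ::
  "'a::euclidean_space set \<Rightarrow> 'b::euclidean_space set \<Rightarrow> ('a \<Rightarrow> 'b) \<Rightarrow> bool" where
  "analytic_map M N f \<longleftrightarrow> f ` M \<subseteq> N \<and>
     (\<forall>p\<in>M. \<exists>U F. p \<in> U \<and> real_analytic_on F U \<and> (\<forall>q\<in>U \<inter> M. F q = f q))"

definition tangent_space :: "'a::euclidean_space set \<Rightarrow> 'a \<Rightarrow> 'a set" where
  "tangent_space M p =
     {v. \<exists>\<gamma>. \<gamma> 0 = p \<and> (\<exists>e>0. \<forall>s. \<bar>s\<bar> < e \<longrightarrow> \<gamma> s \<in> M) \<and> (\<gamma> has_vector_derivative v) (at 0)}"


subsection \<open>Time-oriented Lorentz manifolds and isometries\<close>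

text \<open>
  The metric at a point \<open>p\<close> is only meaningful on \<open>tangent_space (points S) p\<close>;
  \<open>time_dir\<close> is a timelike vector field fixing the time orientation.
\<close>

record 'a spacetime =
  points :: "'a set"
  metric :: "'a \<Rightarrow> 'a \<Rightarrow> 'a \<Rightarrow> real"
  time_dir :: "'a \<Rightarrow> 'a"

definition reverse_time :: "'a::euclidean_space spacetime \<Rightarrow> 'a spacetime" where
  "reverse_time S = S\<lparr>time_dir := (\<lambda>p. - time_dir S p)\<rparr>"

text \<open>\<open>D\<close> below is determined on the tangent space, where it is the differential of \<open>f\<close>.\<close>

definition preserves_metric ::
  "'a::euclidean_space spacetime \<Rightarrow> 'b::euclidean_space spacetime \<Rightarrow> ('a \<Rightarrow> 'b) \<Rightarrow> bool" where
  "preserves_metric S S' f \<longleftrightarrow>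
     (\<forall>p\<in>points S. \<exists>D. (f has_derivative D) (at p within points S) \<and>
        (\<forall>v\<in>tangent_space (points S) p. \<forall>w\<in>tangent_space (points S) p.
           metric S' (f p) (D v) (D w) = metric S p v w))"

text \<open>An isometric map for a nondegenerate metric is automatically an immersion.\<close>

definition analytic_isometric_embedding ::
  "'a::euclidean_space spacetime \<Rightarrow> 'b::euclidean_space spacetime \<Rightarrow> ('a \<Rightarrow> 'b) \<Rightarrow> bool" where
  "analytic_isometric_embedding S S' f \<longleftrightarrow>
     analytic_map (points S) (points S') f \<and> preserves_metric S S' f \<and>
     (\<exists>h. homeomorphism (points S) (f ` points S) f h)"

definition analytic_isometry ::
  "'a::euclidean_space spacetime \<Rightarrow> 'b::euclidean_space spacetime \<Rightarrow> ('a \<Rightarrow> 'b) \<Rightarrow> bool" where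
  "analytic_isometry S S' f \<longleftrightarrow>
     bij_betw f (points S) (points S') \<and>
     analytic_map (points S) (points S') f \<and>
     analytic_map (points S') (points S) (the_inv_into (points S) f) \<and>
     preserves_metric S S' f"

definition locally_isometric ::
  "'a::euclidean_space spacetime \<Rightarrow> 'b::euclidean_space spacetime \<Rightarrow> bool" where
  "locally_isometric S S' \<longleftrightarrow>
     (\<forall>p\<in>points S. \<exists>U V f. p \<in> U \<and>
        openin (top_of_set (points S)) U \<and> openin (top_of_set (points S')) V \<and>
        analytic_isometry (S\<lparr>points := U\<rparr>) (S'\<lparr>points := V\<rparr>) f)"


subsection \<open>Geodesics\<close>

definition local_param ::
  "'a::euclidean_space set \<Rightarrow> (real^4) set \<Rightarrow> (real^4 \<Rightarrow> 'a) \<Rightarrow> bool" where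
  "local_param M W \<phi> \<longleftrightarrow> real_analytic_on \<phi> W \<and>
     openin (top_of_set M) (\<phi> ` W) \<and> (\<exists>\<psi>. homeomorphism W (\<phi> ` W) \<phi> \<psi>) \<and>
     (\<forall>x\<in>W. inj (frechet_derivative \<phi> (at x)))"

definition partial :: "4 \<Rightarrow> (real^4 \<Rightarrow> 'b::real_normed_vector) \<Rightarrow> real^4 \<Rightarrow> 'b" where
  "partial k f x = frechet_derivative f (at x) (axis k 1)"

definition chart_metric ::
  "'a::euclidean_space spacetime \<Rightarrow> (real^4 \<Rightarrow> 'a) \<Rightarrow> real^4 \<Rightarrow> real^4^4" where
  "chart_metric S \<phi> x = (\<chi> i j. metric S (\<phi> x) (partial i \<phi> x) (partial j \<phi> x))"

definition christoffel ::
  "'a::euclidean_space spacetime \<Rightarrow> (real^4 \<Rightarrow> 'a) \<Rightarrow> real^4 \<Rightarrow> 4 \<Rightarrow> 4 \<Rightarrow> 4 \<Rightarrow> real" where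
  "christoffel S \<phi> x k i j =
     1 / 2 * (\<Sum>l\<in>UNIV. matrix_inv (chart_metric S \<phi> x) $ k $ l *
        (partial i (\<lambda>y. chart_metric S \<phi> y $ j $ l) x +
         partial j (\<lambda>y. chart_metric S \<phi> y $ i $ l) x -
         partial l (\<lambda>y. chart_metric S \<phi> y $ i $ j) x))"

text \<open>
  The geodesic equation is invariant under coordinate changes, so it is enough to ask for it in one
  chart around each point of the curve. The curve carries its affine parameter.
\<close>

definition geodesic ::
  "'a::euclidean_space spacetime \<Rightarrow> real set \<Rightarrow> (real \<Rightarrow> 'a) \<Rightarrow> bool" where
  "geodesic S J \<gamma> \<longleftrightarrow> open J \<and> is_interval J \<and> J \<noteq> {} \<and> \<gamma> ` J \<subseteq> points S \<and>
     (\<forall>s\<in>J. \<exists>W \<phi> N x x' x''. local_param (points S) W \<phi> \<and>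
        open N \<and> s \<in> N \<and> N \<subseteq> J \<and>
        (\<forall>u\<in>N. x u \<in> W \<and> \<gamma> u = \<phi> (x u) \<and>
           (x has_vector_derivative x' u) (at u) \<and> (x' has_vector_derivative x'' u) (at u) \<and>
           (\<forall>k. x'' u $ k +
              (\<Sum>i\<in>UNIV. \<Sum>j\<in>UNIV. christoffel S \<phi> (x u) k i j * x' u $ i * x' u $ j) = 0)))"


subsection \<open>Causality\<close>

definition causal_vec :: "'a::euclidean_space spacetime \<Rightarrow> 'a \<Rightarrow> 'a \<Rightarrow> bool" where
  "causal_vec S p v \<longleftrightarrow> v \<noteq> 0 \<and> metric S p v v \<le> 0"

definition future_causal_vec :: "'a::euclidean_space spacetime \<Rightarrow> 'a \<Rightarrow> 'a \<Rightarrow> bool" where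
  "future_causal_vec S p v \<longleftrightarrow> causal_vec S p v \<and> metric S p v (time_dir S p) < 0"

definition future_timelike_vec :: "'a::euclidean_space spacetime \<Rightarrow> 'a \<Rightarrow> 'a \<Rightarrow> bool" where
  "future_timelike_vec S p v \<longleftrightarrow> metric S p v v < 0 \<and> metric S p v (time_dir S p) < 0"

text \<open>
  Continuous curves on an interval, \<open>C\<^sup>1\<close> up to and including the endpoints between any two
  consecutive elements of a locally finite set \<open>K\<close> of break points, all (one-sided) velocities
  satisfying \<open>P\<close>.
\<close>

definition piecewise_C1_curve ::
  "'a::euclidean_space set \<Rightarrow> ('a \<Rightarrow> 'a \<Rightarrow> bool) \<Rightarrow> real set \<Rightarrow> (real \<Rightarrow> 'a) \<Rightarrow> bool" where
  "piecewise_C1_curve M P J \<gamma> \<longleftrightarrow>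
     is_interval J \<and> interior J \<noteq> {} \<and> continuous_on J \<gamma> \<and> \<gamma> ` J \<subseteq> M \<and>
     (\<exists>K. (\<forall>a b. finite (K \<inter> {a..b})) \<and>
        (\<forall>a\<in>J. \<forall>b\<in>J. a < b \<and> K \<inter> {a<..<b} = {} \<longrightarrow>
           (\<exists>v. continuous_on {a..b} v \<and>
              (\<forall>s\<in>{a..b}. (\<gamma> has_vector_derivative v s) (at s within {a..b}) \<and> P (\<gamma> s) (v s)))))"

abbreviation future_causal_curve ::
  "'a::euclidean_space spacetime \<Rightarrow> real set \<Rightarrow> (real \<Rightarrow> 'a) \<Rightarrow> bool" where
  "future_causal_curve S \<equiv> piecewise_C1_curve (points S) (future_causal_vec S)"

abbreviation future_timelike_curve ::
  "'a::euclidean_space spacetime \<Rightarrow> real set \<Rightarrow> (real \<Rightarrow> 'a) \<Rightarrow> bool" where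
  "future_timelike_curve S \<equiv> piecewise_C1_curve (points S) (future_timelike_vec S)"

text \<open>
  A curve is extendible at an end of its parameter interval iff it converges there to a point of the
  manifold; this includes the case in which the interval contains that end. ``Upper'' refers to
  increasing parameter, which is the future for future directed curves.
\<close>

definition upper_inextendible ::
  "'a::euclidean_space set \<Rightarrow> real set \<Rightarrow> (real \<Rightarrow> 'a) \<Rightarrow> bool" where
  "upper_inextendible M J \<gamma> \<longleftrightarrow>
     \<not> (\<exists>q\<in>M. \<forall>U. open U \<and> q \<in> U \<longrightarrow> (\<exists>s0\<in>J. \<forall>s\<in>J. s0 \<le> s \<longrightarrow> \<gamma> s \<in> U))"

definition lower_inextendible ::
  "'a::euclidean_space set \<Rightarrow> real set \<Rightarrow> (real \<Rightarrow> 'a) \<Rightarrow> bool" where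
  "lower_inextendible M J \<gamma> \<longleftrightarrow>
     \<not> (\<exists>q\<in>M. \<forall>U. open U \<and> q \<in> U \<longrightarrow> (\<exists>s0\<in>J. \<forall>s\<in>J. s \<le> s0 \<longrightarrow> \<gamma> s \<in> U))"

definition inextendible ::
  "'a::euclidean_space set \<Rightarrow> real set \<Rightarrow> (real \<Rightarrow> 'a) \<Rightarrow> bool" where
  "inextendible M J \<gamma> \<longleftrightarrow> upper_inextendible M J \<gamma> \<and> lower_inextendible M J \<gamma>"

definition causal_past :: "'a::euclidean_space spacetime \<Rightarrow> 'a set \<Rightarrow> 'a set" where
  "causal_past S A =
     {p\<in>points S. p \<in> A \<or>
        (\<exists>\<gamma> a b. a < b \<and> future_causal_curve S {a..b} \<gamma> \<and> \<gamma> a = p \<and> \<gamma> b \<in> A)}"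

definition cauchy_surface :: "'a::euclidean_space spacetime \<Rightarrow> 'a set \<Rightarrow> bool" where
  "cauchy_surface S C \<longleftrightarrow> C \<subseteq> points S \<and>
     (\<forall>J \<gamma>. future_timelike_curve S J \<gamma> \<and> inextendible (points S) J \<gamma> \<longrightarrow>
        (\<exists>!s. s \<in> J \<and> \<gamma> s \<in> C))"

definition globally_hyperbolic :: "'a::euclidean_space spacetime \<Rightarrow> bool" where
  "globally_hyperbolic S \<longleftrightarrow> (\<exists>C. cauchy_surface S C)"

definition causal_geodesically_incomplete :: "'a::euclidean_space spacetime \<Rightarrow> bool" where
  "causal_geodesically_incomplete S \<longleftrightarrow>
     (\<exists>J \<gamma>. geodesic S J \<gamma> \<and> (\<forall>s\<in>J. causal_vec S (\<gamma> s) (vector_derivative \<gamma> (at s))) \<and>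
        inextendible (points S) J \<gamma> \<and> J \<noteq> UNIV)"

definition future_causal_geodesically_complete :: "'a::euclidean_space spacetime \<Rightarrow> bool" where
  "future_causal_geodesically_complete S \<longleftrightarrow>
     (\<forall>J \<gamma>. geodesic S J \<gamma> \<and> (\<forall>s\<in>J. future_causal_vec S (\<gamma> s) (vector_derivative \<gamma> (at s))) \<and>
        upper_inextendible (points S) J \<gamma> \<longrightarrow> \<not> bdd_above J)"


subsection \<open>Nariai asymptotics\<close>

definition oblivious_to_topology :: "'a::euclidean_space spacetime \<Rightarrow> bool" where
  "oblivious_to_topology S \<longleftrightarrow>
     (\<exists>C. cauchy_surface S C \<and>
        \<not> (\<exists>J \<gamma>. future_causal_curve S J \<gamma> \<and> inextendible (points S) J \<gamma> \<and>
              C \<subseteq> causal_past S (\<gamma> ` J)))"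

text \<open>Both open and closed balls are admitted as Euclidean 3-balls.\<close>

definition completely_oblivious_to_topology :: "'a::euclidean_space spacetime \<Rightarrow> bool" where
  "completely_oblivious_to_topology S \<longleftrightarrow>
     (\<exists>C. cauchy_surface S C \<and>
        (\<forall>J \<gamma>. future_causal_curve S J \<gamma> \<and> upper_inextendible (points S) J \<gamma> \<longrightarrow>
           (\<exists>B\<subseteq>C. (B homeomorphic ball (0::real^3) 1 \<or> B homeomorphic cball (0::real^3) 1) \<and>
              C \<inter> causal_past S (\<gamma> ` J) \<subseteq> B)))"

definition nariai_asymptotics :: "'a::euclidean_space spacetime \<Rightarrow> bool" where
  "nariai_asymptotics S \<longleftrightarrow>
     future_causal_geodesically_complete S \<and> globally_hyperbolic S \<and>
     oblivious_to_topology S \<and> \<not> completely_oblivious_to_topology S"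


subsection \<open>The generalized Nariai solutions\<close>

definition nariai_warp :: "real \<Rightarrow> real \<Rightarrow> real \<Rightarrow> real" where
  "nariai_warp a b t = a * cosh t + b * sinh t"

definition nariai_interval :: "real \<Rightarrow> real \<Rightarrow> real set" where
  "nariai_interval a b = connected_component_set {t. nariai_warp a b t > 0} 0"

text \<open>
  The spatial factor carrying \<open>\<rho>\<close> is either the real line or the unit circle in the complex
  plane. In both cases \<open>d\<rho>\<^sup>2\<close> is the restriction of the Euclidean inner product to
  tangent vectors, and likewise for the round metric of the unit sphere.
\<close>

definition nariai_on ::
  "'r::euclidean_space set \<Rightarrow> real \<Rightarrow> real \<Rightarrow> real \<Rightarrow> (real \<times> 'r \<times> (real^3)) spacetime" where
  "nariai_on R \<Lambda> a b =
     \<lparr>points = nariai_interval a b \<times> R \<times> sphere 0 1,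
      metric = (\<lambda>(t, _, _) (v, x, y) (v', x', y').
        1 / \<Lambda> * (- (v * v') + (nariai_warp a b t)\<^sup>2 * (x \<bullet> x') + y \<bullet> y')),
      time_dir = (\<lambda>_. (1, 0, 0))\<rparr>"

definition nariai :: "real \<Rightarrow> real \<Rightarrow> real \<Rightarrow> (real \<times> complex \<times> (real^3)) spacetime" where
  "nariai = nariai_on (sphere 0 1)"

definition nariai_cover :: "real \<Rightarrow> real \<Rightarrow> real \<Rightarrow> (real \<times> real \<times> (real^3)) spacetime" where
  "nariai_cover = nariai_on UNIV"

end

theory Submission
  imports Defs "HOL-Complex_Analysis.Cauchy_Integral_Formula"
begin

text \<open>
  Part (1). The two-dimensional factor of a generalized Nariai solution has constant curvature. If
  \<open>\<sigma>\<^sub>0 > 0\<close> then \<open>\<Phi>\<close> is a translate of a multiple of \<open>cosh\<close>. Otherwise the factor is mapped into the de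
  Sitter hyperboloid in Minkowski 3-space, the curves of constant \<open>\<rho>\<close> going to the geodesics
  \<open>cosh t P + sinh t N\<close>, where the unit vectors \<open>P, N\<close> are moved along by a one-parameter group of
  boosts or null rotations. Reading off the global coordinates of the hyperboloid gives the embedding.

  Part (2). If \<open>\<sigma>\<^sub>0 < 0\<close> the interval is a half line and the comoving geodesics are incomplete; if
  \<open>\<sigma>\<^sub>0 = 0\<close> the null geodesic \<open>t = \<plusminus>ln s, \<rho> = -1 / (\<Phi>\<^sub>0 s)\<close> is.

  Part (3). Choose the time direction in which \<open>\<Phi>\<close> grows. Along a future causal geodesic
  \<open>t'' = - \<Phi> \<Phi>' \<rho>'\<^sup>2\<close>, so \<open>t'\<close> (where \<open>\<Phi>' \<ge> 0\<close>) or \<open>\<Phi> t'\<close> (where \<open>\<Phi>' \<le> 0\<close>) decreases, the velocity stays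
  bounded and the geodesic is complete. Since \<open>1 / \<Phi>\<close> is integrable towards the future, the past of an
  observer meets \<open>t = 0\<close> in a set that is bounded in \<open>\<rho>\<close>. On the other hand the past of the observer
  \<open>\<rho> = 0\<close>, \<open>y = y0\<close> contains the whole of \<open>\<rho> = 0\<close>, whose intersection with any Cauchy surface is the graph of
  a continuous function on the 2-sphere. If it lay in a ball, the projection to the sphere factor
  would show that the sphere is contractible.
\<close>

subsection \<open>Power series in several variables\<close>

text \<open>Two obstacles shape the proof. First, a geodesic comes with an arbitrary analytic chart
  around each of its points, and Christoffel symbols of an unknown chart cannot be computed.
  Lowering the index and using the symmetry of the second derivative of the chart turns the geodesic
  equation into a condition on velocity and acceleration in the ambient space, from which the chart
  has disappeared. That symmetry, like all closure properties of analytic maps, is derived from the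
  multi-index series themselves. Second, the embedding for \<sigma>0 \<le> 0 must treat boosts and
  null rotations at once. With \<kappa> = \<Phi>0'^2 - \<Phi>0^2 = k^2 the moving frame is a
  combination of sinh (k x) / k and (cosh (k x) - 1) / k^2, which make sense at k = 0. The linear
  form \<Phi>0 X0 + \<Phi>0' X1 is invariant under the group and equals \<Phi>' on the image, so it
  recovers t. Continuity of the graph in (3) holds because no timelike curve meets a Cauchy surface
  twice: the height over the sphere changes by at most the great circle distance.\<close>

abbreviation multi_indices :: "('a::euclidean_space \<Rightarrow> nat) set" where
  "multi_indices \<equiv> Basis \<rightarrow>\<^sub>E UNIV"

definition mono_at :: "('a::euclidean_space \<Rightarrow> nat) \<Rightarrow> 'a \<Rightarrow> real" where
  "mono_at \<alpha> z = (\<Prod>b\<in>Basis. (z \<bullet> b) ^ \<alpha> b)"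

definition mdeg :: "('a::euclidean_space \<Rightarrow> nat) \<Rightarrow> nat" where
  "mdeg \<alpha> = (\<Sum>b\<in>Basis. \<alpha> b)"

text \<open>The closed real polydisc. On it a monomial is bounded by
  \<open>r ^ mdeg \<alpha>\<close>, with equality at a corner, so absolute convergence at one corner
  is the same as finiteness of the weighted norm; a Euclidean ball has no such corner.\<close>

definition cube :: "'a::euclidean_space \<Rightarrow> real \<Rightarrow> 'a set" where
  "cube x r = {y. \<forall>b\<in>Basis. \<bar>(y - x) \<bullet> b\<bar> \<le> r}"

text \<open>
  \<open>B\<close> bounds a weighted \<open>l\<^sup>1\<close> norm of the coefficients. This norm is submultiplicative, hence products
  and compositions of power series converge.
\<close>

definition has_pseries :: "'a::euclidean_space \<Rightarrow> real \<Rightarrow> real \<Rightarrow> ('a \<Rightarrow> real) \<Rightarrow> bool" where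
  "has_pseries x r B f \<longleftrightarrow> (\<exists>c. (\<lambda>\<alpha>. \<bar>c \<alpha>\<bar> * r ^ mdeg \<alpha>) summable_on multi_indices \<and>
     (\<Sum>\<^sub>\<infinity>\<alpha>\<in>multi_indices. \<bar>c \<alpha>\<bar> * r ^ mdeg \<alpha>) \<le> B \<and>
     (\<forall>y\<in>cube x r. ((\<lambda>\<alpha>. c \<alpha> * mono_at \<alpha> (y - x)) has_sum f y) multi_indices))"

lemma abs_mono_at_le:
  assumes "y \<in> cube x r"
  shows "\<bar>mono_at \<alpha> (y - x)\<bar> \<le> r ^ mdeg \<alpha>"
proof -
  have "\<bar>mono_at \<alpha> (y - x)\<bar> = (\<Prod>b\<in>Basis. \<bar>(y - x) \<bullet> b\<bar> ^ \<alpha> b)"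
    by (simp add: mono_at_def abs_prod power_abs)
  also have "\<dots> \<le> (\<Prod>b\<in>Basis. r ^ \<alpha> b)"
    using assms by (intro prod_mono) (auto simp: cube_def intro!: power_mono)
  also have "\<dots> = r ^ mdeg \<alpha>"
    by (simp add: mdeg_def power_sum)
  finally show ?thesis .
qed

text \<open>The workhorse behind products and compositions. The hypotheses make the nonnegative
  double series over \<open>A\<close> and the multi-indices summable, so both the majorant and the
  signed series may be summed in either order; summing over \<open>A\<close> first gives the new
  coefficients.\<close>

lemma has_pseries_infsum:
  fixes g :: "'i \<Rightarrow> 'a::euclidean_space \<Rightarrow> real"
  assumes r: "r > 0"
    and g: "\<And>i. i \<in> A \<Longrightarrow> has_pseries x r (B i) (g i)"
    and B: "(B has_sum S) A"
    and f: "\<And>y. y \<in> cube x r \<Longrightarrow> ((\<lambda>i. g i y) has_sum f y) A"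
  shows "has_pseries x r S f"
proof -
  have "\<forall>i\<in>A. \<exists>c. (\<lambda>\<alpha>. \<bar>c \<alpha>\<bar> * r ^ mdeg \<alpha>) summable_on multi_indices \<and>
     (\<Sum>\<^sub>\<infinity>\<alpha>\<in>multi_indices. \<bar>c \<alpha>\<bar> * r ^ mdeg \<alpha>) \<le> B i \<and>
     (\<forall>y\<in>cube x r. ((\<lambda>\<alpha>. c \<alpha> * mono_at \<alpha> (y - x)) has_sum g i y) multi_indices)"
    using g unfolding has_pseries_def by (rule ballI)
  from bchoice[OF this] obtain c where c: "\<forall>i\<in>A. (\<lambda>\<alpha>. \<bar>c i \<alpha>\<bar> * r ^ mdeg \<alpha>) summable_on multi_indices \<and>
     (\<Sum>\<^sub>\<infinity>\<alpha>\<in>multi_indices. \<bar>c i \<alpha>\<bar> * r ^ mdeg \<alpha>) \<le> B i \<and>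
     (\<forall>y\<in>cube x r. ((\<lambda>\<alpha>. c i \<alpha> * mono_at \<alpha> (y - x)) has_sum g i y) multi_indices)"
    by (rule exE)
  then have c1: "\<And>i. i \<in> A \<Longrightarrow> (\<lambda>\<alpha>. \<bar>c i \<alpha>\<bar> * r ^ mdeg \<alpha>) summable_on multi_indices"
    and c2: "\<And>i. i \<in> A \<Longrightarrow> (\<Sum>\<^sub>\<infinity>\<alpha>\<in>multi_indices. \<bar>c i \<alpha>\<bar> * r ^ mdeg \<alpha>) \<le> B i"
    and c3: "\<And>i y. i \<in> A \<Longrightarrow> y \<in> cube x r \<Longrightarrow>
        ((\<lambda>\<alpha>. c i \<alpha> * mono_at \<alpha> (y - x)) has_sum g i y) multi_indices"
    by simp_all
  define s where "s i = (\<Sum>\<^sub>\<infinity>\<alpha>\<in>multi_indices. \<bar>c i \<alpha>\<bar> * r ^ mdeg \<alpha>)" for i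
  \<comment> \<open>Nonnegative majorant of the double series. Its row sums are \<open>s\<close>,
    bounded by \<open>B\<close>; its column sums \<open>u\<close> will bound the new
    coefficients.\<close>
  define Q where "Q = (\<lambda>(i, \<alpha>). \<bar>c i \<alpha>\<bar> * r ^ mdeg \<alpha>)"
  have s0: "0 \<le> s i" for i
    unfolding s_def using r by (intro infsum_nonneg) auto
  have Bsum: "B summable_on A"
    using B by (rule has_sum_imp_summable)
  have s_sum: "s summable_on A"
    by (rule summable_on_comparison_test[OF Bsum]) (use c2 s0 in \<open>auto simp: s_def\<close>)
  have s_le: "infsum s A \<le> S"
    using infsum_mono[OF s_sum Bsum] c2 infsumI[OF B] by (auto simp: s_def)
  have Qs: "((\<lambda>\<alpha>. Q (i, \<alpha>)) has_sum s i) multi_indices" if "i \<in> A" for i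
    using c1[OF that] by (simp add: Q_def s_def)
  have Q: "Q summable_on (A \<times> multi_indices)"
    by (rule summable_on_SigmaI[OF Qs s_sum]) (use r in \<open>auto simp: Q_def\<close>)
  have QhS: "(Q has_sum infsum s A) (A \<times> multi_indices)"
    by (rule has_sum_SigmaI[OF Qs _ Q]) (use s_sum in auto)
  have QhS': "((\<lambda>(\<alpha>, i). Q (i, \<alpha>)) has_sum infsum s A) (multi_indices \<times> A)"
    using QhS has_sum_swap[where f = Q and A = A and B = multi_indices] by simp
  have c_sum: "(\<lambda>i. \<bar>c i \<alpha>\<bar>) summable_on A" if "\<alpha> \<in> multi_indices" for \<alpha>
  proof -
    have "(\<lambda>i. Q (i, \<alpha>)) summable_on A"
      using summable_on_SigmaD1[OF has_sum_imp_summable[OF QhS'] that] by simp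
    then have "(\<lambda>i. Q (i, \<alpha>) * (1 / r ^ mdeg \<alpha>)) summable_on A"
      by (rule summable_on_cmult_left)
    then show ?thesis using r by (simp add: Q_def)
  qed
  define d where "d \<alpha> = (\<Sum>\<^sub>\<infinity>i\<in>A. c i \<alpha>)" for \<alpha>
  define u where "u \<alpha> = (\<Sum>\<^sub>\<infinity>i\<in>A. Q (i, \<alpha>))" for \<alpha>
  have uu: "((\<lambda>i. Q (i, \<alpha>)) has_sum u \<alpha>) A" if "\<alpha> \<in> multi_indices" for \<alpha>
    unfolding u_def Q_def using summable_on_cmult_left[OF c_sum[OF that], of "r ^ mdeg \<alpha>"] by simp
  have u: "(u has_sum infsum s A) multi_indices"
    by (rule has_sum_SigmaD[OF QhS']) (use uu in auto)
  have c_sum': "(\<lambda>i. c i \<alpha>) summable_on A" if "\<alpha> \<in> multi_indices" for \<alpha>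
    using c_sum[OF that] by (subst summable_on_iff_abs_summable_on_real) simp
  have du: "\<bar>d \<alpha>\<bar> * r ^ mdeg \<alpha> \<le> u \<alpha>" if "\<alpha> \<in> multi_indices" for \<alpha>
  proof -
    have "\<bar>d \<alpha>\<bar> \<le> (\<Sum>\<^sub>\<infinity>i\<in>A. \<bar>c i \<alpha>\<bar>)"
      unfolding d_def using norm_infsum_bound[of "\<lambda>i. c i \<alpha>" A] c_sum[OF that] by simp
    then have "\<bar>d \<alpha>\<bar> * r ^ mdeg \<alpha> \<le> (\<Sum>\<^sub>\<infinity>i\<in>A. \<bar>c i \<alpha>\<bar>) * r ^ mdeg \<alpha>"
      using r by (intro mult_right_mono) auto
    also have "\<dots> = u \<alpha>"
      unfolding u_def Q_def by (simp add: infsum_cmult_left')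
    finally show ?thesis .
  qed
  have d_sum: "(\<lambda>\<alpha>. \<bar>d \<alpha>\<bar> * r ^ mdeg \<alpha>) summable_on multi_indices"
    by (rule summable_on_comparison_test[OF has_sum_imp_summable[OF u]]) (use du r in auto)
  have d_le: "(\<Sum>\<^sub>\<infinity>\<alpha>\<in>multi_indices. \<bar>d \<alpha>\<bar> * r ^ mdeg \<alpha>) \<le> S"
    using infsum_mono[OF d_sum has_sum_imp_summable[OF u] du] infsumI[OF u] s_le by auto
  have "((\<lambda>\<alpha>. d \<alpha> * mono_at \<alpha> (y - x)) has_sum f y) multi_indices" if y: "y \<in> cube x r" for y
  proof -
    define R where "R = (\<lambda>(i, \<alpha>). c i \<alpha> * mono_at \<alpha> (y - x))"
    have "(\<lambda>p. norm (R p)) summable_on (A \<times> multi_indices)"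
    proof (rule summable_on_comparison_test[OF Q])
      fix p :: "'i \<times> ('a \<Rightarrow> nat)" assume "p \<in> A \<times> multi_indices"
      show "norm (R p) \<le> Q p"
        unfolding R_def Q_def using abs_mono_at_le[OF y]
        by (auto simp: abs_mult split: prod.splits intro!: mult_left_mono)
    qed auto
    then have Rs: "R summable_on (A \<times> multi_indices)"
      by (subst summable_on_iff_abs_summable_on_real) simp
    have R: "(R has_sum f y) (A \<times> multi_indices)"
      by (rule has_sum_SigmaI[OF _ f[OF y] Rs]) (use c3 y in \<open>auto simp: R_def\<close>)
    have R': "((\<lambda>(\<alpha>, i). R (i, \<alpha>)) has_sum f y) (multi_indices \<times> A)"
      using R has_sum_swap[where f = R and A = A and B = multi_indices] by simp
    show ?thesis
    proof (rule has_sum_SigmaD[OF R'])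
      fix \<alpha> assume "\<alpha> \<in> (multi_indices :: ('a \<Rightarrow> nat) set)"
      then have "((\<lambda>i. c i \<alpha>) has_sum d \<alpha>) A"
        unfolding d_def using c_sum' by auto
      then show "((\<lambda>i. case (\<alpha>, i) of (\<alpha>, i) \<Rightarrow> R (i, \<alpha>)) has_sum d \<alpha> * mono_at \<alpha> (y - x)) A"
        unfolding R_def by (auto intro: has_sum_cmult_left)
    qed
  qed
  then show ?thesis
    unfolding has_pseries_def using d_sum d_le by (intro exI[of _ d]) simp
qed

lemma has_pseries_cong:
  assumes "has_pseries x r B f" "\<And>y. y \<in> cube x r \<Longrightarrow> f y = g y"
  shows "has_pseries x r B g"
  using assms unfolding has_pseries_def by simp

lemma has_pseries_mono_at:
  assumes "\<alpha> \<in> multi_indices" "r > 0"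
  shows "has_pseries x r (\<bar>k\<bar> * r ^ mdeg \<alpha>) (\<lambda>y. k * mono_at \<alpha> (y - x))"
proof -
  let ?c = "\<lambda>\<beta>. if \<beta> = \<alpha> then k else 0"
  have 1: "((\<lambda>\<beta>. \<bar>?c \<beta>\<bar> * r ^ mdeg \<beta>) has_sum (\<bar>k\<bar> * r ^ mdeg \<alpha>)) multi_indices"
    by (rule has_sum_finite_neutralI[of "{\<alpha>}"]) (use assms in auto)
  have 2: "((\<lambda>\<beta>. ?c \<beta> * mono_at \<beta> (y - x)) has_sum (k * mono_at \<alpha> (y - x))) multi_indices" for y
    by (rule has_sum_finite_neutralI[of "{\<alpha>}"]) (use assms in auto)
  show ?thesis
    unfolding has_pseries_def
    by (rule exI[of _ ?c]) (use has_sum_imp_summable[OF 1] infsumI[OF 1] 2 in auto)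
qed

lemma has_pseries_decreasing:
  assumes "has_pseries x r B f" "0 < s" "s \<le> r"
  shows "has_pseries x s B f"
proof -
  obtain c where c: "(\<lambda>\<alpha>. \<bar>c \<alpha>\<bar> * r ^ mdeg \<alpha>) summable_on multi_indices"
     "(\<Sum>\<^sub>\<infinity>\<alpha>\<in>multi_indices. \<bar>c \<alpha>\<bar> * r ^ mdeg \<alpha>) \<le> B"
     "\<And>y. y\<in>cube x r \<Longrightarrow> ((\<lambda>\<alpha>. c \<alpha> * mono_at \<alpha> (y - x)) has_sum f y) multi_indices"
    using assms(1) unfolding has_pseries_def by blast
  have le: "\<bar>c \<alpha>\<bar> * s ^ mdeg \<alpha> \<le> \<bar>c \<alpha>\<bar> * r ^ mdeg \<alpha>" for \<alpha>
    using assms by (intro mult_left_mono power_mono) auto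
  have s: "(\<lambda>\<alpha>. \<bar>c \<alpha>\<bar> * s ^ mdeg \<alpha>) summable_on multi_indices"
    by (rule summable_on_comparison_test[OF c(1) le]) (use assms in auto)
  have "cube x s \<subseteq> cube x r"
    using assms by (auto simp: cube_def intro: order_trans)
  then show ?thesis
    unfolding has_pseries_def
    using s infsum_mono[OF s c(1) le] c(2,3) by (intro exI[of _ c]) auto
qed

lemma has_pseries_bound_nonneg:
  assumes "has_pseries x r B f" "r > 0" shows "0 \<le> B"
proof -
  obtain c :: "('a \<Rightarrow> nat) \<Rightarrow> real" where "(\<Sum>\<^sub>\<infinity>\<alpha>\<in>multi_indices. \<bar>c \<alpha>\<bar> * r ^ mdeg \<alpha>) \<le> B"
    using assms(1) unfolding has_pseries_def by blast
  moreover have "0 \<le> (\<Sum>\<^sub>\<infinity>\<alpha>\<in>multi_indices. \<bar>c \<alpha>\<bar> * r ^ mdeg \<alpha>)"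
    using assms(2) by (intro infsum_nonneg) auto
  ultimately show ?thesis by linarith
qed

lemma has_pseries_weaken: "has_pseries x r B f \<Longrightarrow> B \<le> B' \<Longrightarrow> has_pseries x r B' f"
  unfolding has_pseries_def by (meson order_trans)

lemma has_pseries_sum:
  assumes "r > 0" "finite A" "\<And>i. i \<in> A \<Longrightarrow> has_pseries x r (B i) (g i)"
  shows "has_pseries x r (\<Sum>i\<in>A. B i) (\<lambda>y. \<Sum>i\<in>A. g i y)"
  by (rule has_pseries_infsum[OF assms(1,3)]) (use assms(2) in \<open>auto intro!: has_sum_finite\<close>)

lemma has_pseries_const:
  assumes "r > 0" shows "has_pseries x r \<bar>k\<bar> (\<lambda>_. k)"
  using has_pseries_mono_at[of "\<lambda>b\<in>Basis. 0" r x k] assms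
  by (simp add: mono_at_def mdeg_def)

lemma mono_at_add:
  "mono_at (\<lambda>b\<in>Basis. \<alpha> b + \<beta> b) z = mono_at \<alpha> z * mono_at \<beta> z"
  by (simp add: mono_at_def power_add prod.distrib)

lemma mdeg_add: "mdeg (\<lambda>b\<in>Basis. \<alpha> b + \<beta> b) = mdeg \<alpha> + mdeg \<beta>"
  by (simp add: mdeg_def sum.distrib)

text \<open>Multiplication by a monomial only shifts exponents, so it scales the weighted norm by
  exactly the weight of the monomial.\<close>

lemma has_pseries_mono_at_mult:
  assumes r: "r > 0" and g: "has_pseries x r B g"
  shows "has_pseries x r (\<bar>k\<bar> * r ^ mdeg \<alpha> * B) (\<lambda>y. k * mono_at \<alpha> (y - x) * g y)"
proof -
  obtain c where c: "(\<lambda>\<alpha>. \<bar>c \<alpha>\<bar> * r ^ mdeg \<alpha>) summable_on multi_indices"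
     "(\<Sum>\<^sub>\<infinity>\<alpha>\<in>multi_indices. \<bar>c \<alpha>\<bar> * r ^ mdeg \<alpha>) \<le> B"
     "\<And>y. y\<in>cube x r \<Longrightarrow> ((\<lambda>\<alpha>. c \<alpha> * mono_at \<alpha> (y - x)) has_sum g y) multi_indices"
    using g unfolding has_pseries_def by blast
  have "has_pseries x r (\<bar>k\<bar> * r ^ mdeg \<alpha> * (\<Sum>\<^sub>\<infinity>\<alpha>\<in>multi_indices. \<bar>c \<alpha>\<bar> * r ^ mdeg \<alpha>))
      (\<lambda>y. k * mono_at \<alpha> (y - x) * g y)"
  proof (rule has_pseries_infsum[OF r])
    fix \<beta> :: "'a \<Rightarrow> nat"
    show "has_pseries x r (\<bar>k * c \<beta>\<bar> * r ^ mdeg (\<lambda>b\<in>Basis. \<alpha> b + \<beta> b))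
            (\<lambda>y. k * c \<beta> * mono_at (\<lambda>b\<in>Basis. \<alpha> b + \<beta> b) (y - x))"
      by (rule has_pseries_mono_at) (use r in auto)
  next
    have "((\<lambda>\<beta>. \<bar>k\<bar> * r ^ mdeg \<alpha> * (\<bar>c \<beta>\<bar> * r ^ mdeg \<beta>)) has_sum
       \<bar>k\<bar> * r ^ mdeg \<alpha> * (\<Sum>\<^sub>\<infinity>\<alpha>\<in>multi_indices. \<bar>c \<alpha>\<bar> * r ^ mdeg \<alpha>)) multi_indices"
      by (rule has_sum_cmult_right) (use c in simp)
    then show "((\<lambda>\<beta>. \<bar>k * c \<beta>\<bar> * r ^ mdeg (\<lambda>b\<in>Basis. \<alpha> b + \<beta> b)) has_sum
       \<bar>k\<bar> * r ^ mdeg \<alpha> * (\<Sum>\<^sub>\<infinity>\<alpha>\<in>multi_indices. \<bar>c \<alpha>\<bar> * r ^ mdeg \<alpha>)) multi_indices"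
      by (simp add: mdeg_add power_add abs_mult mult_ac)
  next
    fix y assume "y \<in> cube x r"
    then have "((\<lambda>\<beta>. k * mono_at \<alpha> (y - x) * (c \<beta> * mono_at \<beta> (y - x))) has_sum
        k * mono_at \<alpha> (y - x) * g y) multi_indices"
      by (intro has_sum_cmult_right c)
    then show "((\<lambda>\<beta>. k * c \<beta> * mono_at (\<lambda>b\<in>Basis. \<alpha> b + \<beta> b) (y - x)) has_sum
        k * mono_at \<alpha> (y - x) * g y) multi_indices"
      by (simp add: mono_at_add mult_ac)
  qed
  then show ?thesis
    by (rule has_pseries_weaken) (use r c in \<open>auto intro!: mult_left_mono\<close>)
qed

text \<open>No Cauchy product is written out: \<open>f\<close> is a sum of monomials, each monomial
  times \<open>g\<close> is a series already, and \<open>has_pseries_infsum\<close> collects the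
  coefficients.\<close>

lemma has_pseries_mult:
  assumes r: "r > 0" and f: "has_pseries x r A f" and g: "has_pseries x r B g"
  shows "has_pseries x r (A * B) (\<lambda>y. f y * g y)"
proof -
  obtain c where c: "(\<lambda>\<alpha>. \<bar>c \<alpha>\<bar> * r ^ mdeg \<alpha>) summable_on multi_indices"
     "(\<Sum>\<^sub>\<infinity>\<alpha>\<in>multi_indices. \<bar>c \<alpha>\<bar> * r ^ mdeg \<alpha>) \<le> A"
     "\<And>y. y\<in>cube x r \<Longrightarrow> ((\<lambda>\<alpha>. c \<alpha> * mono_at \<alpha> (y - x)) has_sum f y) multi_indices"
    using f unfolding has_pseries_def by blast
  have "has_pseries x r ((\<Sum>\<^sub>\<infinity>\<alpha>\<in>multi_indices. \<bar>c \<alpha>\<bar> * r ^ mdeg \<alpha>) * B) (\<lambda>y. f y * g y)"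
  proof (rule has_pseries_infsum[OF r, where A = multi_indices and
        B = "\<lambda>\<alpha>. \<bar>c \<alpha>\<bar> * r ^ mdeg \<alpha> * B" and g = "\<lambda>\<alpha> y. c \<alpha> * mono_at \<alpha> (y - x) * g y"])
    fix \<alpha> :: "'a \<Rightarrow> nat"
    show "has_pseries x r (\<bar>c \<alpha>\<bar> * r ^ mdeg \<alpha> * B) (\<lambda>y. c \<alpha> * mono_at \<alpha> (y - x) * g y)"
      by (rule has_pseries_mono_at_mult[OF r g])
  qed (use c in \<open>auto intro!: has_sum_cmult_left\<close>)
  then show ?thesis
    by (rule has_pseries_weaken) (use has_pseries_bound_nonneg[OF g r] c in \<open>auto intro!: mult_right_mono\<close>)
qed

lemma has_pseries_power:
  assumes "r > 0" "has_pseries x r A f"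
  shows "has_pseries x r (A ^ n) (\<lambda>y. f y ^ n)"
proof (induction n)
  case 0
  then show ?case using has_pseries_const[OF assms(1), of x 1] by simp
next
  case (Suc n)
  then show ?case using has_pseries_mult[OF assms(1,2) Suc] by simp
qed

lemma has_pseries_prod:
  assumes "r > 0" "finite I" "\<And>i. i \<in> I \<Longrightarrow> has_pseries x r (A i) (f i)"
  shows "has_pseries x r (\<Prod>i\<in>I. A i) (\<lambda>y. \<Prod>i\<in>I. f i y)"
  using assms(2,3)
proof (induction I rule: finite_induct)
  case empty
  then show ?case using has_pseries_const[OF assms(1), of x 1] by simp
next
  case (insert i I)
  then show ?case using has_pseries_mult[OF assms(1), of x "A i" "f i" "\<Prod>i\<in>I. A i"] by simp
qed

lemma center_in_cube: "r > 0 \<Longrightarrow> x \<in> cube x r"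
  by (simp add: cube_def)

text \<open>The series of \<open>f y - f x\<close> has no constant term, so each of its terms
  contains the radius at least once and passing from \<open>r\<close> to \<open>s'\<close> costs a
  factor \<open>s' / r\<close> of the norm.\<close>

lemma has_pseries_shrink:
  assumes r: "r > 0" and f: "has_pseries x r B f" and e: "e > 0"
  obtains s where "0 < s" "s \<le> r" "\<And>s'. 0 < s' \<Longrightarrow> s' \<le> s \<Longrightarrow> has_pseries x s' e (\<lambda>y. f y - f x)"
proof -
  obtain c where c: "(\<lambda>\<alpha>. \<bar>c \<alpha>\<bar> * r ^ mdeg \<alpha>) summable_on multi_indices"
     "(\<Sum>\<^sub>\<infinity>\<alpha>\<in>multi_indices. \<bar>c \<alpha>\<bar> * r ^ mdeg \<alpha>) \<le> B"
     "\<And>y. y\<in>cube x r \<Longrightarrow> ((\<lambda>\<alpha>. c \<alpha> * mono_at \<alpha> (y - x)) has_sum f y) multi_indices"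
    using f unfolding has_pseries_def by blast
  have B: "0 \<le> B" using has_pseries_bound_nonneg[OF f r] .
  define z :: "'a \<Rightarrow> nat" where "z = (\<lambda>b\<in>Basis. 0)"
  have z: "z \<in> multi_indices" by (simp add: z_def)
  have deg0: "mdeg \<alpha> = 0 \<longleftrightarrow> \<alpha> = z" if "\<alpha> \<in> multi_indices" for \<alpha> :: "'a \<Rightarrow> nat"
    using that by (auto simp: mdeg_def z_def fun_eq_iff PiE_def extensional_def)
  have mono_x: "mono_at \<alpha> 0 = 0" if "\<alpha> \<in> multi_indices" "\<alpha> \<noteq> z" for \<alpha> :: "'a \<Rightarrow> nat"
  proof -
    have "mdeg \<alpha> \<noteq> 0" using deg0 that by auto
    then obtain b where "b \<in> Basis" "\<alpha> b \<noteq> 0" by (auto simp: mdeg_def)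
    then show ?thesis by (auto simp: mono_at_def intro!: prod_zero)
  qed
  have mz: "mono_at z w = 1" for w by (simp add: mono_at_def z_def)
  have "((\<lambda>\<alpha>. c \<alpha> * mono_at \<alpha> (x - x)) has_sum (c z)) multi_indices"
    by (rule has_sum_finite_neutralI[of "{z}"]) (use z mono_x mz in auto)
  then have fx: "f x = c z"
    using c(3)[OF center_in_cube[OF r]] has_sum_unique by blast
  define d where "d \<alpha> = (if \<alpha> = z then 0 else c \<alpha>)" for \<alpha>
  \<comment> \<open>This makes \<open>s' / r * B\<close> at most \<open>e * B / (B + 1)\<close>,
    hence at most \<open>e\<close>; the 1 covers the case \<open>B = 0\<close>.\<close>
  define s where "s = min r (r * e / (B + 1))"
  have s: "0 < s" "s \<le> r" using r e B by (auto simp: s_def)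
  have "has_pseries x s' e (\<lambda>y. f y - f x)" if s': "0 < s'" "s' \<le> s" for s'
  proof -
    have le: "\<bar>d \<alpha>\<bar> * s' ^ mdeg \<alpha> \<le> (s' / r) * (\<bar>c \<alpha>\<bar> * r ^ mdeg \<alpha>)"
      if "\<alpha> \<in> multi_indices" for \<alpha>
    proof (cases "\<alpha> = z")
      case False
      then have "mdeg \<alpha> \<noteq> 0" using deg0 \<open>\<alpha> \<in> multi_indices\<close> by auto
      then obtain n where n: "mdeg \<alpha> = Suc n" by (cases "mdeg \<alpha>") auto
      have "s' ^ n \<le> r ^ n" using s s' by (intro power_mono) auto
      then have "\<bar>c \<alpha>\<bar> * s' * s' ^ n \<le> \<bar>c \<alpha>\<bar> * s' * r ^ n" using s' by (intro mult_left_mono) auto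
      then show ?thesis using False r n by (simp add: d_def field_simps)
    qed (use r s' in \<open>auto simp: d_def\<close>)
    have sm: "(\<lambda>\<alpha>. (s' / r) * (\<bar>c \<alpha>\<bar> * r ^ mdeg \<alpha>)) summable_on multi_indices"
      by (intro summable_on_cmult_right c)
    have sm': "(\<lambda>\<alpha>. \<bar>d \<alpha>\<bar> * s' ^ mdeg \<alpha>) summable_on multi_indices"
      by (rule summable_on_comparison_test[OF sm le]) (use s' in auto)
    have "(\<Sum>\<^sub>\<infinity>\<alpha>\<in>multi_indices. \<bar>d \<alpha>\<bar> * s' ^ mdeg \<alpha>) \<le> (\<Sum>\<^sub>\<infinity>\<alpha>\<in>multi_indices. (s' / r) * (\<bar>c \<alpha>\<bar> * r ^ mdeg \<alpha>))"
      by (rule infsum_mono[OF sm' sm le])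
    also have "\<dots> = (s' / r) * (\<Sum>\<^sub>\<infinity>\<alpha>\<in>multi_indices. (\<bar>c \<alpha>\<bar> * r ^ mdeg \<alpha>))"
      by (rule infsum_cmult_right')
    also have "\<dots> \<le> (s' / r) * B" using s' r c by (intro mult_left_mono) auto
    also have "\<dots> \<le> (e / (B + 1)) * B"
      using s' B r by (intro mult_right_mono) (auto simp: s_def field_simps)
    also have "\<dots> \<le> e" using B e by (auto simp: field_simps)
    finally have inf: "(\<Sum>\<^sub>\<infinity>\<alpha>\<in>multi_indices. \<bar>d \<alpha>\<bar> * s' ^ mdeg \<alpha>) \<le> e" .
    have "((\<lambda>\<alpha>. d \<alpha> * mono_at \<alpha> (y - x)) has_sum (f y - f x)) multi_indices"
      if y: "y \<in> cube x s'" for y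
    proof -
      have "y \<in> cube x r" using y s s' by (auto simp: cube_def intro: order_trans)
      then have 1: "((\<lambda>\<alpha>. c \<alpha> * mono_at \<alpha> (y - x)) has_sum f y) multi_indices" by (rule c)
      have 2: "((\<lambda>\<alpha>. if \<alpha> = z then - f x else 0) has_sum - f x) multi_indices"
        by (rule has_sum_finite_neutralI[of "{z}"]) (use z in auto)
      have "((\<lambda>\<alpha>. c \<alpha> * mono_at \<alpha> (y - x) + (if \<alpha> = z then - f x else 0)) has_sum (f y + - f x)) multi_indices"
        by (rule has_sum_add[OF 1 2])
      also have "(\<lambda>\<alpha>. c \<alpha> * mono_at \<alpha> (y - x) + (if \<alpha> = z then - f x else 0)) = (\<lambda>\<alpha>. d \<alpha> * mono_at \<alpha> (y - x))"
        by (auto simp: d_def mz fx)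
      finally show ?thesis by simp
    qed
    then show ?thesis unfolding has_pseries_def using sm' inf by (intro exI[of _ d]) simp
  qed
  with s show ?thesis by (rule that)
qed

text \<open>Once every component of \<open>g y - g x\<close> has weighted norm at most
  \<open>r\<close>, a monomial in these components has norm at most
  \<open>r ^ mdeg \<alpha>\<close>. The series of \<open>f\<close> is then dominated by its own
  majorant, which is why the bound \<open>B\<close> survives unchanged.\<close>

lemma has_pseries_compose:
  fixes f :: "'b::euclidean_space \<Rightarrow> real" and g :: "'a::euclidean_space \<Rightarrow> 'b"
  assumes r: "r > 0" and f: "has_pseries (g x) r B f"
    and R: "\<And>b. b \<in> Basis \<Longrightarrow> \<exists>s>0. \<exists>A. has_pseries x s A (\<lambda>y. g y \<bullet> b)"
  shows "\<exists>s>0. has_pseries x s B (\<lambda>y. f (g y)) \<and> (\<forall>y\<in>cube x s. g y \<in> cube (g x) r)"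
proof -
  obtain c where c: "(\<lambda>\<alpha>. \<bar>c \<alpha>\<bar> * r ^ mdeg \<alpha>) summable_on multi_indices"
     "(\<Sum>\<^sub>\<infinity>\<alpha>\<in>multi_indices. \<bar>c \<alpha>\<bar> * r ^ mdeg \<alpha>) \<le> B"
     "\<And>y. y\<in>cube (g x) r \<Longrightarrow> ((\<lambda>\<alpha>. c \<alpha> * mono_at \<alpha> (y - g x)) has_sum f y) multi_indices"
    using f unfolding has_pseries_def by blast
  have "\<exists>s>0. \<forall>s'. 0 < s' \<longrightarrow> s' \<le> s \<longrightarrow> has_pseries x s' r (\<lambda>y. g y \<bullet> b - g x \<bullet> b)"
    if b: "b \<in> Basis" for b
  proof -
    obtain s A where "s > 0" and s: "has_pseries x s A (\<lambda>y. g y \<bullet> b)" using R[OF b] by blast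
    then obtain s1 where "0 < s1" "s1 \<le> s"
      "\<And>s'. 0 < s' \<Longrightarrow> s' \<le> s1 \<Longrightarrow> has_pseries x s' r (\<lambda>y. g y \<bullet> b - g x \<bullet> b)"
      using has_pseries_shrink[OF \<open>s > 0\<close> s r] by metis
    then show ?thesis by (intro exI[of _ s1]) simp
  qed
  then obtain s where s0: "\<And>b. b \<in> Basis \<Longrightarrow> 0 < s b"
    and s: "\<And>b s'. b \<in> Basis \<Longrightarrow> 0 < s' \<Longrightarrow> s' \<le> s b \<Longrightarrow> has_pseries x s' r (\<lambda>y. g y \<bullet> b - g x \<bullet> b)"
    by metis
  define t where "t = Min (s ` Basis)"
  have t: "0 < t" using s0 by (simp add: t_def)
  have tb: "has_pseries x t r (\<lambda>y. g y \<bullet> b - g x \<bullet> b)" if "b \<in> Basis" for b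
    by (rule s) (use that t in \<open>auto simp: t_def\<close>)
  have cube: "g y \<in> cube (g x) r" if y: "y \<in> cube x t" for y
    unfolding cube_def
  proof safe
    fix b :: 'b assume b: "b \<in> Basis"
    obtain d where d: "(\<lambda>\<alpha>. \<bar>d \<alpha>\<bar> * t ^ mdeg \<alpha>) summable_on multi_indices"
     "(\<Sum>\<^sub>\<infinity>\<alpha>\<in>multi_indices. \<bar>d \<alpha>\<bar> * t ^ mdeg \<alpha>) \<le> r"
     "((\<lambda>\<alpha>. d \<alpha> * mono_at \<alpha> (y - x)) has_sum (g y \<bullet> b - g x \<bullet> b)) multi_indices"
      using tb[OF b] y unfolding has_pseries_def by blast
    have le: "norm (d \<alpha> * mono_at \<alpha> (y - x)) \<le> \<bar>d \<alpha>\<bar> * t ^ mdeg \<alpha>" for \<alpha>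
      using abs_mono_at_le[OF y] by (auto simp: abs_mult intro!: mult_left_mono)
    have "norm (g y \<bullet> b - g x \<bullet> b) \<le> (\<Sum>\<^sub>\<infinity>\<alpha>\<in>multi_indices. \<bar>d \<alpha>\<bar> * t ^ mdeg \<alpha>)"
      using norm_infsum_le[OF d(3) _ le] d(1) by simp
    then show "\<bar>(g y - g x) \<bullet> b\<bar> \<le> r" using d(2) by (simp add: inner_diff_left)
  qed
  have P: "has_pseries x t (r ^ mdeg \<alpha>) (\<lambda>y. mono_at \<alpha> (g y - g x))" for \<alpha> :: "'b \<Rightarrow> nat"
  proof -
    have "has_pseries x t (\<Prod>b\<in>(Basis::'b set). r ^ \<alpha> b) (\<lambda>y. \<Prod>b\<in>Basis. (g y \<bullet> b - g x \<bullet> b) ^ \<alpha> b)"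
      by (intro has_pseries_prod has_pseries_power t tb) auto
    then show ?thesis by (simp add: mono_at_def mdeg_def power_sum inner_diff_left)
  qed
  have "has_pseries x t (\<Sum>\<^sub>\<infinity>\<alpha>\<in>multi_indices. \<bar>c \<alpha>\<bar> * r ^ mdeg \<alpha>) (\<lambda>y. f (g y))"
  proof (rule has_pseries_infsum[OF t, where A = multi_indices and
        B = "\<lambda>\<alpha>. \<bar>c \<alpha>\<bar> * r ^ mdeg \<alpha>" and g = "\<lambda>\<alpha> y. c \<alpha> * mono_at \<alpha> (g y - g x)"])
    fix \<alpha> :: "'b \<Rightarrow> nat"
    show "has_pseries x t (\<bar>c \<alpha>\<bar> * r ^ mdeg \<alpha>) (\<lambda>y. c \<alpha> * mono_at \<alpha> (g y - g x))"
      by (intro has_pseries_mult t P has_pseries_const)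
  qed (use c cube in auto)
  from has_pseries_weaken[OF this c(2)] show ?thesis
    using t cube by (intro exI[of _ t]) simp
qed

subsection \<open>Termwise differentiation\<close>

text \<open>Variant of \<open>has_pseries\<close> that exposes the coefficients, since second
  derivatives are compared through them.\<close>

definition pseries_on :: "'a::euclidean_space \<Rightarrow> real \<Rightarrow> (('a \<Rightarrow> nat) \<Rightarrow> real) \<Rightarrow> ('a \<Rightarrow> real) \<Rightarrow> bool" where
  "pseries_on x r c f \<longleftrightarrow> (\<lambda>\<alpha>. \<bar>c \<alpha>\<bar> * r ^ mdeg \<alpha>) summable_on multi_indices \<and>
     (\<forall>y\<in>cube x r. ((\<lambda>\<alpha>. c \<alpha> * mono_at \<alpha> (y - x)) has_sum f y) multi_indices)"

lemma has_pseries_iff_pseries_on: "(\<exists>B. has_pseries x r B f) \<longleftrightarrow> (\<exists>c. pseries_on x r c f)"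
  unfolding has_pseries_def pseries_on_def by auto

text \<open>Coefficients of the termwise partial derivative in direction \<open>b\<close>.\<close>

definition dcoeff :: "'a \<Rightarrow> (('a::euclidean_space \<Rightarrow> nat) \<Rightarrow> real) \<Rightarrow> ('a \<Rightarrow> nat) \<Rightarrow> real" where
  "dcoeff b c = (\<lambda>\<alpha>. real (\<alpha> b + 1) * c (\<alpha>(b := \<alpha> b + 1)))"

text \<open>The origin of the symmetry of second derivatives: both orders of differentiation produce
  the same power series.\<close>

lemma dcoeff_commute: "dcoeff a (dcoeff b c) = dcoeff b (dcoeff a c)"
  by (cases "a = b") (auto simp: dcoeff_def fun_upd_twist)

lemma mdeg_upd:
  assumes "b \<in> Basis" shows "mdeg (\<alpha>(b := k)) + \<alpha> b = mdeg \<alpha> + k"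
proof -
  have "mdeg \<alpha> = \<alpha> b + (\<Sum>i\<in>Basis - {b}. \<alpha> i)" for \<alpha>
    unfolding mdeg_def using assms by (simp add: sum.remove)
  from this[of \<alpha>] this[of "\<alpha>(b := k)"] show ?thesis by simp
qed

lemma mono_at_split:
  assumes "b \<in> Basis"
  shows "mono_at (\<alpha>(b := k)) z = (z \<bullet> b) ^ k * (\<Prod>i\<in>Basis - {b}. (z \<bullet> i) ^ \<alpha> i)"
proof -
  have "mono_at (\<alpha>(b := k)) z = (z \<bullet> b) ^ k * (\<Prod>i\<in>Basis - {b}. (z \<bullet> i) ^ (\<alpha>(b := k)) i)"
    unfolding mono_at_def using assms by (subst prod.remove[of _ b]) auto
  also have "(\<Prod>i\<in>Basis - {b}. (z \<bullet> i) ^ (\<alpha>(b := k)) i) = (\<Prod>i\<in>Basis - {b}. (z \<bullet> i) ^ \<alpha> i)"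
    by (intro prod.cong) auto
  finally show ?thesis .
qed

text \<open>For \<open>\<alpha> b = 0\<close> the truncated \<open>\<alpha> b - 1\<close> leaves the
  exponent unchanged, but then the factor \<open>real (\<alpha> b)\<close> removes the term.\<close>

lemma has_derivative_mono_at:
  "((\<lambda>y. mono_at \<alpha> (y - x)) has_derivative
     (\<lambda>h. \<Sum>b\<in>Basis. (h \<bullet> b) * (real (\<alpha> b) * mono_at (\<alpha>(b := \<alpha> b - 1)) (y - x)))) (at y within S)"
proof -
  have 1: "((\<lambda>y. ((y - x) \<bullet> b) ^ \<alpha> b) has_derivative
      (\<lambda>h. (h \<bullet> b) * (real (\<alpha> b) * ((y - x) \<bullet> b) ^ (\<alpha> b - 1)))) (at y within S)" for b
    by (auto intro!: derivative_eq_intros simp: mult_ac)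
  have 2: "((\<lambda>y. mono_at \<alpha> (y - x)) has_derivative
     (\<lambda>h. \<Sum>b\<in>Basis. (h \<bullet> b) * (real (\<alpha> b) * ((y - x) \<bullet> b) ^ (\<alpha> b - 1)) *
        (\<Prod>j\<in>Basis - {b}. ((y - x) \<bullet> j) ^ \<alpha> j))) (at y within S)"
    unfolding mono_at_def by (rule has_derivative_prod[OF 1])
  show ?thesis
    by (rule has_derivative_eq_rhs[OF 2]) (auto intro!: sum.cong simp: mono_at_split mult_ac)
qed

lemma nat_mult_half_power: "real k * (1/2) ^ (k - 1) \<le> 1"
proof (induction k)
  case (Suc k)
  have "real (Suc k) \<le> 2 ^ k"
  proof (induction k)
    case (Suc k)
    moreover have "(1::real) \<le> 2 ^ k" by simp
    ultimately show ?case by simp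
  qed simp
  then show ?case by (simp add: field_simps power_one_over)
qed simp

text \<open>Halving the radius pays for the exponent brought down by differentiation, so the
  differentiated series keeps a summable majorant.\<close>

lemma pseries_deriv_term_bound:
  assumes r: "r > 0" and b: "b \<in> Basis"
  shows "real (\<alpha> b) * (r / 2) ^ mdeg (\<alpha>(b := \<alpha> b - 1)) \<le> r ^ mdeg \<alpha> / r"
proof (cases "\<alpha> b = 0")
  case False
  define k where "k = mdeg \<alpha>"
  have m: "mdeg (\<alpha>(b := \<alpha> b - 1)) = k - 1" "\<alpha> b \<le> k" "k > 0"
    using mdeg_upd[OF b, of \<alpha> "\<alpha> b - 1"] member_le_sum[OF b, of \<alpha>] False by (auto simp: k_def mdeg_def)
  have "real (\<alpha> b) * (r / 2) ^ (k - 1) \<le> real k * (r / 2) ^ (k - 1)"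
    using m r by (intro mult_right_mono) auto
  also have "\<dots> = r ^ (k - 1) * (real k * (1/2) ^ (k - 1))"
    by (simp add: power_divide power_one_over)
  also have "\<dots> \<le> r ^ (k - 1) * 1"
    using nat_mult_half_power[of k] r by (intro mult_left_mono) auto
  also have "\<dots> = r ^ k / r" using r m by (cases k) auto
  finally show ?thesis using m k_def by simp
qed (use r in simp)

text \<open>Lets the multi-indices be enumerated by all natural numbers, which brings the theorem on
  derivatives of ordinary series into play.\<close>

lemma infinite_multi_indices: "infinite (multi_indices :: ('a::euclidean_space \<Rightarrow> nat) set)"
proof
  assume fin: "finite (multi_indices :: ('a \<Rightarrow> nat) set)"
  have "inj (\<lambda>n. (\<lambda>b\<in>Basis. n) :: 'a \<Rightarrow> nat)"
  proof (rule injI)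
    fix n m :: nat assume "((\<lambda>b\<in>Basis. n) :: 'a \<Rightarrow> nat) = (\<lambda>b\<in>Basis. m)"
    then show "n = m" using SOME_Basis by (metis restrict_apply')
  qed
  moreover have "range (\<lambda>n. (\<lambda>b\<in>Basis. n) :: 'a \<Rightarrow> nat) \<subseteq> multi_indices" by auto
  ultimately show False using fin finite_imageD finite_subset infinite_UNIV_nat by blast
qed

lemma ball_subset_cube: "ball x r \<subseteq> cube x r"
proof
  fix y assume "y \<in> ball x r"
  then show "y \<in> cube x r"
    using Basis_le_norm[of _ "y - x"] by (force simp: cube_def dist_norm norm_minus_commute)
qed

text \<open>All partial derivatives are dominated by the single summable family \<open>M\<close>;
  the Weierstrass test makes their series converge uniformly on the smaller ball, which justifies
  differentiation term by term.\<close>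

lemma pseries_on_deriv:
  assumes r: "r > 0" and f: "pseries_on x r c f"
  shows "\<exists>g. (\<forall>b\<in>Basis. pseries_on x (r / 2) (dcoeff b c) (g b)) \<and>
     (\<forall>y\<in>ball x (r / 2). (f has_derivative (\<lambda>h. \<Sum>b\<in>Basis. (h \<bullet> b) * g b y)) (at y))"
proof -
  let ?MI = "multi_indices :: ('a \<Rightarrow> nat) set"
  have c: "(\<lambda>\<alpha>. \<bar>c \<alpha>\<bar> * r ^ mdeg \<alpha>) summable_on ?MI"
    and cf: "\<And>y. y \<in> cube x r \<Longrightarrow> ((\<lambda>\<alpha>. c \<alpha> * mono_at \<alpha> (y - x)) has_sum f y) ?MI"
    using f by (auto simp: pseries_on_def)
  define F where "F b y \<alpha> = c \<alpha> * (real (\<alpha> b) * mono_at (\<alpha>(b := \<alpha> b - 1)) (y - x))" for b y \<alpha>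
  define M where "M \<alpha> = \<bar>c \<alpha>\<bar> * r ^ mdeg \<alpha> * (1 / r)" for \<alpha> :: "'a \<Rightarrow> nat"
  define g where "g b y = infsum (F b y) ?MI" for b y
  have M: "M summable_on ?MI"
    unfolding M_def by (rule summable_on_cmult_left[OF c])
  have coef_le: "\<bar>c \<alpha>\<bar> * (real (\<alpha> b) * (r / 2) ^ mdeg (\<alpha>(b := \<alpha> b - 1))) \<le> M \<alpha>" if "b \<in> Basis" for \<alpha> b
    using mult_left_mono[OF pseries_deriv_term_bound[OF r that, of \<alpha>], of "\<bar>c \<alpha>\<bar>"] by (simp add: M_def)
  have F_le: "norm (F b y \<alpha>) \<le> M \<alpha>" if "b \<in> Basis" "y \<in> cube x (r / 2)" for b y \<alpha>
  proof -
    have "norm (F b y \<alpha>) \<le> \<bar>c \<alpha>\<bar> * (real (\<alpha> b) * (r / 2) ^ mdeg (\<alpha>(b := \<alpha> b - 1)))"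
      unfolding F_def using abs_mono_at_le[OF that(2)] by (auto simp: abs_mult intro!: mult_left_mono)
    with coef_le[OF that(1)] show ?thesis by (rule order_trans[rotated])
  qed
  have F_sum: "(F b y has_sum g b y) ?MI" if "b \<in> Basis" "y \<in> cube x (r / 2)" for b y
  proof -
    have "(\<lambda>\<alpha>. norm (F b y \<alpha>)) summable_on ?MI"
      by (rule summable_on_comparison_test[OF M]) (use F_le that in auto)
    then have "F b y summable_on ?MI" by (subst summable_on_iff_abs_summable_on_real) simp
    then show ?thesis unfolding g_def by (rule has_sum_infsum)
  qed
  have g: "pseries_on x (r / 2) (dcoeff b c) (g b)" if b: "b \<in> Basis" for b
  proof -
    \<comment> \<open>The shift of the exponent of \<open>b\<close> is a bijection onto
      \<open>P\<close>; outside \<open>P\<close> the differentiated terms vanish.\<close>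
    define P where "P = {\<alpha> \<in> ?MI. \<alpha> b \<noteq> 0}"
    have bij: "bij_betw (\<lambda>\<alpha>. \<alpha>(b := \<alpha> b + 1)) ?MI P"
      by (rule bij_betwI[where g = "\<lambda>\<alpha>. \<alpha>(b := \<alpha> b - 1)"])
         (use b in \<open>auto simp: P_def PiE_def extensional_def\<close>)
    have "(\<lambda>\<alpha>. \<bar>c \<alpha>\<bar> * (real (\<alpha> b) * (r / 2) ^ mdeg (\<alpha>(b := \<alpha> b - 1)))) summable_on ?MI"
      by (rule summable_on_comparison_test[OF M coef_le[OF b]]) (use r in auto)
    then have "(\<lambda>\<alpha>. \<bar>c \<alpha>\<bar> * (real (\<alpha> b) * (r / 2) ^ mdeg (\<alpha>(b := \<alpha> b - 1)))) summable_on P"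
      by (rule summable_on_subset_banach) (auto simp: P_def)
    then have 1: "(\<lambda>\<alpha>. \<bar>dcoeff b c \<alpha>\<bar> * (r / 2) ^ mdeg \<alpha>) summable_on ?MI"
      by (subst (asm) summable_on_reindex_bij_betw[OF bij, symmetric])
         (simp add: dcoeff_def abs_mult mult_ac)
    have 2: "((\<lambda>\<alpha>. dcoeff b c \<alpha> * mono_at \<alpha> (y - x)) has_sum g b y) ?MI" if "y \<in> cube x (r / 2)" for y
    proof -
      have "(F b y has_sum g b y) P"
        using F_sum[OF b that]
        by (subst (asm) has_sum_cong_neutral[where T = P and g = "F b y"]) (auto simp: P_def F_def)
      then show ?thesis
        by (subst (asm) has_sum_reindex_bij_betw[OF bij, symmetric])
           (simp add: dcoeff_def F_def abs_mult mult_ac)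
    qed
    show ?thesis using 1 2 by (simp add: pseries_on_def)
  qed
  define e where "e = from_nat_into ?MI"
  have e: "bij_betw e UNIV ?MI"
    unfolding e_def by (intro bij_betw_from_nat_into countable_PiE infinite_multi_indices) auto
  have sub: "ball x (r / 2) \<subseteq> cube x (r / 2)" by (rule ball_subset_cube)
  have sub2: "ball x (r / 2) \<subseteq> cube x r" using r by (intro order_trans[OF subset_ball ball_subset_cube]) simp
  have Me: "summable (\<lambda>n. M (e n))"
    using M by (subst (asm) summable_on_reindex_bij_betw[OF e, symmetric]) (rule summable_on_imp_summable)
  have ul: "uniform_limit (ball x (r / 2)) (\<lambda>n y. \<Sum>i<n. F b y (e i)) (g b) sequentially" if b: "b \<in> Basis" for b
  proof -
    have "uniform_limit (ball x (r / 2)) (\<lambda>n y. \<Sum>i<n. F b y (e i)) (\<lambda>y. suminf (\<lambda>i. F b y (e i))) sequentially"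
      by (rule Weierstrass_m_test[OF F_le[OF b] Me]) (use sub in auto)
    moreover have "suminf (\<lambda>i. F b y (e i)) = g b y" if "y \<in> ball x (r / 2)" for y
    proof -
      have "((\<lambda>i. F b y (e i)) has_sum g b y) UNIV"
        using F_sum[OF b, of y] that sub by (subst has_sum_reindex_bij_betw[OF e]) auto
      then show ?thesis by (metis has_sum_imp_sums sums_unique)
    qed
    ultimately show ?thesis
      by (subst (asm) uniform_limit_cong') auto
  qed
  have "\<exists>G. \<forall>y\<in>ball x (r / 2). (\<lambda>n. c (e n) * mono_at (e n) (y - x)) sums G y \<and>
      (G has_derivative (\<lambda>h. \<Sum>b\<in>Basis. (h \<bullet> b) * g b y)) (at y within ball x (r / 2))"
  proof (rule has_derivative_series[where f' = "\<lambda>n y h. \<Sum>b\<in>Basis. (h \<bullet> b) * F b y (e n)" and x = x])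
    fix n y
    show "((\<lambda>y. c (e n) * mono_at (e n) (y - x)) has_derivative
        (\<lambda>h. \<Sum>b\<in>Basis. (h \<bullet> b) * F b y (e n))) (at y within ball x (r / 2))"
      by (rule has_derivative_eq_rhs[OF has_derivative_mult_right[OF has_derivative_mono_at]])
         (simp add: F_def sum_distrib_left mult_ac)
  next
    fix \<epsilon> :: real assume \<epsilon>: "\<epsilon> > 0"
    \<comment> \<open>The error of the derivative is a sum over the coordinate directions, so each
      may contribute a share \<open>1 / DIM('a)\<close> of \<epsilon>.\<close>
    define \<delta> where "\<delta> = \<epsilon> / DIM('a)"
    have \<delta>: "\<delta> > 0" using \<epsilon> by (simp add: \<delta>_def)
    have "\<forall>\<^sub>F n in sequentially. \<forall>b\<in>(Basis::'a set). \<forall>y\<in>ball x (r / 2). dist (\<Sum>i<n. F b y (e i)) (g b y) < \<delta>"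
      using ul \<delta> unfolding uniform_limit_iff by (subst eventually_ball_finite_distrib) auto
    then show "\<forall>\<^sub>F n in sequentially. \<forall>y\<in>ball x (r / 2). \<forall>h.
        norm ((\<Sum>i<n. \<Sum>b\<in>Basis. (h \<bullet> b) * F b y (e i)) - (\<Sum>b\<in>Basis. (h \<bullet> b) * g b y)) \<le> \<epsilon> * norm h"
    proof (rule eventually_mono, intro ballI allI)
      fix n y h
      assume *: "\<forall>b\<in>(Basis::'a set). \<forall>y\<in>ball x (r / 2). dist (\<Sum>i<n. F b y (e i)) (g b y) < \<delta>"
        and y: "y \<in> ball x (r / 2)"
      have "(\<Sum>i<n. \<Sum>b\<in>Basis. (h \<bullet> b) * F b y (e i)) - (\<Sum>b\<in>Basis. (h \<bullet> b) * g b y)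
          = (\<Sum>b\<in>Basis. (h \<bullet> b) * ((\<Sum>i<n. F b y (e i)) - g b y))"
        by (subst sum.swap) (simp add: sum_distrib_left right_diff_distrib sum_subtractf)
      also have "norm \<dots> \<le> (\<Sum>b\<in>(Basis::'a set). norm h * \<delta>)"
      proof (rule sum_norm_le)
        fix b :: 'a assume b: "b \<in> Basis"
        have "norm ((\<Sum>i<n. F b y (e i)) - g b y) \<le> \<delta>"
          using * b y by (force simp: dist_norm)
        then show "norm ((h \<bullet> b) * ((\<Sum>i<n. F b y (e i)) - g b y)) \<le> norm h * \<delta>"
          using Basis_le_norm[OF b, of h] by (simp add: abs_mult) (intro mult_mono, auto)
      qed
      also have "\<dots> = \<epsilon> * norm h" by (simp add: \<delta>_def)
      finally show "norm ((\<Sum>i<n. \<Sum>b\<in>Basis. (h \<bullet> b) * F b y (e i)) - (\<Sum>b\<in>Basis. (h \<bullet> b) * g b y)) \<le> \<epsilon> * norm h" .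
    qed
  next
    show "(\<lambda>n. c (e n) * mono_at (e n) (x - x)) sums f x"
      using cf[OF center_in_cube[OF r]]
      by (subst (asm) has_sum_reindex_bij_betw[OF e, symmetric]) (rule has_sum_imp_sums)
  qed (use r in auto)
  then obtain G where G: "\<And>y. y \<in> ball x (r / 2) \<Longrightarrow> (\<lambda>n. c (e n) * mono_at (e n) (y - x)) sums G y"
    "\<And>y. y \<in> ball x (r / 2) \<Longrightarrow> (G has_derivative (\<lambda>h. \<Sum>b\<in>Basis. (h \<bullet> b) * g b y)) (at y within ball x (r / 2))"
    by blast
  have Gf: "G y = f y" if "y \<in> ball x (r / 2)" for y
  proof -
    have "((\<lambda>n. c (e n) * mono_at (e n) (y - x)) has_sum f y) UNIV"
      using cf[of y] that sub2 by (subst has_sum_reindex_bij_betw[OF e]) auto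
    then show ?thesis using G(1)[OF that] by (metis has_sum_imp_sums sums_unique2)
  qed
  have "(f has_derivative (\<lambda>h. \<Sum>b\<in>Basis. (h \<bullet> b) * g b y)) (at y)" if y: "y \<in> ball x (r / 2)" for y
  proof (rule has_derivative_transform_within_open[OF _ open_ball y Gf])
    show "(G has_derivative (\<lambda>h. \<Sum>b\<in>Basis. (h \<bullet> b) * g b y)) (at y)"
      using G(2)[OF y] at_within_open[OF y open_ball] by simp
  qed
  with g show ?thesis by blast
qed

subsection \<open>Closure properties of real analytic maps\<close>

text \<open>Each differentiation halves the radius. At the centre the two mixed derivatives are sums
  of identical series by \<open>dcoeff_commute\<close>, hence equal.\<close>

lemma pseries_on_C2:
  assumes r: "r > 0" and f: "pseries_on x r c f"
  shows "\<exists>s>0. \<exists>f' f''. (\<forall>y\<in>ball x s. (f has_derivative f' y) (at y)) \<and>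
    (\<forall>h. ((\<lambda>y. f' y h) has_derivative (\<lambda>k. f'' k h)) (at x)) \<and> (\<forall>h k. f'' k h = f'' h k)"
proof -
  obtain g where g: "\<forall>b\<in>Basis. pseries_on x (r / 2) (dcoeff b c) (g b)"
     "\<forall>y\<in>ball x (r / 2). (f has_derivative (\<lambda>h. \<Sum>b\<in>Basis. (h \<bullet> b) * g b y)) (at y)"
    using pseries_on_deriv[OF r f] by blast
  have "\<forall>b\<in>Basis. \<exists>k. (\<forall>a\<in>Basis. pseries_on x (r / 2 / 2) (dcoeff a (dcoeff b c)) (k a)) \<and>
      (\<forall>y\<in>ball x (r / 2 / 2). (g b has_derivative (\<lambda>h. \<Sum>a\<in>Basis. (h \<bullet> a) * k a y)) (at y))"
    using pseries_on_deriv[of "r / 2" x] g(1) r by auto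
  from bchoice[OF this] obtain k where "\<forall>b\<in>Basis. (\<forall>a\<in>Basis. pseries_on x (r / 2 / 2) (dcoeff a (dcoeff b c)) (k b a)) \<and>
      (\<forall>y\<in>ball x (r / 2 / 2). (g b has_derivative (\<lambda>h. \<Sum>a\<in>Basis. (h \<bullet> a) * k b a y)) (at y))"
    by (rule exE)
  then have
    k: "\<And>a b. b \<in> Basis \<Longrightarrow> a \<in> Basis \<Longrightarrow> pseries_on x (r / 2 / 2) (dcoeff a (dcoeff b c)) (k b a)"
     "\<And>b y. b \<in> Basis \<Longrightarrow> y \<in> ball x (r / 2 / 2) \<Longrightarrow>
        (g b has_derivative (\<lambda>h. \<Sum>a\<in>Basis. (h \<bullet> a) * k b a y)) (at y)"
    by blast+
  have x: "x \<in> cube x (r / 2 / 2)" "x \<in> ball x (r / 2 / 2)" using r by (auto simp: center_in_cube)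
  have sym: "k b a x = k a b x" if "a \<in> Basis" "b \<in> Basis" for a b
    using k(1)[OF that(1,2)] k(1)[OF that(2,1)] x unfolding pseries_on_def dcoeff_commute[of a b]
    by (meson has_sum_unique)
  define f' where "f' y h = (\<Sum>b\<in>Basis. (h \<bullet> b) * g b y)" for y h
  define f'' where "f'' u h = (\<Sum>b\<in>Basis. (h \<bullet> b) * (\<Sum>a\<in>Basis. (u \<bullet> a) * k b a x))" for u h
  have "((\<lambda>y. f' y h) has_derivative (\<lambda>u. f'' u h)) (at x)" for h
    unfolding f'_def f''_def using k(2) x by (intro has_derivative_sum has_derivative_mult_right) auto
  moreover have "f'' u h = f'' h u" for u h
  proof -
    have "f'' u h = (\<Sum>b\<in>Basis. \<Sum>a\<in>Basis. (h \<bullet> b) * (u \<bullet> a) * k b a x)"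
      by (simp add: f''_def sum_distrib_left mult_ac)
    also have "\<dots> = (\<Sum>a\<in>Basis. \<Sum>b\<in>Basis. (h \<bullet> b) * (u \<bullet> a) * k b a x)"
      by (rule sum.swap)
    also have "\<dots> = f'' h u"
      unfolding f''_def using sym by (auto simp: sum_distrib_left mult_ac intro!: sum.cong)
    finally show ?thesis .
  qed
  moreover have "\<forall>y\<in>ball x (r / 2). (f has_derivative f' y) (at y)"
    using g(2) by (simp add: f'_def[abs_def])
  ultimately show ?thesis using r
    by (intro exI[of _ "r / 2"] conjI exI[of _ f'] exI[of _ f'']) auto
qed

definition real_analytic_at :: "('a::euclidean_space \<Rightarrow> real) \<Rightarrow> 'a \<Rightarrow> bool" where
  "real_analytic_at f x \<longleftrightarrow> (\<exists>r>0. \<exists>B. has_pseries x r B f)"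

lemma real_analytic_at_common:
  assumes "real_analytic_at f x" "real_analytic_at g x"
  obtains r A B where "r > 0" "has_pseries x r A f" "has_pseries x r B g"
proof -
  obtain r s A B where "r > 0" "s > 0" "has_pseries x r A f" "has_pseries x s B g"
    using assms unfolding real_analytic_at_def by blast
  then have "min r s > 0" "has_pseries x (min r s) A f" "has_pseries x (min r s) B g"
    using has_pseries_decreasing[of x r A f "min r s"] has_pseries_decreasing[of x s B g "min r s"] by auto
  then show ?thesis by (rule that)
qed

lemma real_analytic_at_const: "real_analytic_at (\<lambda>_. k) x"
  unfolding real_analytic_at_def using has_pseries_const[of 1 x k] by (intro exI[of _ 1]) auto

lemma real_analytic_at_mult: "real_analytic_at f x \<Longrightarrow> real_analytic_at g x \<Longrightarrow> real_analytic_at (\<lambda>y. f y * g y) x"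
  by (erule (1) real_analytic_at_common) (use has_pseries_mult in \<open>force simp: real_analytic_at_def\<close>)

lemma real_analytic_at_add:
  assumes "real_analytic_at f x" "real_analytic_at g x" shows "real_analytic_at (\<lambda>y. f y + g y) x"
proof -
  obtain r A B where r: "r > 0" "has_pseries x r A f" "has_pseries x r B g"
    using assms by (rule real_analytic_at_common)
  have "has_pseries x r (\<Sum>b\<in>UNIV. if b then A else B) (\<lambda>y. \<Sum>b\<in>UNIV. (if b then f else g) y)"
    by (rule has_pseries_sum) (use r in auto)
  then show ?thesis using r(1) unfolding real_analytic_at_def by (auto simp: UNIV_bool add.commute)
qed

lemma real_analytic_at_sum: "(\<And>i. i \<in> I \<Longrightarrow> real_analytic_at (f i) x) \<Longrightarrow> real_analytic_at (\<lambda>y. \<Sum>i\<in>I. f i y) x"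
  by (induction I rule: infinite_finite_induct) (auto intro: real_analytic_at_const real_analytic_at_add)

lemma real_analytic_at_coordinate:
  assumes "b \<in> Basis" shows "real_analytic_at (\<lambda>y. y \<bullet> b) x"
proof -
  let ?\<alpha> = "\<lambda>i\<in>Basis. if i = b then 1 else 0"
  have "mono_at ?\<alpha> z = z \<bullet> b" for z :: 'a
  proof -
    have "mono_at ?\<alpha> z = (\<Prod>i\<in>Basis. if i = b then z \<bullet> b else 1)"
      unfolding mono_at_def by (intro prod.cong) auto
    then show ?thesis using assms by simp
  qed
  then have "real_analytic_at (\<lambda>y. (y - x) \<bullet> b) x"
    unfolding real_analytic_at_def using has_pseries_mono_at[of ?\<alpha> 1 x 1] by (intro exI[of _ 1]) auto
  from real_analytic_at_add[OF this real_analytic_at_const[of "x \<bullet> b"]] show ?thesis by (simp add: inner_diff_left)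
qed

lemma real_analytic_at_cong:
  assumes f: "real_analytic_at f x" and U: "open U" "x \<in> U" "\<And>y. y \<in> U \<Longrightarrow> f y = g y"
  shows "real_analytic_at g x"
proof -
  obtain r B where r: "r > 0" "has_pseries x r B f" using f unfolding real_analytic_at_def by blast
  obtain e where e: "e > 0" "ball x e \<subseteq> U" using U(1,2) openE by blast
  \<comment> \<open>The norm is at most the sum of the coordinates, so this side length keeps the
    cube strictly inside the ball.\<close>
  define s where "s = min r (e / (2 * DIM('a)))"
  have s: "s > 0" "s \<le> r" using r e by (auto simp: s_def)
  have "cube x s \<subseteq> ball x e"
  proof
    fix y assume y: "y \<in> cube x s"
    have "norm (y - x) \<le> (\<Sum>b\<in>Basis. \<bar>(y - x) \<bullet> b\<bar>)" by (rule norm_le_l1)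
    also have "\<dots> \<le> (\<Sum>b\<in>(Basis::'a set). e / (2 * DIM('a)))"
      using y by (intro sum_mono) (auto simp: cube_def s_def)
    also have "\<dots> < e" using e by simp
    finally show "y \<in> ball x e" by (simp add: dist_norm norm_minus_commute)
  qed
  then have "has_pseries x s B g"
    using has_pseries_decreasing[OF r(2) s] U(3) e(2) by (auto intro: has_pseries_cong)
  then show ?thesis using s unfolding real_analytic_at_def by blast
qed

lemma real_analytic_at_compose:
  assumes "real_analytic_at f (g x)" "\<And>b. b \<in> Basis \<Longrightarrow> real_analytic_at (\<lambda>y. g y \<bullet> b) x"
  shows "real_analytic_at (\<lambda>y. f (g y)) x"
proof -
  obtain r B where r: "r > 0" "has_pseries (g x) r B f" using assms(1) unfolding real_analytic_at_def by blast
  then obtain s where "s > 0" "has_pseries x s B (\<lambda>y. f (g y))"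
    using has_pseries_compose[of r g x B f, OF r] assms(2) unfolding real_analytic_at_def by blast
  then show ?thesis unfolding real_analytic_at_def by blast
qed

text \<open>Bridge between the vector-valued definition on balls and the weighted norm of the
  components. The passage to the norm works because an unconditionally convergent real sum converges
  absolutely.\<close>

lemma real_analytic_on_iff:
  fixes f :: "'a::euclidean_space \<Rightarrow> 'b::euclidean_space"
  shows "real_analytic_on f U \<longleftrightarrow> open U \<and> (\<forall>x\<in>U. \<forall>i\<in>Basis. real_analytic_at (\<lambda>y. f y \<bullet> i) x)"
proof (intro iffI conjI ballI)
  assume L: "real_analytic_on f U"
  then show "open U" by (simp add: real_analytic_on_def)
  fix x and i :: 'b assume x: "x \<in> U" and i: "i \<in> Basis"
  have "\<exists>e>0. \<exists>c. \<forall>y\<in>ball x e. ((\<lambda>\<alpha>. mono_at \<alpha> (y - x) *\<^sub>R c \<alpha>) has_sum f y) multi_indices"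
    using L x unfolding real_analytic_on_def mono_at_def by blast
  then obtain e and c :: "('a \<Rightarrow> nat) \<Rightarrow> 'b" where e: "e > 0"
    and c: "\<And>y. y \<in> ball x e \<Longrightarrow> ((\<lambda>\<alpha>. mono_at \<alpha> (y - x) *\<^sub>R c \<alpha>) has_sum f y) multi_indices"
    by blast
  have ci: "((\<lambda>\<alpha>. (c \<alpha> \<bullet> i) * mono_at \<alpha> (y - x)) has_sum (f y \<bullet> i)) multi_indices"
    if "y \<in> ball x e" for y
    using has_sum_bounded_linear[OF bounded_linear_inner_left c[OF that], of i]
    by (simp add: o_def mult.commute)
  define r where "r = e / (2 * DIM('a))"
  have r: "r > 0" using e by (simp add: r_def)
  have cube: "y \<in> ball x e" if y: "y \<in> cube x r" for y
  proof -
    have "norm (y - x) \<le> (\<Sum>b\<in>Basis. \<bar>(y - x) \<bullet> b\<bar>)" by (rule norm_le_l1)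
    also have "\<dots> \<le> (\<Sum>b\<in>(Basis::'a set). e / (2 * DIM('a)))"
      using y by (intro sum_mono) (auto simp: cube_def r_def)
    also have "\<dots> < e" using e by simp
    finally show "y \<in> ball x e" by (simp add: dist_norm norm_minus_commute)
  qed
  \<comment> \<open>A corner of the cube: every monomial equals \<open>r ^ mdeg \<alpha>\<close>
    there, so convergence at this one point is finiteness of the weighted norm.\<close>
  define p where "p = x + (\<Sum>b\<in>Basis. r *\<^sub>R b)"
  have pb: "(p - x) \<bullet> b = r" if "b \<in> Basis" for b
    using that by (simp add: p_def inner_sum_left inner_Basis if_distrib[of "\<lambda>t. r * t"] sum.delta' cong: if_cong)
  have "p \<in> cube x r" using pb r by (simp add: cube_def)
  then have "(\<lambda>\<alpha>. (c \<alpha> \<bullet> i) * mono_at \<alpha> (p - x)) summable_on multi_indices"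
    using ci cube has_sum_imp_summable by blast
  then have "(\<lambda>\<alpha>. norm ((c \<alpha> \<bullet> i) * mono_at \<alpha> (p - x))) summable_on multi_indices"
    by (subst (asm) summable_on_iff_abs_summable_on_real) simp
  moreover have "mono_at \<alpha> (p - x) = r ^ mdeg \<alpha>" for \<alpha>
    unfolding mono_at_def mdeg_def using pb by (simp add: power_sum)
  ultimately have "(\<lambda>\<alpha>. \<bar>c \<alpha> \<bullet> i\<bar> * r ^ mdeg \<alpha>) summable_on multi_indices"
    using r by (simp add: abs_mult)
  then have "pseries_on x r (\<lambda>\<alpha>. c \<alpha> \<bullet> i) (\<lambda>y. f y \<bullet> i)"
    unfolding pseries_on_def using ci cube by blast
  then show "real_analytic_at (\<lambda>y. f y \<bullet> i) x"
    unfolding real_analytic_at_def using r has_pseries_iff_pseries_on by blast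
next
  assume R: "open U \<and> (\<forall>x\<in>U. \<forall>i\<in>Basis. real_analytic_at (\<lambda>y. f y \<bullet> i) x)"
  have "\<exists>r>0. \<exists>c :: ('a \<Rightarrow> nat) \<Rightarrow> 'b. \<forall>y\<in>ball x r. ((\<lambda>\<alpha>. mono_at \<alpha> (y - x) *\<^sub>R c \<alpha>) has_sum f y) multi_indices"
    if x: "x \<in> U" for x
  proof -
    have "\<forall>i\<in>(Basis::'b set). \<exists>r>0. \<exists>c. pseries_on x r c (\<lambda>y. f y \<bullet> i)"
      using R x unfolding real_analytic_at_def has_pseries_iff_pseries_on by blast
    then obtain r c where r: "\<And>i. i \<in> (Basis::'b set) \<Longrightarrow> r i > 0"
      and c: "\<And>i. i \<in> (Basis::'b set) \<Longrightarrow> pseries_on x (r i) (c i) (\<lambda>y. f y \<bullet> i)"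
      by metis
    define s where "s = Min (r ` (Basis::'b set))"
    have s: "s > 0" using r by (simp add: s_def)
    have "((\<lambda>\<alpha>. mono_at \<alpha> (y - x) *\<^sub>R (\<Sum>i\<in>Basis. c i \<alpha> *\<^sub>R i)) has_sum f y) multi_indices"
      if y: "y \<in> ball x s" for y
    proof -
      have 1: "((\<lambda>\<alpha>. (c i \<alpha> * mono_at \<alpha> (y - x)) *\<^sub>R i) has_sum (f y \<bullet> i) *\<^sub>R i) multi_indices"
        if i: "i \<in> (Basis::'b set)" for i
      proof -
        have "s \<le> r i" using i by (simp add: s_def)
        then have "y \<in> cube x (r i)"
          using y ball_subset_cube[of x "r i"] by (auto simp: subset_iff)
        then have "((\<lambda>\<alpha>. c i \<alpha> * mono_at \<alpha> (y - x)) has_sum (f y \<bullet> i)) multi_indices"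
          using c[OF i] by (simp add: pseries_on_def)
        from has_sum_bounded_linear[OF bounded_linear_scaleR_left this, of i] show ?thesis
          by (simp add: o_def)
      qed
      have "((\<lambda>\<alpha>. \<Sum>i\<in>I. (c i \<alpha> * mono_at \<alpha> (y - x)) *\<^sub>R i) has_sum (\<Sum>i\<in>I. (f y \<bullet> i) *\<^sub>R i)) multi_indices"
        if "I \<subseteq> Basis" "finite I" for I :: "'b set"
        using that(2,1) by (induction I rule: finite_induct) (auto intro!: has_sum_add 1)
      from this[of Basis] show ?thesis
        by (simp add: euclidean_representation scaleR_sum_right mult.commute)
    qed
    then show ?thesis using s
      by (intro exI[of _ s] conjI exI[of _ "\<lambda>\<alpha>. \<Sum>i\<in>Basis. c i \<alpha> *\<^sub>R i"] ballI)
  qed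
  then show "real_analytic_on f U"
    unfolding real_analytic_on_def mono_at_def[symmetric] using R by (intro conjI ballI) simp_all
qed

lemma real_analytic_on_real_iff:
  fixes f :: "'a::euclidean_space \<Rightarrow> real"
  shows "real_analytic_on f U \<longleftrightarrow> open U \<and> (\<forall>x\<in>U. real_analytic_at f x)"
  by (simp add: real_analytic_on_iff)

lemma real_analytic_on_open: "real_analytic_on f U \<Longrightarrow> open U"
  by (simp add: real_analytic_on_def)

lemma real_analytic_on_subset: "real_analytic_on f U \<Longrightarrow> open V \<Longrightarrow> V \<subseteq> U \<Longrightarrow> real_analytic_on f V"
  by (auto simp: real_analytic_on_def)

lemma real_analytic_on_compose:
  fixes f :: "'a::euclidean_space \<Rightarrow> 'b::euclidean_space" and g :: "'b \<Rightarrow> 'c::euclidean_space"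
  assumes "real_analytic_on f U" "real_analytic_on g V" "f ` U \<subseteq> V"
  shows "real_analytic_on (\<lambda>x. g (f x)) U"
  unfolding real_analytic_on_iff
proof (intro conjI ballI)
  show "open U" using assms(1) by (simp add: real_analytic_on_def)
  fix x and i :: 'c assume x: "x \<in> U" and i: "i \<in> Basis"
  have "f x \<in> V" using x assms(3) by blast
  then have "real_analytic_at (\<lambda>z. g z \<bullet> i) (f x)" using assms(2) i unfolding real_analytic_on_iff by blast
  then show "real_analytic_at (\<lambda>y. g (f y) \<bullet> i) x"
    by (rule real_analytic_at_compose[where f = "\<lambda>z. g z \<bullet> i" and g = f])
       (use assms(1) x in \<open>simp add: real_analytic_on_iff\<close>)
qed

lemma real_analytic_on_cong:
  fixes f :: "'a::euclidean_space \<Rightarrow> 'b::euclidean_space"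
  assumes "real_analytic_on f U" "\<And>y. y \<in> U \<Longrightarrow> f y = g y"
  shows "real_analytic_on g U"
  unfolding real_analytic_on_iff
proof (intro conjI ballI)
  show U: "open U" using assms(1) by (simp add: real_analytic_on_def)
  fix x and i :: 'b assume x: "x \<in> U" and i: "i \<in> Basis"
  have "real_analytic_at (\<lambda>y. f y \<bullet> i) x" using assms(1) x i unfolding real_analytic_on_iff by blast
  then show "real_analytic_at (\<lambda>y. g y \<bullet> i) x"
    by (rule real_analytic_at_cong[OF _ U x]) (simp add: assms(2))
qed

lemma real_analytic_on_linear:
  fixes f :: "'a::euclidean_space \<Rightarrow> 'b::euclidean_space"
  assumes "linear f" "open U"
  shows "real_analytic_on f U"
  unfolding real_analytic_on_iff
proof (intro conjI ballI assms(2))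
  fix x and i :: 'b
  have "f y \<bullet> i = (\<Sum>b\<in>Basis. (y \<bullet> b) * (f b \<bullet> i))" for y
  proof -
    have "f y = f (\<Sum>b\<in>Basis. (y \<bullet> b) *\<^sub>R b)" by (simp add: euclidean_representation)
    also have "\<dots> = (\<Sum>b\<in>Basis. (y \<bullet> b) *\<^sub>R f b)" using assms(1) by (simp add: linear_sum linear_scale)
    finally show ?thesis by (simp add: inner_sum_left)
  qed
  then have eq: "(\<lambda>y. f y \<bullet> i) = (\<lambda>y. \<Sum>b\<in>Basis. (y \<bullet> b) * (f b \<bullet> i))" by (rule ext)
  show "real_analytic_at (\<lambda>y. f y \<bullet> i) x"
    by (subst eq, rule real_analytic_at_sum, rule real_analytic_at_mult, erule real_analytic_at_coordinate, rule real_analytic_at_const)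
qed

lemma real_analytic_on_Pair:
  fixes f :: "'a::euclidean_space \<Rightarrow> 'b::euclidean_space" and g :: "'a \<Rightarrow> 'c::euclidean_space"
  assumes "real_analytic_on f U" "real_analytic_on g U"
  shows "real_analytic_on (\<lambda>x. (f x, g x)) U"
  using assms unfolding real_analytic_on_iff by (auto simp: Basis_prod_def)

lemma real_analytic_on_const: "open U \<Longrightarrow> real_analytic_on (\<lambda>_. k :: 'b::euclidean_space) U"
  unfolding real_analytic_on_iff by (auto intro: real_analytic_at_const)

lemma real_analytic_on_id: "open U \<Longrightarrow> real_analytic_on (\<lambda>x. x :: 'a::euclidean_space) U"
  by (rule real_analytic_on_linear) (auto intro: linearI)

lemma real_analytic_on_linear_compose:
  fixes f :: "'a::euclidean_space \<Rightarrow> 'b::euclidean_space" and g :: "'b \<Rightarrow> 'c::euclidean_space"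
  assumes "real_analytic_on f U" "linear g"
  shows "real_analytic_on (\<lambda>x. g (f x)) U"
  by (rule real_analytic_on_compose[OF assms(1) real_analytic_on_linear[OF assms(2) open_UNIV]]) simp

lemmas real_analytic_on_fst = real_analytic_on_linear_compose[OF _ linear_fst]
lemmas real_analytic_on_snd = real_analytic_on_linear_compose[OF _ linear_snd]

lemma real_analytic_on_add:
  "real_analytic_on f U \<Longrightarrow> real_analytic_on g U \<Longrightarrow> real_analytic_on (\<lambda>x. f x + g x :: 'b::euclidean_space) U"
  unfolding real_analytic_on_iff by (auto simp: inner_add_left intro: real_analytic_at_add)

lemma real_analytic_on_minus:
  "real_analytic_on f U \<Longrightarrow> real_analytic_on (\<lambda>x. - f x :: 'b::euclidean_space) U"
  by (erule real_analytic_on_linear_compose) (auto intro: linearI)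

lemma real_analytic_on_diff:
  "real_analytic_on f U \<Longrightarrow> real_analytic_on g U \<Longrightarrow> real_analytic_on (\<lambda>x. f x - g x :: 'b::euclidean_space) U"
  using real_analytic_on_add[OF _ real_analytic_on_minus, of f U g] by simp

lemma real_analytic_on_mult:
  fixes f g :: "'a::euclidean_space \<Rightarrow> real"
  shows "real_analytic_on f U \<Longrightarrow> real_analytic_on g U \<Longrightarrow> real_analytic_on (\<lambda>x. f x * g x) U"
  unfolding real_analytic_on_real_iff by (auto intro: real_analytic_at_mult)

lemma real_analytic_on_power:
  fixes f :: "'a::euclidean_space \<Rightarrow> real"
  assumes "real_analytic_on f U"
  shows "real_analytic_on (\<lambda>x. f x ^ n) U"
proof (induction n)
  case 0
  have "open U" using assms by (rule real_analytic_on_open)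
  then show ?case using real_analytic_on_const[of U "1::real"] by simp
next
  case (Suc n)
  then show ?case using real_analytic_on_mult[OF assms Suc] by simp
qed

lemma real_analytic_on_C2:
  fixes f :: "'a::euclidean_space \<Rightarrow> 'b::euclidean_space"
  assumes "real_analytic_on f U"
  obtains f' f'' where "\<And>x. x \<in> U \<Longrightarrow> (f has_derivative f' x) (at x)"
    "\<And>x h. x \<in> U \<Longrightarrow> ((\<lambda>y. f' y h) has_derivative (\<lambda>k. f'' x k h)) (at x)"
    "\<And>x h k. x \<in> U \<Longrightarrow> f'' x k h = f'' x h k"
proof -
  have U: "open U" using assms by (simp add: real_analytic_on_def)
  have loc: "\<exists>s>0. \<exists>F' F''. (\<forall>y\<in>ball x s. (f has_derivative F' y) (at y)) \<and>
    (\<forall>h. ((\<lambda>y. F' y h) has_derivative (\<lambda>k. F'' k h)) (at x)) \<and> (\<forall>h k. F'' k h = F'' h k)"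
    if x: "x \<in> U" for x
  proof -
    define Q where "Q i s F' F'' \<longleftrightarrow> (\<forall>y\<in>ball x s. ((\<lambda>y. f y \<bullet> i) has_derivative F' y) (at y)) \<and>
      (\<forall>h. ((\<lambda>y. F' y h) has_derivative (\<lambda>k. F'' k h)) (at x)) \<and> (\<forall>h k. F'' k h = (F'' h k :: real))"
      for i :: 'b and s :: real and F' F'' :: "'a \<Rightarrow> 'a \<Rightarrow> real"
    have "\<exists>s>0. \<exists>F' F''. Q i s F' F''" if i: "i \<in> Basis" for i
    proof -
      have "real_analytic_at (\<lambda>y. f y \<bullet> i) x" using assms x i unfolding real_analytic_on_iff by simp
      then obtain r c where "r > 0" "pseries_on x r c (\<lambda>y. f y \<bullet> i)"
        unfolding real_analytic_at_def has_pseries_iff_pseries_on by (elim exE conjE) (rule that)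
      from pseries_on_C2[OF this] show ?thesis unfolding Q_def .
    qed
    then obtain s F' F'' where Q: "\<And>i. i \<in> Basis \<Longrightarrow> s i > 0 \<and> Q i (s i) (F' i) (F'' i)" by metis
    have s: "s i > 0" and F:
      "\<And>y. y \<in> ball x (s i) \<Longrightarrow> ((\<lambda>y. f y \<bullet> i) has_derivative F' i y) (at y)"
      "\<And>h. ((\<lambda>y. F' i y h) has_derivative (\<lambda>k. F'' i k h)) (at x)"
      "\<And>h k. F'' i k h = F'' i h k" if "i \<in> Basis" for i
      using Q[OF that] unfolding Q_def by blast+
    define t where "t = Min (s ` (Basis::'b set))"
    have t: "t > 0" using s by (simp add: t_def)
    have "(f has_derivative (\<lambda>h. \<Sum>i\<in>Basis. F' i y h *\<^sub>R i)) (at y)" if "y \<in> ball x t" for y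
    proof -
      have "((\<lambda>y. \<Sum>i\<in>Basis. (f y \<bullet> i) *\<^sub>R i) has_derivative (\<lambda>h. \<Sum>i\<in>Basis. F' i y h *\<^sub>R i)) (at y)"
        using that by (intro has_derivative_sum has_derivative_scaleR_left F) (auto simp: t_def)
      then show ?thesis by (simp add: euclidean_representation)
    qed
    moreover have "((\<lambda>y. \<Sum>i\<in>Basis. F' i y h *\<^sub>R i) has_derivative (\<lambda>k. \<Sum>i\<in>Basis. F'' i k h *\<^sub>R i)) (at x)" for h
      by (intro has_derivative_sum has_derivative_scaleR_left F) auto
    moreover have "(\<Sum>i\<in>Basis. F'' i k h *\<^sub>R i) = (\<Sum>i\<in>Basis. F'' i h k *\<^sub>R i)" for h k
      using F(3) by (intro sum.cong) auto
    ultimately show ?thesis using t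
      by (intro exI[of _ t] conjI exI[of _ "\<lambda>y h. \<Sum>i\<in>Basis. F' i y h *\<^sub>R i"]
          exI[of _ "\<lambda>k h. \<Sum>i\<in>Basis. F'' i k h *\<^sub>R i"]) blast+
  qed
  \<comment> \<open>The local derivatives were chosen anew for each centre \<open>x\<close>. The
    Frechet derivative is one function agreeing with all of them by uniqueness, on a whole ball, so
    that second derivatives transfer.\<close>
  define f' where "f' x = frechet_derivative f (at x)" for x
  have f': "(f has_derivative f' x) (at x)" if x: "x \<in> U" for x
  proof -
    obtain s F' where "s > 0" "\<forall>y\<in>ball x s. (f has_derivative F' y) (at y)" using loc[OF x] by blast
    then have "(f has_derivative F' x) (at x)" by simp
    then show ?thesis unfolding f'_def using frechet_derivative_works differentiable_def by blast
  qed
  have "\<exists>F''. (\<forall>h. ((\<lambda>y. f' y h) has_derivative (\<lambda>k. F'' k h)) (at x)) \<and> (\<forall>h k. F'' k h = F'' h k)"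
    if x: "x \<in> U" for x
  proof -
    obtain s F' F'' where s: "s > 0" "\<And>y. y \<in> ball x s \<Longrightarrow> (f has_derivative F' y) (at y)"
      and F'': "\<And>h. ((\<lambda>y. F' y h) has_derivative (\<lambda>k. F'' k h)) (at x)" "\<And>h k. F'' k h = F'' h k"
      using loc[OF x] by blast
    have "F' y h = f' y h" if "y \<in> ball x s" for y h
      using frechet_derivative_at[OF s(2)[OF that]] by (simp add: f'_def)
    then have "((\<lambda>y. f' y h) has_derivative (\<lambda>k. F'' k h)) (at x)" for h
      by (rule has_derivative_transform_within_open[OF F''(1) open_ball centre_in_ball[THEN iffD2, OF s(1)]])
    then show ?thesis using F''(2) by blast
  qed
  then have "\<forall>x\<in>U. \<exists>F''. (\<forall>h. ((\<lambda>y. f' y h) has_derivative (\<lambda>k. F'' k h)) (at x)) \<and> (\<forall>h k. F'' k h = F'' h k)"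
    by (rule ballI)
  from bchoice[OF this] obtain f'' where "\<forall>x\<in>U. (\<forall>h. ((\<lambda>y. f' y h) has_derivative (\<lambda>k. f'' x k h)) (at x)) \<and>
      (\<forall>h k. f'' x k h = f'' x h k)"
    by (rule exE)
  then have
    "\<And>x h. x \<in> U \<Longrightarrow> ((\<lambda>y. f' y h) has_derivative (\<lambda>k. f'' x k h)) (at x)"
    "\<And>x h k. x \<in> U \<Longrightarrow> f'' x k h = f'' x h k" by blast+
  with f' show ?thesis by (rule that)
qed

lemma real_analytic_on_imp_continuous_on:
  fixes f :: "'a::euclidean_space \<Rightarrow> 'b::euclidean_space"
  assumes "real_analytic_on f U" shows "continuous_on U f"
  using real_analytic_on_C2[OF assms] has_derivative_continuous continuous_at_imp_continuous_on by metis

text \<open>On the real axis the real parts of the complex Taylor coefficients already represent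
  \<open>h\<close>, because \<open>F\<close> takes real values there.\<close>

lemma real_analytic_on_of_holomorphic:
  fixes h :: "real \<Rightarrow> real"
  assumes V: "open V" and S: "open S" and F: "F holomorphic_on S"
    and VS: "\<And>x. x \<in> V \<Longrightarrow> complex_of_real x \<in> S"
    and Fh: "\<And>x. x \<in> V \<Longrightarrow> F (of_real x) = of_real (h x)"
  shows "real_analytic_on h V"
  unfolding real_analytic_on_real_iff
proof (intro conjI ballI V)
  fix x assume x: "x \<in> V"
  obtain e1 where e1: "e1 > 0" "ball (complex_of_real x) e1 \<subseteq> S" using S VS[OF x] openE by blast
  obtain e2 where e2: "e2 > 0" "ball x e2 \<subseteq> V" using V x openE by blast
  define e where "e = min e1 e2"
  have e: "e > 0" using e1 e2 by (simp add: e_def)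
  have hol: "F holomorphic_on ball (of_real x) e"
    by (rule holomorphic_on_subset[OF F]) (use e1 in \<open>auto simp: e_def\<close>)
  define a where "a n = (deriv ^^ n) F (of_real x) / fact n" for n
  have sums: "(\<lambda>n. a n * (w - of_real x) ^ n) sums F w" if "w \<in> ball (of_real x) e" for w
    unfolding a_def by (rule holomorphic_power_series[OF hol that])
  \<comment> \<open>Convergence at distance \<open>e / 2\<close> implies absolute convergence
    strictly inside, hence at half that distance.\<close>
  define r where "r = e / 2 / 2"
  have r: "r > 0" using e by (simp add: r_def)
  have "summable (\<lambda>n. a n * (complex_of_real (e / 2)) ^ n)"
    using sums[of "of_real x + of_real (e / 2)"] e
    by (auto simp: dist_norm norm_minus_commute sums_iff norm_divide)
  then have "summable (\<lambda>n. norm (a n * (complex_of_real r) ^ n))"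
    by (rule powser_insidea) (use e in \<open>simp add: r_def norm_divide\<close>)
  then have s1: "summable (\<lambda>n. norm (a n) * r ^ n)"
    using r by (simp add: norm_mult norm_power)
  have s2: "summable (\<lambda>n. \<bar>Re (a n)\<bar> * r ^ n)"
    by (rule summable_comparison_test'[OF s1]) (use r abs_Re_le_cmod in \<open>auto intro!: mult_right_mono\<close>)
  define \<alpha> :: "nat \<Rightarrow> real \<Rightarrow> nat" where "\<alpha> n = (\<lambda>b\<in>Basis. n)" for n
  have m: "mono_at (\<alpha> n) z = z ^ n" "mdeg (\<alpha> n) = n" for n z
    by (auto simp: mono_at_def mdeg_def \<alpha>_def)
  have hs: "((\<lambda>n. Re (a n) * mono_at (\<alpha> n) (y - x)) has_sum h y) UNIV" if y: "y \<in> cube x r" for y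
  proof -
    have yr: "\<bar>y - x\<bar> \<le> r" using y by (simp add: cube_def)
    have ye: "\<bar>y - x\<bar> < e" using yr r by (simp add: r_def)
    then have yV: "y \<in> V" using e2 by (auto simp: e_def dist_real_def)
    have "dist (complex_of_real x) (of_real y) = \<bar>y - x\<bar>"
      by (metis dist_of_real dist_real_def abs_minus_commute)
    then have "(\<lambda>n. a n * (of_real y - of_real x) ^ n) sums F (of_real y)"
      using ye by (intro sums) simp
    from sums_Re[OF this] have "(\<lambda>n. Re (a n * of_real ((y - x) ^ n))) sums h y"
      by (simp add: Fh[OF yV])
    then have "(\<lambda>n. Re (a n) * (y - x) ^ n) sums h y" by simp
    moreover have "summable (\<lambda>n. norm (Re (a n) * (y - x) ^ n))"
      by (rule summable_comparison_test'[OF s2])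
         (use yr in \<open>auto simp: abs_mult power_abs intro!: mult_left_mono power_mono\<close>)
    ultimately show ?thesis unfolding m by (intro norm_summable_imp_has_sum)
  qed
  have "has_pseries x r (suminf (\<lambda>n. \<bar>Re (a n)\<bar> * r ^ n)) h"
  proof (rule has_pseries_infsum[OF r, where A = UNIV and B = "\<lambda>n. \<bar>Re (a n)\<bar> * r ^ mdeg (\<alpha> n)"
        and g = "\<lambda>n y. Re (a n) * mono_at (\<alpha> n) (y - x)"])
    show "has_pseries x r (\<bar>Re (a n)\<bar> * r ^ mdeg (\<alpha> n)) (\<lambda>y. Re (a n) * mono_at (\<alpha> n) (y - x))" for n
      by (rule has_pseries_mono_at) (use r in \<open>auto simp: \<alpha>_def\<close>)
    show "((\<lambda>n. \<bar>Re (a n)\<bar> * r ^ mdeg (\<alpha> n)) has_sum suminf (\<lambda>n. \<bar>Re (a n)\<bar> * r ^ n)) UNIV"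
      unfolding m by (rule norm_summable_imp_has_sum) (use s2 r in \<open>auto simp: abs_mult intro: summable_sums\<close>)
  qed (use hs in auto)
  then show "real_analytic_at h x" unfolding real_analytic_at_def using r by blast
qed

section \<open>Analyticity of the elementary functions of one variable\<close>

lemma real_analytic_on_exp: "real_analytic_on (exp :: real \<Rightarrow> real) UNIV"
  by (rule real_analytic_on_of_holomorphic[of _ UNIV exp]) (auto intro: holomorphic_intros simp: exp_of_real)

lemma real_analytic_on_cos: "real_analytic_on (cos :: real \<Rightarrow> real) UNIV"
  by (rule real_analytic_on_of_holomorphic[of _ UNIV cos]) (auto intro: holomorphic_intros simp: cos_of_real)

lemma real_analytic_on_sin: "real_analytic_on (sin :: real \<Rightarrow> real) UNIV"
  by (rule real_analytic_on_of_holomorphic[of _ UNIV sin]) (auto intro: holomorphic_intros simp: sin_of_real)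

lemma real_analytic_on_ln: "real_analytic_on (ln :: real \<Rightarrow> real) {0<..}"
proof (rule real_analytic_on_of_holomorphic[of _ "- \<real>\<^sub>\<le>\<^sub>0" Ln])
  show "open (- \<real>\<^sub>\<le>\<^sub>0 :: complex set)" by (simp add: open_Compl closed_nonpos_Reals_complex)
qed (auto intro: holomorphic_intros simp: Ln_of_real complex_nonpos_Reals_iff)

lemma real_analytic_on_inverse: "real_analytic_on (inverse :: real \<Rightarrow> real) (- {0})"
  by (rule real_analytic_on_of_holomorphic[of _ "- {0}" inverse]) (auto intro!: holomorphic_intros)

lemma real_analytic_on_arctan: "real_analytic_on arctan UNIV"
proof (rule real_analytic_on_of_holomorphic[of _ "{z. \<bar>Im z\<bar> < 1}" Arctan])
  show "open {z. \<bar>Im z\<bar> < 1}" by (intro open_Collect_less continuous_intros)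
qed (auto intro!: holomorphic_on_Arctan simp: Arctan_of_real)

subsection \<open>The geodesic equation of the Nariai metric\<close>

text \<open>Interchanging the two parameters differentiates the warping function, so
  \<open>nariai_warp b a\<close> stands for \<Phi>' everywhere below.\<close>

lemma has_real_derivative_nariai_warp [derivative_intros]:
  "(nariai_warp a b has_real_derivative nariai_warp b a t) (at t within S)"
  unfolding nariai_warp_def[abs_def] by (auto intro!: derivative_eq_intros)

lemma continuous_on_nariai_warp [continuous_intros]:
  "continuous_on S f \<Longrightarrow> continuous_on S (\<lambda>x. nariai_warp a b (f x))"
  unfolding nariai_warp_def by (intro continuous_intros)

lemma nariai_warp_exp: "nariai_warp a b t = ((a + b) * exp t + (a - b) * exp (- t)) / 2"
  by (simp add: nariai_warp_def cosh_def sinh_def field_simps)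

lemma nariai_warp_square_diff: "(nariai_warp a b t)\<^sup>2 - (nariai_warp b a t)\<^sup>2 = a\<^sup>2 - b\<^sup>2"
proof -
  have "(nariai_warp a b t)\<^sup>2 - (nariai_warp b a t)\<^sup>2 = (a\<^sup>2 - b\<^sup>2) * ((cosh t)\<^sup>2 - (sinh t)\<^sup>2)"
    unfolding nariai_warp_def by algebra
  then show ?thesis by (simp add: cosh_square_eq)
qed

section \<open>The time interval and the metric of the universal cover\<close>

lemma open_nariai_interval: "open (nariai_interval a b)"
  unfolding nariai_interval_def
  by (intro open_connected_component open_Collect_less continuous_intros)

lemma connected_nariai_interval: "connected (nariai_interval a b)"
  by (simp add: nariai_interval_def)

lemma is_interval_nariai_interval: "is_interval (nariai_interval a b)"
  by (simp add: is_interval_connected_1 connected_nariai_interval)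

lemma nariai_warp_pos: "t \<in> nariai_interval a b \<Longrightarrow> nariai_warp a b t > 0"
  using connected_component_subset[of "{t. nariai_warp a b t > 0}" 0] by (auto simp: nariai_interval_def)

lemma subset_nariai_interval:
  "connected T \<Longrightarrow> 0 \<in> T \<Longrightarrow> (\<And>t. t \<in> T \<Longrightarrow> nariai_warp a b t > 0) \<Longrightarrow> T \<subseteq> nariai_interval a b"
  unfolding nariai_interval_def by (intro connected_component_maximal) auto

lemma zero_in_nariai_interval: "a > 0 \<Longrightarrow> 0 \<in> nariai_interval a b"
  using subset_nariai_interval[of "{0}" a b] by (simp add: nariai_warp_def)

lemma nariai_interval_UNIV: "(\<And>t. nariai_warp a b t > 0) \<Longrightarrow> nariai_interval a b = UNIV"
  using subset_nariai_interval[of UNIV a b] by auto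

lemma points_nariai_cover: "points (nariai_cover \<Lambda> a b) = nariai_interval a b \<times> UNIV \<times> sphere 0 1"
  by (simp add: nariai_cover_def nariai_on_def)

lemma metric_nariai_cover:
  "metric (nariai_cover \<Lambda> a b) p u v = 1 / \<Lambda> * (- (fst u * fst v) +
     (nariai_warp a b (fst p))\<^sup>2 * (fst (snd u) * fst (snd v)) + snd (snd u) \<bullet> snd (snd v))"
  by (simp add: nariai_cover_def nariai_on_def split_beta)

lemma linear_metric_nariai_left:
  assumes "linear f" shows "linear (\<lambda>\<xi>. metric (nariai_cover \<Lambda> a b) p (f \<xi>) v)"
proof -
  define c where "c = 1 / \<Lambda>"
  show ?thesis
    unfolding metric_nariai_cover c_def[symmetric]
    using assms by (auto simp: linear_iff inner_add_left algebra_simps)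
qed

lemma metric_nariai_cover_commute: "metric (nariai_cover \<Lambda> a b) p u v = metric (nariai_cover \<Lambda> a b) p v u"
  by (simp add: metric_nariai_cover inner_commute mult_ac)

lemma linear_metric_nariai_right:
  assumes "linear f" shows "linear (\<lambda>\<xi>. metric (nariai_cover \<Lambda> a b) p v (f \<xi>))"
  using linear_metric_nariai_left[OF assms] by (simp add: metric_nariai_cover_commute[of _ _ _ _ v])

lemma linear_eq_sum_axis:
  fixes f :: "real^'n \<Rightarrow> 'a::real_vector"
  assumes "linear f" shows "f x = (\<Sum>i\<in>UNIV. (x $ i) *\<^sub>R f (axis i 1))"
proof -
  have "f x = f (\<Sum>i\<in>UNIV. (x $ i) *\<^sub>R axis i 1)"
    using basis_expansion[of x] by (simp add: scalar_mult_eq_scaleR)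
  also have "\<dots> = (\<Sum>i\<in>UNIV. (x $ i) *\<^sub>R f (axis i 1))"
    using assms by (simp add: linear_sum linear_scale)
  finally show ?thesis .
qed

lemma linear_eq_sum_axis_real:
  fixes f :: "real^'n \<Rightarrow> real"
  assumes "linear f" shows "f x = (\<Sum>i\<in>UNIV. x $ i * f (axis i 1))"
  using linear_eq_sum_axis[OF assms, of x] by simp

lemma matrix_inv:
  assumes "invertible A"
  shows "A ** matrix_inv A = mat 1" "matrix_inv A ** A = mat 1"
  using someI_ex[OF assms[unfolded invertible_def]] by (simp_all add: matrix_inv_def)

text \<open>Multiplication by the Gram matrix cancels the inverse hidden in the Christoffel symbols;
  what remains is linear in the index \<open>m\<close> and can be tested against vectors.\<close>

lemma geodesic_equation_lower:
  assumes G: "invertible (chart_metric S \<phi> x)"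
  shows "(\<forall>k. x'' $ k + (\<Sum>i\<in>UNIV. \<Sum>j\<in>UNIV. christoffel S \<phi> x k i j * x' $ i * x' $ j) = 0) \<longleftrightarrow>
    (\<forall>m. (\<Sum>k\<in>UNIV. chart_metric S \<phi> x $ m $ k * x'' $ k) +
       1 / 2 * (\<Sum>i\<in>UNIV. \<Sum>j\<in>UNIV. x' $ i * x' $ j *
        (partial i (\<lambda>y. chart_metric S \<phi> y $ j $ m) x +
         partial j (\<lambda>y. chart_metric S \<phi> y $ i $ m) x -
         partial m (\<lambda>y. chart_metric S \<phi> y $ i $ j) x)) = 0)"
proof -
  define M where "M = chart_metric S \<phi> x"
  define d where "d i j l = partial i (\<lambda>y. chart_metric S \<phi> y $ j $ l) x +
         partial j (\<lambda>y. chart_metric S \<phi> y $ i $ l) x -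
         partial l (\<lambda>y. chart_metric S \<phi> y $ i $ j) x" for i j l
  define q :: "real^4" where "q = (\<chi> l. 1 / 2 * (\<Sum>i\<in>UNIV. \<Sum>j\<in>UNIV. x' $ i * x' $ j * d i j l))"
  have "(\<Sum>i\<in>UNIV. \<Sum>j\<in>UNIV. christoffel S \<phi> x k i j * x' $ i * x' $ j) = (matrix_inv M *v q) $ k" for k
  proof -
    have "(\<Sum>i\<in>UNIV. \<Sum>j\<in>UNIV. christoffel S \<phi> x k i j * x' $ i * x' $ j) =
      (\<Sum>i\<in>UNIV. \<Sum>j\<in>UNIV. \<Sum>l\<in>UNIV. matrix_inv M $ k $ l * (1 / 2 * (x' $ i * x' $ j * d i j l)))"
      by (simp add: christoffel_def d_def[symmetric] M_def sum_distrib_left sum_distrib_right mult_ac)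
    also have "\<dots> = (\<Sum>l\<in>UNIV. \<Sum>i\<in>UNIV. \<Sum>j\<in>UNIV. matrix_inv M $ k $ l * (1 / 2 * (x' $ i * x' $ j * d i j l)))"
      by (subst (2) sum.swap, subst sum.swap) (rule refl)
    also have "\<dots> = (matrix_inv M *v q) $ k"
      by (simp add: matrix_vector_mult_def q_def sum_distrib_left)
    finally show ?thesis .
  qed
  then have "(\<forall>k. x'' $ k + (\<Sum>i\<in>UNIV. \<Sum>j\<in>UNIV. christoffel S \<phi> x k i j * x' $ i * x' $ j) = 0) \<longleftrightarrow>
      x'' + matrix_inv M *v q = 0"
    by (simp add: vec_eq_iff)
  also have "\<dots> \<longleftrightarrow> M *v x'' + q = 0"
  proof
    assume "x'' + matrix_inv M *v q = 0"
    then have "M *v (x'' + matrix_inv M *v q) = 0" by simp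
    then show "M *v x'' + q = 0"
      using matrix_inv[OF G] by (simp add: M_def matrix_vector_right_distrib matrix_vector_mul_assoc)
  next
    assume "M *v x'' + q = 0"
    then have "matrix_inv M *v (M *v x'' + q) = 0" by simp
    then show "x'' + matrix_inv M *v q = 0"
      using matrix_inv[OF G] by (simp add: M_def matrix_vector_right_distrib matrix_vector_mul_assoc)
  qed
  also have "\<dots> \<longleftrightarrow> (\<forall>m. (\<Sum>k\<in>UNIV. M $ m $ k * x'' $ k) +
       1 / 2 * (\<Sum>i\<in>UNIV. \<Sum>j\<in>UNIV. x' $ i * x' $ j * d i j m) = 0)"
    by (simp add: vec_eq_iff q_def matrix_vector_mult_def)
  finally show ?thesis by (simp add: M_def d_def)
qed

text \<open>Differentiating the constant squared norm of the sphere component puts the range in a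
  hyperplane. The ambient space has dimension 5 and the derivative is injective on a space of
  dimension 4, so the two coincide.\<close>

lemma local_param_nariai_range:
  assumes \<phi>: "local_param (points (nariai_cover \<Lambda> a b)) W \<phi>" and x: "x \<in> W"
    and \<phi>': "(\<phi> has_derivative \<phi>') (at x)"
  shows "range \<phi>' = {V. snd (snd V) \<bullet> snd (snd (\<phi> x)) = 0}"
proof -
  let ?n = "(0, 0, snd (snd (\<phi> x))) :: real \<times> real \<times> (real^3)"
  have W: "open W" using \<phi> unfolding local_param_def by (blast intro: real_analytic_on_open)
  have M: "\<phi> ` W \<subseteq> points (nariai_cover \<Lambda> a b)"
    using \<phi> openin_imp_subset unfolding local_param_def by blast
  have inj: "inj \<phi>'"
    using \<phi> x frechet_derivative_at[OF \<phi>'] unfolding local_param_def by metis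
  have lin: "linear \<phi>'" using \<phi>' by (rule has_derivative_linear)
  have one: "snd (snd (\<phi> y)) \<bullet> snd (snd (\<phi> y)) = 1" if "y \<in> W" for y
    using M that by (force simp: points_nariai_cover norm_eq_1)
  have "((\<lambda>y. snd (snd (\<phi> y)) \<bullet> snd (snd (\<phi> y))) has_derivative
      (\<lambda>h. snd (snd (\<phi> x)) \<bullet> snd (snd (\<phi>' h)) + snd (snd (\<phi>' h)) \<bullet> snd (snd (\<phi> x)))) (at x)"
    by (intro has_derivative_inner has_derivative_snd \<phi>')
  moreover have "((\<lambda>y. snd (snd (\<phi> y)) \<bullet> snd (snd (\<phi> y))) has_derivative (\<lambda>h. 0)) (at x)"
    by (rule has_derivative_transform_within_open[OF has_derivative_const W x]) (use one in auto)
  ultimately have "(\<lambda>h. snd (snd (\<phi> x)) \<bullet> snd (snd (\<phi>' h)) + snd (snd (\<phi>' h)) \<bullet> snd (snd (\<phi> x))) = (\<lambda>h. 0)"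
    by (rule has_derivative_unique)
  then have sub: "range \<phi>' \<subseteq> {V. ?n \<bullet> V = 0}"
    by (auto simp: fun_eq_iff inner_commute inner_prod_def)
  have "dim (range \<phi>') = 4" using dim_image_eq[OF lin, of UNIV] inj by simp
  moreover have "?n \<noteq> 0" using one[OF x] by (auto simp: zero_prod_def)
  then have "dim {V. ?n \<bullet> V = 0} = 4" by (simp add: dim_hyperplane)
  moreover have "subspace (range \<phi>')" using lin by (simp add: linear_subspace_image)
  ultimately have "range \<phi>' = {V. ?n \<bullet> V = 0}"
    using subspace_dim_equal[OF _ subspace_hyperplane sub] by simp
  then show ?thesis by (simp add: inner_prod_def inner_commute)
qed

text \<open>Flipping the sign of the time component preserves the tangent space, and pairing a
  vector with its flipped copy is positive definite. Hence a tangent vector orthogonal to all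
  tangent vectors is zero.\<close>

lemma invertible_chart_metric_nariai:
  assumes \<Lambda>: "\<Lambda> > 0" and \<phi>: "local_param (points (nariai_cover \<Lambda> a b)) W \<phi>" and x: "x \<in> W"
  shows "invertible (chart_metric (nariai_cover \<Lambda> a b) \<phi> x)"
proof -
  let ?S = "nariai_cover \<Lambda> a b" let ?G = "chart_metric ?S \<phi> x"
  obtain \<phi>' \<phi>'' where "\<And>x. x \<in> W \<Longrightarrow> (\<phi> has_derivative \<phi>' x) (at x)"
    using \<phi> real_analytic_on_C2 unfolding local_param_def by metis
  then have d: "(\<phi> has_derivative \<phi>' x) (at x)" using x .
  have fd: "frechet_derivative \<phi> (at x) = \<phi>' x" using frechet_derivative_at[OF d] by simp
  have lin: "linear (\<phi>' x)" using d by (rule has_derivative_linear)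
  have inj: "inj (\<phi>' x)" using \<phi> x fd unfolding local_param_def by metis
  have M: "\<phi> x \<in> points ?S"
    using \<phi> x openin_imp_subset unfolding local_param_def by blast
  have w: "nariai_warp a b (fst (\<phi> x)) > 0"
    using M by (auto simp: points_nariai_cover intro: nariai_warp_pos)
  note range = local_param_nariai_range[OF \<phi> x d]
  have "\<xi> = 0" if "?G *v \<xi> = 0" for \<xi>
  proof -
    define V where "V = \<phi>' x \<xi>"
    have mV: "metric ?S (\<phi> x) (\<phi>' x \<eta>) V = 0" for \<eta>
    proof -
      have "(?G *v \<xi>) $ m = metric ?S (\<phi> x) (\<phi>' x (axis m 1)) V" for m
      proof -
        have "linear (\<lambda>\<xi>. metric ?S (\<phi> x) (\<phi>' x (axis m 1)) (\<phi>' x \<xi>))"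
          using lin by (rule linear_metric_nariai_right)
        from linear_eq_sum_axis_real[OF this, of \<xi>] show ?thesis
          by (simp add: V_def chart_metric_def partial_def fd matrix_vector_mult_def mult.commute)
      qed
      then have 0: "metric ?S (\<phi> x) (\<phi>' x (axis m 1)) V = 0" for m using that by (metis zero_index)
      have "linear (\<lambda>\<eta>. metric ?S (\<phi> x) (\<phi>' x \<eta>) V)"
        using lin by (rule linear_metric_nariai_left)
      from linear_eq_sum_axis_real[OF this, of \<eta>] 0 show ?thesis by simp
    qed
    have "V \<in> range (\<phi>' x)" by (simp add: V_def)
    then have "(- fst V, snd V) \<in> range (\<phi>' x)" unfolding range by simp
    then have "metric ?S (\<phi> x) (- fst V, snd V) V = 0" using mV by (metis rangeE)
    then have 0: "(fst V)\<^sup>2 + (nariai_warp a b (fst (\<phi> x)))\<^sup>2 * (fst (snd V))\<^sup>2 + snd (snd V) \<bullet> snd (snd V) = 0"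
      using \<Lambda> by (simp add: metric_nariai_cover power2_eq_square)
    moreover have "(nariai_warp a b (fst (\<phi> x)))\<^sup>2 * (fst (snd V))\<^sup>2 \<ge> 0" "(fst V)\<^sup>2 \<ge> 0"
      "snd (snd V) \<bullet> snd (snd V) \<ge> 0" by auto
    ultimately have "(fst V)\<^sup>2 = 0" "(nariai_warp a b (fst (\<phi> x)))\<^sup>2 * (fst (snd V))\<^sup>2 = 0" "snd (snd V) \<bullet> snd (snd V) = 0"
      by linarith+
    then have "V = 0" using w by (auto simp: prod_eq_iff)
    then show "\<xi> = 0" using inj lin unfolding V_def by (metis linear_0 injD)
  qed
  then show ?thesis
    by (simp add: invertible_left_inverse matrix_left_invertible_ker)
qed

text \<open>
  Extrinsic form of the geodesic equation: \<open>A\<close> is the acceleration of the curve in the ambient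
  space, and the equation says that it satisfies the Euler-Lagrange equation against every tangent
  vector \<open>V\<close>.
\<close>

definition nariai_EL :: "real \<Rightarrow> real \<Rightarrow> real \<Rightarrow> real \<times> real \<times> (real^3) \<Rightarrow> real \<times> real \<times> (real^3) \<Rightarrow>
    real \<times> real \<times> (real^3) \<Rightarrow> real" where
  "nariai_EL a b t T A V = - (fst A * fst V) + (nariai_warp a b t)\<^sup>2 * (fst (snd A) * fst (snd V)) +
     snd (snd A) \<bullet> snd (snd V) + 2 * nariai_warp a b t * nariai_warp b a t * fst T * fst (snd T) * fst (snd V)
     - nariai_warp a b t * nariai_warp b a t * fst V * (fst (snd T))\<^sup>2"

text \<open>The result mentions the chart only through the velocity \<open>\<phi>' x x'\<close> and
  the acceleration \<open>\<phi>'' x' x' + \<phi>' x x''\<close> of the curve, so it applies to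
  whatever chart the definition of a geodesic supplies.\<close>

lemma geodesic_equation_nariai:
  assumes \<Lambda>: "\<Lambda> > 0" and \<phi>: "local_param (points (nariai_cover \<Lambda> a b)) W \<phi>" and x: "x \<in> W"
    and d1: "\<And>y. y \<in> W \<Longrightarrow> (\<phi> has_derivative \<phi>' y) (at y)"
    and d2: "\<And>h. ((\<lambda>y. \<phi>' y h) has_derivative (\<lambda>k. \<phi>'' k h)) (at x)"
    and sym: "\<And>h k. \<phi>'' k h = \<phi>'' h k"
  shows "(\<forall>k. x'' $ k + (\<Sum>i\<in>UNIV. \<Sum>j\<in>UNIV. christoffel (nariai_cover \<Lambda> a b) \<phi> x k i j * x' $ i * x' $ j) = 0) \<longleftrightarrow>
    (\<forall>V. snd (snd V) \<bullet> snd (snd (\<phi> x)) = 0 \<longrightarrow>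
       nariai_EL a b (fst (\<phi> x)) (\<phi>' x x') (\<phi>'' x' x' + \<phi>' x x'') V = 0)"
proof -
  let ?S = "nariai_cover \<Lambda> a b" let ?w = "nariai_warp a b (fst (\<phi> x))" let ?w' = "nariai_warp b a (fst (\<phi> x))"
  have W: "open W" using \<phi> unfolding local_param_def by (blast intro: real_analytic_on_open)
  have fd: "frechet_derivative \<phi> (at y) = \<phi>' y" if "y \<in> W" for y
    using frechet_derivative_at[OF d1[OF that]] by simp
  have lin: "linear (\<phi>' x)" using d1[OF x] by (rule has_derivative_linear)
  have lin1: "linear (\<lambda>k. \<phi>'' k h)" for h using d2 by (rule has_derivative_linear)
  have lin2: "linear (\<lambda>h. \<phi>'' k h)" for k using lin1[of k] by (simp add: sym)
  define c where "c = 1 / \<Lambda>"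
  have metric: "metric ?S p u v = c * (- (fst u * fst v) +
     (nariai_warp a b (fst p))\<^sup>2 * (fst (snd u) * fst (snd v)) + snd (snd u) \<bullet> snd (snd v))" for p u v
    by (simp add: metric_nariai_cover c_def)
  \<comment> \<open>Derivative in direction \<open>k\<close> of the metric coefficient of the chart
    vectors \<open>h\<close> and \<open>l\<close>: the product rule hits both chart vectors and the
    warping function.\<close>
  define DG where "DG k h l = c * (
      - (fst (\<phi>'' k h) * fst (\<phi>' x l) + fst (\<phi>' x h) * fst (\<phi>'' k l))
      + (2 * ?w * ?w' * fst (\<phi>' x k) * (fst (snd (\<phi>' x h)) * fst (snd (\<phi>' x l)))
         + ?w\<^sup>2 * (fst (snd (\<phi>'' k h)) * fst (snd (\<phi>' x l)) + fst (snd (\<phi>' x h)) * fst (snd (\<phi>'' k l))))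
      + (snd (snd (\<phi>'' k h)) \<bullet> snd (snd (\<phi>' x l)) + snd (snd (\<phi>' x h)) \<bullet> snd (snd (\<phi>'' k l))))"
    for k h l
  have DG: "((\<lambda>y. metric ?S (\<phi> y) (\<phi>' y h) (\<phi>' y l)) has_derivative (\<lambda>k. DG k h l)) (at x)" for h l
  proof -
    have 1: "((\<lambda>y. nariai_warp a b (fst (\<phi> y))) has_derivative (\<lambda>k. ?w' * fst (\<phi>' x k))) (at x)"
      by (rule has_derivative_compose[OF has_derivative_fst[OF d1[OF x]],
            of "nariai_warp a b" "\<lambda>t. ?w' * t", simplified])
         (use has_real_derivative_nariai_warp in \<open>simp add: has_field_derivative_def\<close>)
    have w2: "((\<lambda>y. (nariai_warp a b (fst (\<phi> y)))\<^sup>2) has_derivative (\<lambda>k. 2 * (?w * (?w' * fst (\<phi>' x k))))) (at x)"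
      using has_derivative_power[OF 1, of 2] by (simp add: mult_ac)
    note t = has_derivative_mult[OF has_derivative_fst[OF d2] has_derivative_fst[OF d2], of h l]
    note r = has_derivative_mult[OF has_derivative_fst[OF has_derivative_snd[OF d2]]
        has_derivative_fst[OF has_derivative_snd[OF d2]], of h l]
    note s = has_derivative_inner[OF has_derivative_snd[OF has_derivative_snd[OF d2]]
        has_derivative_snd[OF has_derivative_snd[OF d2]], of h l]
    show ?thesis
      unfolding metric DG_def
      by (rule has_derivative_eq_rhs[OF has_derivative_mult_right[OF has_derivative_add[OF
           has_derivative_add[OF has_derivative_minus[OF t] has_derivative_mult[OF w2 r]] s]]])
         (simp add: fun_eq_iff algebra_simps)
  qed
  have part: "partial k (\<lambda>y. chart_metric ?S \<phi> y $ j $ l) x = DG (axis k 1) (axis j 1) (axis l 1)" for k j l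
  proof -
    have "((\<lambda>y. chart_metric ?S \<phi> y $ j $ l) has_derivative (\<lambda>k. DG k (axis j 1) (axis l 1))) (at x)"
      by (rule has_derivative_transform_within_open[OF DG W x])
         (simp add: chart_metric_def partial_def fd)
    from frechet_derivative_at[OF this] show ?thesis by (simp add: partial_def fun_eq_iff)
  qed
  have linDG1: "linear (\<lambda>k. DG k h l)" for h l
    using DG by (rule has_derivative_linear)
  have linDG2: "linear (\<lambda>h. DG k h l)" for k l
    unfolding DG_def using lin lin2[of k]
    by (auto simp: linear_iff inner_add_left inner_add_right algebra_simps)
  have linDG3: "linear (\<lambda>l. DG k h l)" for k h
    unfolding DG_def using lin lin2[of k]
    by (auto simp: linear_iff inner_add_left inner_add_right algebra_simps)
  \<comment> \<open>The lowered equation contracted with an arbitrary \<open>\<xi>\<close>. It is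
    linear in \<open>\<xi>\<close>, so vanishing on the axes is vanishing everywhere.\<close>
  define L where "L \<xi> = metric ?S (\<phi> x) (\<phi>' x \<xi>) (\<phi>' x x'') + DG x' x' \<xi> - 1 / 2 * DG \<xi> x' x'" for \<xi>
  have linL: "linear L"
    unfolding L_def using linDG1[of x' x'] linDG3[of x' x'] linear_metric_nariai_left[OF lin, of \<Lambda> a b "\<phi> x" "\<phi>' x x''"]
    by (auto simp: linear_iff algebra_simps)
  \<comment> \<open>The terms containing \<open>\<phi>'' x' \<xi>\<close> cancel against half of the
    last derivative term; this is the use of the symmetry of \<open>\<phi>''\<close>.\<close>
  have L_EL: "L \<xi> = c * nariai_EL a b (fst (\<phi> x)) (\<phi>' x x') (\<phi>'' x' x' + \<phi>' x x'') (\<phi>' x \<xi>)" for \<xi>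
    unfolding L_def DG_def nariai_EL_def metric sym[of \<xi> x']
    by (simp add: algebra_simps inner_add_left inner_commute power2_eq_square)
  have Lm: "L (axis m 1) = (\<Sum>k\<in>UNIV. chart_metric ?S \<phi> x $ m $ k * x'' $ k) +
       1 / 2 * (\<Sum>i\<in>UNIV. \<Sum>j\<in>UNIV. x' $ i * x' $ j *
        (partial i (\<lambda>y. chart_metric ?S \<phi> y $ j $ m) x +
         partial j (\<lambda>y. chart_metric ?S \<phi> y $ i $ m) x -
         partial m (\<lambda>y. chart_metric ?S \<phi> y $ i $ j) x))" for m
  proof -
    have expand: "f x' x' = (\<Sum>i\<in>UNIV. \<Sum>j\<in>UNIV. x' $ i * x' $ j * f (axis i 1) (axis j 1))"
      if "\<And>h. linear (\<lambda>k. f k h)" "\<And>k. linear (f k)" for f :: "real^4 \<Rightarrow> real^4 \<Rightarrow> real"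
    proof -
      have "f x' x' = (\<Sum>i\<in>UNIV. x' $ i * f (axis i 1) x')" by (rule linear_eq_sum_axis_real[OF that(1)])
      also have "\<dots> = (\<Sum>i\<in>UNIV. x' $ i * (\<Sum>j\<in>UNIV. x' $ j * f (axis i 1) (axis j 1)))"
        by (subst linear_eq_sum_axis_real[OF that(2)]) (rule refl)
      finally show ?thesis by (simp add: sum_distrib_left mult.assoc)
    qed
    have e1: "DG x' x' (axis m 1) = (\<Sum>i\<in>UNIV. \<Sum>j\<in>UNIV. x' $ i * x' $ j * DG (axis i 1) (axis j 1) (axis m 1))"
      by (rule expand[OF linDG1 linDG2])
    \<comment> \<open>The same double sum with the roles of \<open>i\<close> and \<open>j\<close>
      exchanged, to supply the second of the three derivative terms of the Christoffel
      symbol.\<close>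
    have e2: "DG x' x' (axis m 1) = (\<Sum>i\<in>UNIV. \<Sum>j\<in>UNIV. x' $ i * x' $ j * DG (axis j 1) (axis i 1) (axis m 1))"
      by (subst e1, subst sum.swap) (simp add: mult_ac)
    have e3: "DG (axis m 1) x' x' = (\<Sum>i\<in>UNIV. \<Sum>j\<in>UNIV. x' $ i * x' $ j * DG (axis m 1) (axis i 1) (axis j 1))"
      by (rule expand[OF linDG2 linDG3])
    have "linear (\<lambda>\<xi>. metric ?S (\<phi> x) (\<phi>' x (axis m 1)) (\<phi>' x \<xi>))"
      using lin by (rule linear_metric_nariai_right)
    from linear_eq_sum_axis_real[OF this, of x'']
    have e4: "metric ?S (\<phi> x) (\<phi>' x (axis m 1)) (\<phi>' x x'') = (\<Sum>k\<in>UNIV. chart_metric ?S \<phi> x $ m $ k * x'' $ k)"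
      by (simp add: chart_metric_def partial_def fd[OF x] mult.commute)
    have "L (axis m 1) = metric ?S (\<phi> x) (\<phi>' x (axis m 1)) (\<phi>' x x'') +
       1 / 2 * (DG x' x' (axis m 1) + DG x' x' (axis m 1) - DG (axis m 1) x' x')"
      by (simp add: L_def)
    also have "\<dots> = (\<Sum>k\<in>UNIV. chart_metric ?S \<phi> x $ m $ k * x'' $ k) +
       1 / 2 * (\<Sum>i\<in>UNIV. \<Sum>j\<in>UNIV. x' $ i * x' $ j *
        (DG (axis i 1) (axis j 1) (axis m 1) + DG (axis j 1) (axis i 1) (axis m 1) - DG (axis m 1) (axis i 1) (axis j 1)))"
      unfolding e4 by (subst (1) e1, subst e2, subst e3)
        (simp add: sum.distrib sum_subtractf distrib_left right_diff_distrib)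
    finally show ?thesis by (simp add: part)
  qed
  have "L \<xi> = 0" if "\<forall>m. L (axis m 1) = 0" for \<xi>
    by (subst linear_eq_sum_axis_real[OF linL]) (use that in simp)
  then have "(\<forall>m. L (axis m 1) = 0) \<longleftrightarrow> (\<forall>\<xi>. L \<xi> = 0)" by blast
  also have "\<dots> \<longleftrightarrow> (\<forall>V\<in>range (\<phi>' x). nariai_EL a b (fst (\<phi> x)) (\<phi>' x x') (\<phi>'' x' x' + \<phi>' x x'') V = 0)"
    using \<Lambda> by (simp add: L_EL c_def)
  finally show ?thesis
    unfolding geodesic_equation_lower[OF invertible_chart_metric_nariai[OF \<Lambda> \<phi> x]] Lm[symmetric]
    by (simp add: local_param_nariai_range[OF \<phi> x d1[OF x]])
qed

subsection \<open>Null and comoving geodesics\<close>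

lemma has_vector_derivative_chart_curve:
  fixes \<phi> :: "real^'n \<Rightarrow> 'b::euclidean_space"
  assumes N: "open N" "u \<in> N"
    and x: "\<And>u. u \<in> N \<Longrightarrow> x u \<in> W \<and> \<gamma> u = \<phi> (x u) \<and>
       (x has_vector_derivative x' u) (at u) \<and> (x' has_vector_derivative x'' u) (at u)"
    and d1: "\<And>y. y \<in> W \<Longrightarrow> (\<phi> has_derivative \<phi>' y) (at y)"
    and d2: "\<And>y h. y \<in> W \<Longrightarrow> ((\<lambda>y. \<phi>' y h) has_derivative (\<lambda>k. \<phi>'' y k h)) (at y)"
    and sym: "\<And>y h k. y \<in> W \<Longrightarrow> \<phi>'' y k h = \<phi>'' y h k"
  shows "(\<gamma> has_vector_derivative \<phi>' (x u) (x' u)) (at u)"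
    and "((\<lambda>u. \<phi>' (x u) (x' u)) has_vector_derivative \<phi>'' (x u) (x' u) (x' u) + \<phi>' (x u) (x'' u)) (at u)"
proof -
  have xd: "(x has_derivative (\<lambda>h. h *\<^sub>R x' u)) (at u)" "(x' has_derivative (\<lambda>h. h *\<^sub>R x'' u)) (at u)"
    using x[OF N(2)] by (simp_all add: has_vector_derivative_def)
  have W: "x u \<in> W" using x N by blast
  have lin: "linear (\<phi>' y)" if "y \<in> W" for y using d1[OF that] by (rule has_derivative_linear)
  have lin1: "linear (\<lambda>k. \<phi>'' (x u) k h)" for h using d2[OF W] by (rule has_derivative_linear)
  have lin2: "linear (\<lambda>h. \<phi>'' (x u) k h)" for k using lin1[of k] sym[OF W] by simp
  have "((\<lambda>u. \<phi> (x u)) has_derivative (\<lambda>h. \<phi>' (x u) (h *\<^sub>R x' u))) (at u)"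
    by (rule has_derivative_compose[OF xd(1) d1[OF W]])
  then have "((\<lambda>u. \<phi> (x u)) has_vector_derivative \<phi>' (x u) (x' u)) (at u)"
    unfolding has_vector_derivative_def using linear_scale[OF lin[OF W]] by simp
  then show "(\<gamma> has_vector_derivative \<phi>' (x u) (x' u)) (at u)"
    by (rule has_vector_derivative_transform_within_open[OF _ N]) (use x in auto)
  \<comment> \<open>The derivative of \<open>\<phi>'\<close> is known only for a fixed direction
    \<open>h\<close>; expanding the moving vector \<open>x' u\<close> in the axes reduces to fixed
    directions.\<close>
  have a: "((\<lambda>u. \<phi>' (x u) (axis i 1)) has_derivative (\<lambda>h. h *\<^sub>R \<phi>'' (x u) (x' u) (axis i 1))) (at u)" for i
    using has_derivative_compose[OF xd(1) d2[OF W, of "axis i 1"]] linear_scale[OF lin1] by simp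
  have b: "((\<lambda>u. x' u $ i) has_derivative (\<lambda>h. h * x'' u $ i)) (at u)" for i
    using bounded_linear.has_derivative[OF bounded_linear_vec_nth xd(2), of i] by simp
  have "((\<lambda>u. \<Sum>i\<in>UNIV. (x' u $ i) *\<^sub>R \<phi>' (x u) (axis i 1)) has_derivative
     (\<lambda>h. \<Sum>i\<in>UNIV. (x' u $ i) *\<^sub>R (h *\<^sub>R \<phi>'' (x u) (x' u) (axis i 1)) + (h * x'' u $ i) *\<^sub>R \<phi>' (x u) (axis i 1))) (at u)"
    by (intro has_derivative_sum has_derivative_scaleR a b)
  moreover have "(\<Sum>i\<in>UNIV. (x' u $ i) *\<^sub>R (h *\<^sub>R \<phi>'' (x u) (x' u) (axis i 1)) + (h * x'' u $ i) *\<^sub>R \<phi>' (x u) (axis i 1))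
      = h *\<^sub>R (\<phi>'' (x u) (x' u) (x' u) + \<phi>' (x u) (x'' u))" for h
  proof -
    have "\<phi>'' (x u) (x' u) (x' u) = (\<Sum>i\<in>UNIV. (x' u $ i) *\<^sub>R \<phi>'' (x u) (x' u) (axis i 1))"
      by (rule linear_eq_sum_axis[OF lin2])
    moreover have "\<phi>' (x u) (x'' u) = (\<Sum>i\<in>UNIV. (x'' u $ i) *\<^sub>R \<phi>' (x u) (axis i 1))"
      by (rule linear_eq_sum_axis[OF lin[OF W]])
    ultimately show ?thesis
      by (simp add: scaleR_add_right scaleR_sum_right sum.distrib mult.commute)
  qed
  ultimately have sum: "((\<lambda>u. \<Sum>i\<in>UNIV. (x' u $ i) *\<^sub>R \<phi>' (x u) (axis i 1)) has_vector_derivative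
      \<phi>'' (x u) (x' u) (x' u) + \<phi>' (x u) (x'' u)) (at u)"
    by (simp add: has_vector_derivative_def)
  have eq: "(\<Sum>i\<in>UNIV. (x' v $ i) *\<^sub>R \<phi>' (x v) (axis i 1)) = \<phi>' (x v) (x' v)" if "v \<in> N" for v
    by (rule linear_eq_sum_axis[OF lin, symmetric]) (use x that in simp)
  show "((\<lambda>u. \<phi>' (x u) (x' u)) has_vector_derivative \<phi>'' (x u) (x' u) (x' u) + \<phi>' (x u) (x'' u)) (at u)"
    by (rule has_vector_derivative_transform_within_open[OF sum N eq])
qed

text \<open>The vector \<open>(1, 0, 0)\<close> is tangent at every point, so it may be inserted
  into the Euler-Lagrange equation. Future completeness uses no other component.\<close>

lemma geodesic_nariai_time_equation:
  assumes \<Lambda>: "\<Lambda> > 0" and \<gamma>: "geodesic (nariai_cover \<Lambda> a b) J \<gamma>" and s: "s \<in> J"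
  defines "v \<equiv> \<lambda>s. vector_derivative \<gamma> (at s)"
  shows "(\<gamma> has_vector_derivative v s) (at s)"
    and "((\<lambda>s. fst (v s)) has_real_derivative
       - (nariai_warp a b (fst (\<gamma> s)) * nariai_warp b a (fst (\<gamma> s)) * (fst (snd (v s)))\<^sup>2)) (at s)"
proof -
  from bspec[OF conjunct2[OF conjunct2[OF conjunct2[OF conjunct2[OF \<gamma>[unfolded geodesic_def]]]]] s]
  obtain W \<phi> N x x' x'' where geo: "local_param (points (nariai_cover \<Lambda> a b)) W \<phi> \<and>
        open N \<and> s \<in> N \<and> N \<subseteq> J \<and>
        (\<forall>u\<in>N. x u \<in> W \<and> \<gamma> u = \<phi> (x u) \<and>
           (x has_vector_derivative x' u) (at u) \<and> (x' has_vector_derivative x'' u) (at u) \<and>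
           (\<forall>k. x'' u $ k + (\<Sum>i\<in>UNIV. \<Sum>j\<in>UNIV.
              christoffel (nariai_cover \<Lambda> a b) \<phi> (x u) k i j * x' u $ i * x' u $ j) = 0))"
    by (elim exE) (rule that)
  then have \<phi>: "local_param (points (nariai_cover \<Lambda> a b)) W \<phi>"
    and N: "open N" "s \<in> N"
    and x: "\<And>u. u \<in> N \<Longrightarrow> x u \<in> W \<and> \<gamma> u = \<phi> (x u) \<and>
       (x has_vector_derivative x' u) (at u) \<and> (x' has_vector_derivative x'' u) (at u)"
    and eq: "\<forall>k. x'' s $ k + (\<Sum>i\<in>UNIV. \<Sum>j\<in>UNIV.
        christoffel (nariai_cover \<Lambda> a b) \<phi> (x s) k i j * x' s $ i * x' s $ j) = 0"
    by blast+
  have "real_analytic_on \<phi> W" using \<phi> by (simp add: local_param_def)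
  then obtain \<phi>' \<phi>'' where d1: "\<And>y. y \<in> W \<Longrightarrow> (\<phi> has_derivative \<phi>' y) (at y)"
    and d2: "\<And>y h. y \<in> W \<Longrightarrow> ((\<lambda>y. \<phi>' y h) has_derivative (\<lambda>k. \<phi>'' y k h)) (at y)"
    and sym: "\<And>y h k. y \<in> W \<Longrightarrow> \<phi>'' y k h = \<phi>'' y h k"
    by (rule real_analytic_on_C2) (rule that)
  note curve = has_vector_derivative_chart_curve[OF N(1) _ x d1 d2 sym]
  have v: "v u = \<phi>' (x u) (x' u)" if "u \<in> N" for u
    unfolding v_def using curve(1)[OF that] by (rule vector_derivative_at)
  show "(\<gamma> has_vector_derivative v s) (at s)" using curve(1)[OF N(2)] v[OF N(2)] by simp
  have "(v has_vector_derivative \<phi>'' (x s) (x' s) (x' s) + \<phi>' (x s) (x'' s)) (at s)"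
    by (rule has_vector_derivative_transform_within_open[OF curve(2)[OF N(2)] N]) (use v in auto)
  then have d: "((\<lambda>s. fst (v s)) has_real_derivative fst (\<phi>'' (x s) (x' s) (x' s) + \<phi>' (x s) (x'' s))) (at s)"
    unfolding has_vector_derivative_def has_field_derivative_def
    by (rule has_derivative_eq_rhs[OF has_derivative_fst]) (auto simp: fun_eq_iff)
  have xs: "x s \<in> W" "\<gamma> s = \<phi> (x s)" using x N by auto
  have "nariai_EL a b (fst (\<phi> (x s))) (\<phi>' (x s) (x' s)) (\<phi>'' (x s) (x' s) (x' s) + \<phi>' (x s) (x'' s)) (1, 0, 0) = 0"
    using iffD1[OF geodesic_equation_nariai[OF \<Lambda> \<phi> xs(1) d1 d2[OF xs(1)] sym[OF xs(1)]] eq] by simp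
  then have "fst (\<phi>'' (x s) (x' s) (x' s) + \<phi>' (x s) (x'' s)) =
      - (nariai_warp a b (fst (\<gamma> s)) * nariai_warp b a (fst (\<gamma> s)) * (fst (snd (v s)))\<^sup>2)"
    by (simp add: nariai_EL_def xs(2) v[OF N(2)])
  with d show "((\<lambda>s. fst (v s)) has_real_derivative
       - (nariai_warp a b (fst (\<gamma> s)) * nariai_warp b a (fst (\<gamma> s)) * (fst (snd (v s)))\<^sup>2)) (at s)"
    by simp
qed

lemma geodesic_time_dir: "geodesic (S\<lparr>time_dir := d\<rparr>) = geodesic S"
  by (simp add: geodesic_def fun_eq_iff christoffel_def chart_metric_def)

text \<open>Graph chart over the hemisphere around the pole \<open>axis 3 1\<close>. Curves that
  keep the sphere coordinate at the pole stay in this one chart.\<close>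

definition sphere_chart :: "real^4 \<Rightarrow> real \<times> real \<times> (real^3)" where
  "sphere_chart x = (x $ 1, x $ 2,
     (x $ 3) *\<^sub>R axis 1 1 + (x $ 4) *\<^sub>R axis 2 1 + sqrt (1 - (x $ 3)\<^sup>2 - (x $ 4)\<^sup>2) *\<^sub>R axis 3 1)"

definition sphere_chart_inv :: "real \<times> real \<times> (real^3) \<Rightarrow> real^4" where
  "sphere_chart_inv p = fst p *\<^sub>R axis 1 1 + fst (snd p) *\<^sub>R axis 2 1 +
     (snd (snd p) $ 1) *\<^sub>R axis 3 1 + (snd (snd p) $ 2) *\<^sub>R axis 4 1"

lemma real_analytic_on_vec_nth:
  "real_analytic_on f U \<Longrightarrow> real_analytic_on (\<lambda>x. f x $ i :: real) U"
  by (erule real_analytic_on_linear_compose) (auto simp: linear_iff)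

lemma real_analytic_on_scaleR_const:
  fixes v :: "'b::euclidean_space" and f :: "'a::euclidean_space \<Rightarrow> real"
  shows "real_analytic_on f U \<Longrightarrow> real_analytic_on (\<lambda>x. f x *\<^sub>R v) U"
  by (erule real_analytic_on_linear_compose) (auto simp: linear_iff scaleR_add_left)

lemma real_analytic_on_sqrt: "real_analytic_on sqrt {0<..}"
proof (rule real_analytic_on_cong)
  have "real_analytic_on (\<lambda>x::real. exp (1 / 2 * ln x)) {0<..}"
    by (rule real_analytic_on_compose[OF real_analytic_on_mult[OF real_analytic_on_const real_analytic_on_ln] real_analytic_on_exp])
       auto
  then show "real_analytic_on (\<lambda>x::real. exp (1 / 2 * ln x)) {0<..}" .
  show "exp (1 / 2 * ln y) = sqrt y" if "y \<in> {0<..}" for y :: real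
    using that powr_half_sqrt[of y] by (simp add: powr_def)
qed

text \<open>The chart has a linear left inverse, a coordinate projection. Continuity of the inverse
  and injectivity of the derivative follow from that alone.\<close>

lemma local_param_sphere_chart:
  assumes W: "W = {x. x $ 1 \<in> nariai_interval a b \<and> (x $ 3)\<^sup>2 + (x $ 4)\<^sup>2 < 1}"
  shows "local_param (points (nariai_cover \<Lambda> a b)) W sphere_chart"
proof -
  let ?M = "points (nariai_cover \<Lambda> a b)"
  have oW: "open W"
    unfolding W by (intro open_Collect_conj open_Collect_less continuous_intros
        open_vimage[OF open_nariai_interval, unfolded vimage_def])
  have nth: "real_analytic_on (\<lambda>x::real^4. x $ i) W" for i
    by (rule real_analytic_on_vec_nth[OF real_analytic_on_id[OF oW]])
  have "real_analytic_on (\<lambda>x::real^4. sqrt (1 - (x $ 3)\<^sup>2 - (x $ 4)\<^sup>2)) W"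
    by (rule real_analytic_on_compose[OF _ real_analytic_on_sqrt])
       (intro real_analytic_on_diff real_analytic_on_power nth real_analytic_on_const oW, auto simp: W)
  then have an: "real_analytic_on sphere_chart W"
    unfolding sphere_chart_def[abs_def]
    by (intro real_analytic_on_Pair real_analytic_on_add real_analytic_on_scaleR_const nth)
  have inv: "sphere_chart_inv (sphere_chart x) = x" for x
    by (simp add: sphere_chart_def sphere_chart_inv_def vec_eq_iff forall_4 axis_def)
  have lin: "linear sphere_chart_inv"
    by (auto simp: linear_iff sphere_chart_inv_def algebra_simps scaleR_add_left)
  have cinv: "continuous_on T sphere_chart_inv" for T
    by (simp add: lin linear_continuous_on linear_conv_bounded_linear[symmetric])
  have im: "sphere_chart ` W = ?M \<inter> {p. snd (snd p) $ 3 > 0}"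
  proof (intro equalityI subsetI)
    fix p assume "p \<in> sphere_chart ` W"
    then obtain x where x: "x \<in> W" "p = sphere_chart x" by blast
    then have "1 - (x $ 3)\<^sup>2 - (x $ 4)\<^sup>2 > 0" by (simp add: W)
    then show "p \<in> ?M \<inter> {p. snd (snd p) $ 3 > 0}"
      using x by (auto simp: sphere_chart_def points_nariai_cover W axis_def norm_eq_1 inner_vec_def sum_3 power2_eq_square)
  next
    fix p assume p: "p \<in> ?M \<inter> {p. snd (snd p) $ 3 > 0}"
    define y where "y = snd (snd p)"
    have y: "(y $ 1)\<^sup>2 + (y $ 2)\<^sup>2 + (y $ 3)\<^sup>2 = 1" "y $ 3 > 0"
      using p by (auto simp: y_def points_nariai_cover norm_eq_1 inner_vec_def sum_3 power2_eq_square)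
    then have "1 - (y $ 1)\<^sup>2 - (y $ 2)\<^sup>2 = (y $ 3)\<^sup>2" by simp
    then have sq: "sqrt (1 - (y $ 1)\<^sup>2 - (y $ 2)\<^sup>2) = y $ 3" using y(2) by simp
    have i: "sphere_chart_inv p $ 1 = fst p" "sphere_chart_inv p $ 2 = fst (snd p)"
      "sphere_chart_inv p $ 3 = y $ 1" "sphere_chart_inv p $ 4 = y $ 2"
      by (simp_all add: sphere_chart_inv_def axis_def y_def)
    have "sphere_chart (sphere_chart_inv p) = p"
      by (simp add: sphere_chart_def i sq prod_eq_iff vec_eq_iff forall_3 axis_def flip: y_def)
    moreover have "0 < (y $ 3)\<^sup>2" using y(2) by simp
    with y(1) have "(y $ 1)\<^sup>2 + (y $ 2)\<^sup>2 < 1" by linarith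
    then have "sphere_chart_inv p \<in> W"
      using p by (simp add: W i points_nariai_cover mem_Times_iff)
    ultimately show "p \<in> sphere_chart ` W" by (metis imageI)
  qed
  have "openin (top_of_set ?M) (sphere_chart ` W)"
    unfolding im by (intro openin_open_Int open_Collect_less continuous_intros)
  moreover have "homeomorphism W (sphere_chart ` W) sphere_chart sphere_chart_inv"
    using real_analytic_on_imp_continuous_on[OF an] cinv inv
    by (auto simp: homeomorphism_def image_image)
  moreover have "inj (frechet_derivative sphere_chart (at x))" if x: "x \<in> W" for x
  proof -
    obtain \<phi>' where d: "(sphere_chart has_derivative \<phi>') (at x)"
      using real_analytic_on_C2[OF an] x by metis
    have "((\<lambda>x. sphere_chart_inv (sphere_chart x)) has_derivative (\<lambda>h. sphere_chart_inv (\<phi>' h))) (at x)"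
      by (rule bounded_linear.has_derivative[OF _ d]) (use lin linear_conv_bounded_linear in blast)
    then have "((\<lambda>x. x) has_derivative (\<lambda>h. sphere_chart_inv (\<phi>' h))) (at x)" by (simp add: inv)
    then have "(\<lambda>h. sphere_chart_inv (\<phi>' h)) = (\<lambda>h. h)" using has_derivative_ident has_derivative_unique by blast
    then have "inj \<phi>'" by (metis injI)
    then show ?thesis using frechet_derivative_at[OF d] by simp
  qed
  ultimately show ?thesis using an unfolding local_param_def by blast
qed

text \<open>With constant sphere component the Euler-Lagrange expression splits: its time part
  vanishes by \<open>eq1\<close>, and its \<rho> part is a multiple of the left side of
  \<open>eq2\<close>, which says that \<Phi>^2 \<rho>' is conserved.\<close>

lemma geodesic_nariai_2d:
  assumes \<Lambda>: "\<Lambda> > 0" and J: "open J" "is_interval J" "J \<noteq> {}"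
    and I: "\<And>s. s \<in> J \<Longrightarrow> t s \<in> nariai_interval a b"
    and t: "\<And>s. s \<in> J \<Longrightarrow> (t has_real_derivative t' s) (at s)"
      "\<And>s. s \<in> J \<Longrightarrow> (t' has_real_derivative t'' s) (at s)"
    and \<rho>: "\<And>s. s \<in> J \<Longrightarrow> (\<rho> has_real_derivative \<rho>' s) (at s)"
      "\<And>s. s \<in> J \<Longrightarrow> (\<rho>' has_real_derivative \<rho>'' s) (at s)"
    and eq1: "\<And>s. s \<in> J \<Longrightarrow> t'' s = - (nariai_warp a b (t s) * nariai_warp b a (t s) * (\<rho>' s)\<^sup>2)"
    and eq2: "\<And>s. s \<in> J \<Longrightarrow> nariai_warp a b (t s) * \<rho>'' s + 2 * nariai_warp b a (t s) * t' s * \<rho>' s = 0"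
  shows "geodesic (nariai_cover \<Lambda> a b) J (\<lambda>s. (t s, \<rho> s, axis 3 1))"
    and "\<And>s. s \<in> J \<Longrightarrow> vector_derivative (\<lambda>s. (t s, \<rho> s, axis 3 1 :: real^3)) (at s) = (t' s, \<rho>' s, 0)"
proof -
  let ?\<gamma> = "\<lambda>s. (t s, \<rho> s, axis 3 1 :: real^3)"
  define W where "W = {x :: real^4. x $ 1 \<in> nariai_interval a b \<and> (x $ 3)\<^sup>2 + (x $ 4)\<^sup>2 < 1}"
  have \<phi>: "local_param (points (nariai_cover \<Lambda> a b)) W sphere_chart"
    by (rule local_param_sphere_chart[OF W_def])
  then have "real_analytic_on sphere_chart W" by (simp add: local_param_def)
  then obtain \<phi>' \<phi>'' where d1: "\<And>y. y \<in> W \<Longrightarrow> (sphere_chart has_derivative \<phi>' y) (at y)"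
    and d2: "\<And>y h. y \<in> W \<Longrightarrow> ((\<lambda>y. \<phi>' y h) has_derivative (\<lambda>k. \<phi>'' y k h)) (at y)"
    and sym: "\<And>y h k. y \<in> W \<Longrightarrow> \<phi>'' y k h = \<phi>'' y h k"
    by (rule real_analytic_on_C2) (rule that)
  define x :: "real \<Rightarrow> real^4" where "x s = t s *\<^sub>R axis 1 1 + \<rho> s *\<^sub>R axis 2 1" for s
  define x' :: "real \<Rightarrow> real^4" where "x' s = t' s *\<^sub>R axis 1 1 + \<rho>' s *\<^sub>R axis 2 1" for s
  define x'' :: "real \<Rightarrow> real^4" where "x'' s = t'' s *\<^sub>R axis 1 1 + \<rho>'' s *\<^sub>R axis 2 1" for s
  have x: "x u \<in> W \<and> ?\<gamma> u = sphere_chart (x u) \<and>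
       (x has_vector_derivative x' u) (at u) \<and> (x' has_vector_derivative x'' u) (at u)" if "u \<in> J" for u
    using I[OF that] t[OF that] \<rho>[OF that] unfolding x_def[abs_def] x'_def[abs_def] x''_def
    by (auto simp: W_def sphere_chart_def axis_def has_real_derivative_iff_has_vector_derivative
        intro!: has_vector_derivative_add has_vector_derivative_scaleR[THEN has_vector_derivative_eq_rhs])
  note curve = has_vector_derivative_chart_curve[OF J(1) _ x d1 d2 sym]
  have vd: "((\<lambda>s. (f s, g s, c :: real^3)) has_vector_derivative (f', g', 0)) (at s)"
    if "(f has_real_derivative f') (at s)" "(g has_real_derivative g') (at s)" for f g f' g' s c
    using that by (auto simp: has_real_derivative_iff_has_vector_derivative intro!: has_vector_derivative_Pair)
  have T: "\<phi>' (x u) (x' u) = (t' u, \<rho>' u, 0)" if "u \<in> J" for u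
    using vector_derivative_unique_at[OF curve(1)[OF that] vd[OF t(1)[OF that] \<rho>(1)[OF that]]] .
  have A: "\<phi>'' (x u) (x' u) (x' u) + \<phi>' (x u) (x'' u) = (t'' u, \<rho>'' u, 0)" if u: "u \<in> J" for u
  proof -
    have "((\<lambda>u. \<phi>' (x u) (x' u)) has_vector_derivative (t'' u, \<rho>'' u, 0)) (at u)"
      by (rule has_vector_derivative_transform_within_open[OF vd[OF t(2)[OF u] \<rho>(2)[OF u]] J(1) u]) (simp add: T)
    then show ?thesis using vector_derivative_unique_at[OF curve(2)[OF u]] by simp
  qed
  show "vector_derivative ?\<gamma> (at s) = (t' s, \<rho>' s, 0)" if "s \<in> J" for s
    by (rule vector_derivative_at[OF vd[OF t(1)[OF that] \<rho>(1)[OF that]]])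
  have eqn: "\<forall>k. x'' u $ k + (\<Sum>i\<in>UNIV. \<Sum>j\<in>UNIV.
        christoffel (nariai_cover \<Lambda> a b) sphere_chart (x u) k i j * x' u $ i * x' u $ j) = 0" if u: "u \<in> J" for u
  proof -
    have xu: "x u \<in> W" "sphere_chart (x u) = ?\<gamma> u" using x[OF u] by auto
    have "nariai_EL a b (t u) (t' u, \<rho>' u, 0) (t'' u, \<rho>'' u, 0) V = 0" for V
    proof -
      have "nariai_EL a b (t u) (t' u, \<rho>' u, 0) (t'' u, \<rho>'' u, 0) V =
        nariai_warp a b (t u) * fst (snd V) * (nariai_warp a b (t u) * \<rho>'' u + 2 * nariai_warp b a (t u) * t' u * \<rho>' u)"
        unfolding nariai_EL_def eq1[OF u] by (simp add: algebra_simps power2_eq_square)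
      then show ?thesis by (simp add: eq2[OF u])
    qed
    then have "\<forall>V. snd (snd V) \<bullet> snd (snd (sphere_chart (x u))) = 0 \<longrightarrow>
       nariai_EL a b (fst (sphere_chart (x u))) (\<phi>' (x u) (x' u)) (\<phi>'' (x u) (x' u) (x' u) + \<phi>' (x u) (x'' u)) V = 0"
      unfolding xu(2) T[OF u] A[OF u] fst_conv by simp
    then show ?thesis
      by - (rule iffD2[OF geodesic_equation_nariai[OF \<Lambda> \<phi> xu(1) d1 d2[OF xu(1)] sym[OF xu(1)]]], assumption, assumption)
  qed
  show "geodesic (nariai_cover \<Lambda> a b) J ?\<gamma>"
    unfolding geodesic_def
  proof (intro conjI ballI J)
    show "?\<gamma> ` J \<subseteq> points (nariai_cover \<Lambda> a b)" using I by (auto simp: points_nariai_cover)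
    fix s assume s: "s \<in> J"
    show "\<exists>W \<phi> N x x' x''. local_param (points (nariai_cover \<Lambda> a b)) W \<phi> \<and>
        open N \<and> s \<in> N \<and> N \<subseteq> J \<and>
        (\<forall>u\<in>N. x u \<in> W \<and> ?\<gamma> u = \<phi> (x u) \<and>
           (x has_vector_derivative x' u) (at u) \<and> (x' has_vector_derivative x'' u) (at u) \<and>
           (\<forall>k. x'' u $ k +
              (\<Sum>i\<in>UNIV. \<Sum>j\<in>UNIV. christoffel (nariai_cover \<Lambda> a b) \<phi> (x u) k i j * x' u $ i * x' u $ j) = 0))"
      by (rule exI[of _ W], rule exI[of _ sphere_chart], rule exI[of _ J], rule exI[of _ x],
          rule exI[of _ x'], rule exI[of _ x'']) (use \<phi> J(1) s x eqn in simp)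
  qed
qed

text \<open>Convergence to \<open>q\<close> would eventually keep \<open>T\<close> below any level
  above \<open>T q\<close>; it is therefore enough that one such level is reached arbitrarily late.
  This also covers curves running to a finite end of the time interval.\<close>

lemma upper_inextendible_if_time_unbounded:
  fixes T :: "'a::euclidean_space \<Rightarrow> real"
  assumes "\<And>q. q \<in> M \<Longrightarrow> \<exists>c>T q. \<forall>s0\<in>J. \<exists>s\<in>J. s0 \<le> s \<and> T (\<gamma> s) \<ge> c" "continuous_on UNIV T"
  shows "upper_inextendible M J \<gamma>"
  unfolding upper_inextendible_def
proof safe
  fix q assume q: "q \<in> M" and *: "\<forall>U. open U \<and> q \<in> U \<longrightarrow> (\<exists>s0\<in>J. \<forall>s\<in>J. s0 \<le> s \<longrightarrow> \<gamma> s \<in> U)"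
  obtain c where c: "c > T q" "\<forall>s0\<in>J. \<exists>s\<in>J. s0 \<le> s \<and> T (\<gamma> s) \<ge> c" using assms(1)[OF q] by blast
  have "open {p. T p < c}" by (rule open_Collect_less[OF assms(2)]) (rule continuous_on_const)
  with * c(1) obtain s0 where "s0 \<in> J" "\<forall>s\<in>J. s0 \<le> s \<longrightarrow> T (\<gamma> s) < c" by blast
  then show False using c(2) by force
qed

lemma lower_inextendible_if_time_unbounded:
  fixes T :: "'a::euclidean_space \<Rightarrow> real"
  assumes "\<And>q. q \<in> M \<Longrightarrow> \<exists>c>T q. \<forall>s0\<in>J. \<exists>s\<in>J. s \<le> s0 \<and> T (\<gamma> s) \<ge> c" "continuous_on UNIV T"
  shows "lower_inextendible M J \<gamma>"
  unfolding lower_inextendible_def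
proof safe
  fix q assume q: "q \<in> M" and *: "\<forall>U. open U \<and> q \<in> U \<longrightarrow> (\<exists>s0\<in>J. \<forall>s\<in>J. s \<le> s0 \<longrightarrow> \<gamma> s \<in> U)"
  obtain c where c: "c > T q" "\<forall>s0\<in>J. \<exists>s\<in>J. s \<le> s0 \<and> T (\<gamma> s) \<ge> c" using assms(1)[OF q] by blast
  have "open {p. T p < c}" by (rule open_Collect_less[OF assms(2)]) (rule continuous_on_const)
  with * c(1) obtain s0 where "s0 \<in> J" "\<forall>s\<in>J. s \<le> s0 \<longrightarrow> T (\<gamma> s) < c" by blast
  then show False using c(2) by force
qed

lemma open_greater_ex:
  fixes x :: real
  assumes "open U" "x \<in> U" obtains y where "y > x" "y \<in> U"
proof -
  obtain e where "e > 0" "ball x e \<subseteq> U" using assms openE by blast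
  then have "x + e / 2 > x" "x + e / 2 \<in> U" by (auto simp: dist_real_def)
  then show ?thesis by (rule that)
qed

lemma open_less_ex:
  fixes x :: real
  assumes "open U" "x \<in> U" obtains y where "y < x" "y \<in> U"
proof -
  obtain e where "e > 0" "ball x e \<subseteq> U" using assms openE by blast
  then have "x - e / 2 < x" "x - e / 2 \<in> U" by (auto simp: dist_real_def)
  then show ?thesis by (rule that)
qed

section \<open>Incomplete causal geodesics when \<sigma>0 \<le> 0\<close>

lemma nariai_incomplete_degenerate:
  assumes \<Lambda>: "\<Lambda> > 0" and a: "a > 0" and b: "b = \<epsilon> * a" and \<epsilon>: "\<epsilon> = 1 \<or> \<epsilon> = - 1"
  shows "causal_geodesically_incomplete (nariai_cover \<Lambda> a b)"
proof -
  have w: "nariai_warp a b t = a * exp (\<epsilon> * t)" "nariai_warp b a t = \<epsilon> * a * exp (\<epsilon> * t)" for t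
    using \<epsilon> by (auto simp: nariai_warp_exp b)
  have I: "nariai_interval a b = UNIV" using a by (intro nariai_interval_UNIV) (simp add: w)
  have ee: "\<epsilon> * (\<epsilon> * x) = x" "\<epsilon> * \<epsilon> = 1" for x using \<epsilon> by auto
  define J where "J = {0::real<..}"
  \<comment> \<open>For a null curve with conserved quantity \<Phi>^2 \<rho>' = \<open>a\<close>,
    the condition \<Phi> \<rho>' = \<open>\<epsilon>\<close> t' says that exp
    (\<open>\<epsilon>\<close> t) has derivative 1, so it can be taken as affine parameter
    \<open>s\<close>. The values of t' and \<rho>' follow from \<Phi> =
    \<open>a * s\<close>.\<close>
  define t where "t s = \<epsilon> * ln s" for s :: real
  define t' where "t' s = \<epsilon> / s" for s :: real
  define t'' where "t'' s = - \<epsilon> / s\<^sup>2" for s :: real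
  define \<rho> where "\<rho> s = - 1 / (a * s)" for s :: real
  define \<rho>' where "\<rho>' s = 1 / (a * s\<^sup>2)" for s :: real
  define \<rho>'' where "\<rho>'' s = - 2 / (a * s ^ 3)" for s :: real
  have ex: "exp (\<epsilon> * t s) = s" if "s \<in> J" for s using that by (simp add: t_def ee J_def)
  have d: "(t has_real_derivative t' s) (at s)" "(t' has_real_derivative t'' s) (at s)"
    "(\<rho> has_real_derivative \<rho>' s) (at s)" "(\<rho>' has_real_derivative \<rho>'' s) (at s)" if "s \<in> J" for s
    unfolding t_def[abs_def] t'_def[abs_def] t''_def \<rho>_def[abs_def] \<rho>'_def[abs_def] \<rho>''_def
    using that a
    by (auto intro!: derivative_eq_intros simp: J_def power2_eq_square power3_eq_cube field_simps)
  have e1: "t'' s = - (nariai_warp a b (t s) * nariai_warp b a (t s) * (\<rho>' s)\<^sup>2)" if "s \<in> J" for s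
    using that a by (simp add: w ex t''_def \<rho>'_def J_def field_simps power2_eq_square)
  have e2: "nariai_warp a b (t s) * \<rho>'' s + 2 * nariai_warp b a (t s) * t' s * \<rho>' s = 0" if "s \<in> J" for s
    using that a by (simp add: w ex \<rho>''_def \<rho>'_def t'_def J_def field_simps power2_eq_square power3_eq_cube ee)
  let ?\<gamma> = "\<lambda>s. (t s, \<rho> s, axis 3 1 :: real^3)"
  have J: "open J" "is_interval J" "J \<noteq> {}" by (auto simp: J_def is_interval_oi gt_ex)
  have tI: "t s \<in> nariai_interval a b" for s by (simp add: I)
  have geo: "geodesic (nariai_cover \<Lambda> a b) J ?\<gamma>"
    "\<And>s. s \<in> J \<Longrightarrow> vector_derivative ?\<gamma> (at s) = (t' s, \<rho>' s, 0)"
    by (rule geodesic_nariai_2d[OF \<Lambda> J tI d e1 e2]; assumption)+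
  have causal: "causal_vec (nariai_cover \<Lambda> a b) (?\<gamma> s) (vector_derivative ?\<gamma> (at s))" if s: "s \<in> J" for s
  proof -
    have "metric (nariai_cover \<Lambda> a b) (?\<gamma> s) (t' s, \<rho>' s, 0) (t' s, \<rho>' s, 0) = 1 / \<Lambda> * (- (t' s)\<^sup>2 + (a * s * \<rho>' s)\<^sup>2)"
      by (simp add: metric_nariai_cover w ex[OF s] power2_eq_square mult_ac)
    also have "(a * s * \<rho>' s)\<^sup>2 = (t' s)\<^sup>2"
      using s a \<epsilon> by (auto simp: t'_def \<rho>'_def J_def power2_eq_square)
    finally show ?thesis
      using s a by (simp add: geo(2)[OF s] causal_vec_def \<rho>'_def J_def zero_prod_def)
  qed
  have "upper_inextendible (points (nariai_cover \<Lambda> a b)) J ?\<gamma>"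
  proof (rule upper_inextendible_if_time_unbounded[where T = "\<lambda>p. \<epsilon> * fst p"])
    fix q :: "real \<times> real \<times> (real^3)"
    define c where "c = \<epsilon> * fst q + 1"
    have "\<forall>s0\<in>J. \<exists>s\<in>J. s0 \<le> s \<and> \<epsilon> * fst (?\<gamma> s) \<ge> c"
    proof
      fix s0 assume s0: "s0 \<in> J"
      have "ln (exp c) \<le> ln (max s0 (exp c))" using s0 by (subst ln_le_cancel_iff) (auto simp: max_def J_def)
      then show "\<exists>s\<in>J. s0 \<le> s \<and> \<epsilon> * fst (?\<gamma> s) \<ge> c"
        using s0 by (intro bexI[of _ "max s0 (exp c)"]) (auto simp: J_def t_def ee)
    qed
    then show "\<exists>c>\<epsilon> * fst q. \<forall>s0\<in>J. \<exists>s\<in>J. s0 \<le> s \<and> \<epsilon> * fst (?\<gamma> s) \<ge> c"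
      by (intro exI[of _ c]) (simp add: c_def)
  qed (intro continuous_intros)
  moreover have "lower_inextendible (points (nariai_cover \<Lambda> a b)) J ?\<gamma>"
  proof (rule lower_inextendible_if_time_unbounded[where T = "\<lambda>p. - (\<epsilon> * fst p)"])
    fix q :: "real \<times> real \<times> (real^3)"
    define c where "c = - (\<epsilon> * fst q) + 1"
    have "\<forall>s0\<in>J. \<exists>s\<in>J. s \<le> s0 \<and> - (\<epsilon> * fst (?\<gamma> s)) \<ge> c"
    proof
      fix s0 assume s0: "s0 \<in> J"
      have "ln (min s0 (exp (- c))) \<le> ln (exp (- c))" using s0 by (subst ln_le_cancel_iff) (auto simp: min_def J_def)
      then show "\<exists>s\<in>J. s \<le> s0 \<and> - (\<epsilon> * fst (?\<gamma> s)) \<ge> c"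
        using s0 by (intro bexI[of _ "min s0 (exp (- c))"]) (auto simp: J_def t_def ee)
    qed
    then show "\<exists>c>- (\<epsilon> * fst q). \<forall>s0\<in>J. \<exists>s\<in>J. s \<le> s0 \<and> - (\<epsilon> * fst (?\<gamma> s)) \<ge> c"
      by (intro exI[of _ c]) (simp add: c_def)
  qed (intro continuous_intros)
  moreover have "J \<noteq> UNIV" by (metis J_def UNIV_I greaterThan_iff less_irrefl)
  ultimately show ?thesis
    unfolding causal_geodesically_incomplete_def inextendible_def using geo(1) causal by blast
qed

lemma nariai_interval_neq_UNIV:
  assumes "a\<^sup>2 < b\<^sup>2" shows "nariai_interval a b \<noteq> UNIV"
proof
  assume UNIV: "nariai_interval a b = UNIV"
  have "a\<^sup>2 - b\<^sup>2 = (a + b) * (a - b)" by (simp add: power2_eq_square algebra_simps)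
  then have neg: "(a + b) * (a - b) < 0" using assms by linarith
  then have pos: "- (a - b) / (a + b) > 0" by (auto simp: mult_less_0_iff divide_less_0_iff zero_less_divide_iff)
  \<comment> \<open>In the exponential form of the warping function, its zero is where exp (2 t)
    equals this quotient; positivity is the opposite sign of \<open>a + b\<close> and
    \<open>a - b\<close>.\<close>
  define t where "t = ln (- (a - b) / (a + b)) / 2"
  have "exp t * exp t = - (a - b) / (a + b)" using pos by (simp add: t_def flip: exp_add)
  moreover have "a + b \<noteq> 0" using neg by auto
  ultimately have "(a + b) * (exp t * exp t) = - (a - b)" by simp
  then have "(a + b) * exp t = - (a - b) * exp (- t)" by (simp add: exp_minus divide_simps mult.assoc)
  then have "nariai_warp a b t = 0" by (simp add: nariai_warp_exp flip: distrib_right)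
  then show False using nariai_warp_pos[of t a b] UNIV by simp
qed

lemma upper_inextendible_comoving:
  "upper_inextendible (nariai_interval a b \<times> UNIV \<times> sphere 0 1) (nariai_interval a b) (\<lambda>s. (s, g s))"
proof (rule upper_inextendible_if_time_unbounded[where T = fst])
  fix q :: "real \<times> 'a \<times> 'b" assume "q \<in> nariai_interval a b \<times> UNIV \<times> sphere 0 1"
  then obtain c where c: "c > fst q" "c \<in> nariai_interval a b"
    using open_greater_ex[OF open_nariai_interval] by (metis mem_Times_iff)
  show "\<exists>c>fst q. \<forall>s0\<in>nariai_interval a b. \<exists>s\<in>nariai_interval a b. s0 \<le> s \<and> c \<le> fst (s, g s)"
    using c by (intro exI[of _ c]) (auto intro!: bexI[of _ "max _ c"] simp: max_def)
qed (intro continuous_intros)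

lemma lower_inextendible_comoving:
  "lower_inextendible (nariai_interval a b \<times> UNIV \<times> sphere 0 1) (nariai_interval a b) (\<lambda>s. (s, g s))"
proof (rule lower_inextendible_if_time_unbounded[where T = "\<lambda>p. - fst p"])
  fix q :: "real \<times> 'a \<times> 'b" assume "q \<in> nariai_interval a b \<times> UNIV \<times> sphere 0 1"
  then obtain c where c: "c < fst q" "c \<in> nariai_interval a b"
    using open_less_ex[OF open_nariai_interval] by (metis mem_Times_iff)
  show "\<exists>c>- fst q. \<forall>s0\<in>nariai_interval a b. \<exists>s\<in>nariai_interval a b. s \<le> s0 \<and> c \<le> - fst (s, g s)"
    using c by (intro exI[of _ "- c"]) (auto intro!: bexI[of _ "min _ c"] simp: min_def)
qed (intro continuous_intros)

lemma nariai_incomplete_hyperbolic: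
  assumes \<Lambda>: "\<Lambda> > 0" and a: "a > 0" and b: "a\<^sup>2 < b\<^sup>2"
  shows "causal_geodesically_incomplete (nariai_cover \<Lambda> a b)"
proof -
  let ?\<gamma> = "\<lambda>s. (s, 0, axis 3 1 :: real^3) :: real \<times> real \<times> (real^3)" let ?J = "nariai_interval a b"
  have ne: "?J \<noteq> {}" using zero_in_nariai_interval[OF a] by blast
  have geo: "geodesic (nariai_cover \<Lambda> a b) ?J ?\<gamma>"
    "\<And>s. s \<in> ?J \<Longrightarrow> vector_derivative ?\<gamma> (at s) = (1, 0, 0)"
    by (rule geodesic_nariai_2d[OF \<Lambda> open_nariai_interval is_interval_nariai_interval ne,
          where t' = "\<lambda>_. 1" and t'' = "\<lambda>_. 0" and \<rho>' = "\<lambda>_. 0" and \<rho>'' = "\<lambda>_. 0"]; simp)+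
  have "causal_vec (nariai_cover \<Lambda> a b) (?\<gamma> s) (vector_derivative ?\<gamma> (at s))" if "s \<in> ?J" for s
    using \<Lambda> by (simp add: geo(2)[OF that] causal_vec_def metric_nariai_cover zero_prod_def)
  then show ?thesis
    unfolding causal_geodesically_incomplete_def inextendible_def
    using geo(1) nariai_interval_neq_UNIV[OF b]
      upper_inextendible_comoving[of a b "\<lambda>s. (0 :: real, axis 3 1 :: real^3)"]
      lower_inextendible_comoving[of a b "\<lambda>s. (0 :: real, axis 3 1 :: real^3)"]
    by (intro exI[of _ ?J] exI[of _ ?\<gamma>]) (simp add: points_nariai_cover)
qed

lemma nariai_incomplete:
  assumes "\<Lambda> > 0" "a > 0" "a\<^sup>2 - b\<^sup>2 \<le> 0"
  shows "causal_geodesically_incomplete (nariai_cover \<Lambda> a b)"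
proof (cases "a\<^sup>2 = b\<^sup>2")
  case True
  then have "b = a \<or> b = - a" by (auto simp: power2_eq_iff)
  then show ?thesis
    using nariai_incomplete_degenerate[OF assms(1,2), of b 1] nariai_incomplete_degenerate[OF assms(1,2), of b "- 1"]
    by auto
next
  case False
  then show ?thesis using nariai_incomplete_hyperbolic[OF assms(1,2)] assms(3) by simp
qed

section \<open>Limits of curves of bounded length\<close>

lemma limit_in_closed:
  assumes q: "\<forall>U. open U \<and> q \<in> U \<longrightarrow> (\<exists>s0\<in>J. \<forall>s\<in>J. s0 \<le> s \<longrightarrow> \<gamma> s \<in> U)"
    and C: "closed C" "\<And>s. s \<in> J \<Longrightarrow> s0 \<le> s \<Longrightarrow> \<gamma> s \<in> C" and s0: "s0 \<in> (J :: real set)"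
  shows "q \<in> C"
proof (rule ccontr)
  assume "q \<notin> C"
  then obtain s1 where "s1 \<in> J" "\<forall>s\<in>J. s1 \<le> s \<longrightarrow> \<gamma> s \<in> - C" using q C(1) by (metis ComplI open_Compl)
  moreover have "max s0 s1 \<in> J" using s0 \<open>s1 \<in> J\<close> by (simp add: max_def)
  ultimately show False using C(2)[of "max s0 s1"] by auto
qed

text \<open>The function \<open>g\<close> bounds distances along the curve, so boundedness of
  \<open>g\<close> forces a Cauchy limit at the upper end. It is applied with oriented time for
  causal curves and with the affine parameter for geodesics.\<close>

lemma curve_converges:
  fixes \<gamma> :: "real \<Rightarrow> 'a::complete_space" and g :: "real \<Rightarrow> real"
  assumes s0: "s0 \<in> J" and g: "\<And>s. s \<in> J \<Longrightarrow> s0 \<le> s \<Longrightarrow> g s \<le> B" and K: "K \<ge> 0"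
    and dist: "\<And>s s'. s \<in> J \<Longrightarrow> s' \<in> J \<Longrightarrow> s0 \<le> s \<Longrightarrow> s \<le> s' \<Longrightarrow> dist (\<gamma> s) (\<gamma> s') \<le> K * (g s' - g s)"
    and mono: "\<And>s s'. s \<in> J \<Longrightarrow> s' \<in> J \<Longrightarrow> s0 \<le> s \<Longrightarrow> s \<le> s' \<Longrightarrow> g s \<le> g s'"
  shows "\<exists>q. \<forall>U. open U \<and> q \<in> U \<longrightarrow> (\<exists>s0\<in>J. \<forall>s\<in>J. s0 \<le> s \<longrightarrow> \<gamma> s \<in> U)"
proof -
  define A where "A = {s \<in> J. s0 \<le> s}"
  define L where "L = Sup (g ` A)"
  have A: "s0 \<in> A" using s0 by (simp add: A_def)
  have bdd: "bdd_above (g ` A)" using g by (auto simp: A_def bdd_above_def)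
  have gL: "g s \<le> L" if "s \<in> A" for s unfolding L_def by (rule cSUP_upper[OF that bdd])
  have "\<exists>s\<in>A. g s > L - e" if "e > 0" for e
  proof -
    have "L - e < Sup (g ` A)" using that by (simp add: L_def)
    then show ?thesis using less_cSup_iff[OF _ bdd] A by blast
  qed
  then have "\<forall>n::nat. \<exists>s. s \<in> A \<and> g s > L - inverse (real (Suc n))" by (metis inverse_positive_iff_positive of_nat_0_less_iff zero_less_Suc)
  then obtain s where s: "\<And>n. s n \<in> A" "\<And>n. g (s n) > L - inverse (real (Suc n))" by metis
  have close: "dist (\<gamma> (s n)) (\<gamma> u) \<le> K * inverse (real (Suc n))" if "u \<in> A" "s n \<le> u" for n u
  proof -
    have "dist (\<gamma> (s n)) (\<gamma> u) \<le> K * (g u - g (s n))" using dist s(1) that by (auto simp: A_def)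
    also have "\<dots> \<le> K * inverse (real (Suc n))"
      using gL[OF that(1)] s(2)[of n] K by (intro mult_left_mono) auto
    finally show ?thesis .
  qed
  \<comment> \<open>The parameters \<open>s n\<close> approach the supremum of \<open>g\<close> but
    need not increase with \<open>n\<close>, so both orders have to be considered.\<close>
  have close2: "dist (\<gamma> (s n)) (\<gamma> (s m)) \<le> K * inverse (real (Suc n))" if "n \<le> m" for n m
  proof (cases "s n \<le> s m")
    case True
    then show ?thesis using close s(1) by blast
  next
    case False
    then have "dist (\<gamma> (s m)) (\<gamma> (s n)) \<le> K * inverse (real (Suc m))" using close s(1) by simp
    also have "\<dots> \<le> K * inverse (real (Suc n))" using K that by (intro mult_left_mono le_imp_inverse_le) auto
    finally show ?thesis by (simp add: dist_commute)
  qed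
  have lim: "(\<lambda>n. K * inverse (real (Suc n))) \<longlonglongrightarrow> K * 0"
    by (intro tendsto_intros LIMSEQ_inverse_real_of_nat)
  have "Cauchy (\<lambda>n. \<gamma> (s n))"
  proof (rule metric_CauchyI)
    fix e :: real assume "e > 0"
    then have "\<forall>\<^sub>F n in sequentially. K * inverse (real (Suc n)) < e / 2"
      using order_tendstoD(2)[OF lim, of "e / 2"] by simp
    then obtain N where N: "K * inverse (real (Suc N)) < e / 2" by (auto simp: eventually_sequentially)
    have "dist (\<gamma> (s m)) (\<gamma> (s n)) < e" if "N \<le> m" "N \<le> n" for m n
    proof -
      have "dist (\<gamma> (s m)) (\<gamma> (s n)) \<le> dist (\<gamma> (s N)) (\<gamma> (s m)) + dist (\<gamma> (s N)) (\<gamma> (s n))"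
        by (rule dist_triangle3)
      also have "\<dots> < e" using close2[OF that(1)] close2[OF that(2)] N by linarith
      finally show ?thesis .
    qed
    then show "\<exists>N. \<forall>m\<ge>N. \<forall>n\<ge>N. dist (\<gamma> (s m)) (\<gamma> (s n)) < e" by blast
  qed
  then obtain q where q: "(\<lambda>n. \<gamma> (s n)) \<longlonglongrightarrow> q" by (metis Cauchy_convergent convergent_def)
  have "\<exists>s1\<in>J. \<forall>u\<in>J. s1 \<le> u \<longrightarrow> \<gamma> u \<in> U" if U: "open U" "q \<in> U" for U
  proof -
    obtain e where e: "e > 0" "ball q e \<subseteq> U" using U openE by blast
    have "\<forall>\<^sub>F n in sequentially. K * inverse (real (Suc n)) < e / 2"
      using order_tendstoD(2)[OF lim, of "e / 2"] e by simp
    moreover have "\<forall>\<^sub>F n in sequentially. dist (\<gamma> (s n)) q < e / 2" using tendstoD[OF q, of "e / 2"] e by simp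
    ultimately have "\<forall>\<^sub>F n in sequentially. K * inverse (real (Suc n)) < e / 2 \<and> dist (\<gamma> (s n)) q < e / 2"
      by (rule eventually_conj)
    then obtain n where n: "K * inverse (real (Suc n)) < e / 2" "dist (\<gamma> (s n)) q < e / 2"
      by (auto simp: eventually_sequentially)
    have "\<gamma> u \<in> U" if "u \<in> J" "s n \<le> u" for u
    proof -
      have "u \<in> A" using that s(1)[of n] by (auto simp: A_def)
      then have "dist (\<gamma> (s n)) (\<gamma> u) < e / 2" using close[OF _ that(2)] n(1) by force
      then have "dist q (\<gamma> u) < e"
        using n(2) dist_triangle3[of q "\<gamma> u" "\<gamma> (s n)"] by (simp add: dist_commute)
      then show ?thesis using e(2) by (auto simp: dist_commute)
    qed
    then show ?thesis using s(1)[of n] by (auto simp: A_def)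
  qed
  then show ?thesis by blast
qed

subsection \<open>Causal curves and Cauchy surfaces\<close>

text \<open>A sign \<open>e\<close> in the time direction treats both orientations together: 1 gives
  the cover itself and -1 its time reversal.\<close>

definition nariai_dir :: "real \<Rightarrow> real \<Rightarrow> real \<Rightarrow> real \<Rightarrow> (real \<times> real \<times> (real^3)) spacetime" where
  "nariai_dir e \<Lambda> a b = (nariai_cover \<Lambda> a b)\<lparr>time_dir := (\<lambda>_. (e, 0, 0))\<rparr>"

text \<open>Break points are finite in number between two parameters. Induction on that number,
  splitting at a break point, extends any transitive relation from the smooth pieces.\<close>

lemma piecewise_C1_curve_induct:
  assumes \<gamma>: "piecewise_C1_curve M P J \<gamma>"
    and step: "\<And>a b v. \<lbrakk>a \<in> J; b \<in> J; a < b; continuous_on {a..b} \<gamma>;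
        \<And>s. s \<in> {a..b} \<Longrightarrow> \<gamma> s \<in> M \<and> (\<gamma> has_vector_derivative v s) (at s within {a..b}) \<and> P (\<gamma> s) (v s)\<rbrakk> \<Longrightarrow> Q a b"
    and trans: "\<And>a b c. \<lbrakk>a \<in> J; b \<in> J; c \<in> J; a < b; b < c; Q a b; Q b c\<rbrakk> \<Longrightarrow> Q a c"
    and "a \<in> J" "b \<in> J" "a < b"
  shows "Q a b"
proof -
  have J: "is_interval J" and cont: "continuous_on J \<gamma>" and im: "\<gamma> ` J \<subseteq> M"
    using \<gamma> by (auto simp: piecewise_C1_curve_def)
  have "\<exists>K. (\<forall>a b. finite (K \<inter> {a..b})) \<and>
        (\<forall>a\<in>J. \<forall>b\<in>J. a < b \<and> K \<inter> {a<..<b} = {} \<longrightarrow>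
           (\<exists>v. continuous_on {a..b} v \<and>
              (\<forall>s\<in>{a..b}. (\<gamma> has_vector_derivative v s) (at s within {a..b}) \<and> P (\<gamma> s) (v s))))"
    using \<gamma> unfolding piecewise_C1_curve_def by (elim conjE)
  then obtain K where K0: "(\<forall>a b. finite (K \<inter> {a..b})) \<and>
        (\<forall>a\<in>J. \<forall>b\<in>J. a < b \<and> K \<inter> {a<..<b} = {} \<longrightarrow>
           (\<exists>v. continuous_on {a..b} v \<and>
              (\<forall>s\<in>{a..b}. (\<gamma> has_vector_derivative v s) (at s within {a..b}) \<and> P (\<gamma> s) (v s))))"
    by (rule exE)
  have fin: "finite (K \<inter> {a..b})" for a b using K0 by simp
  note K = conjunct2[OF K0, rule_format, OF _ _ conjI]
  have fin': "finite (K \<inter> {a<..<b})" for a b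
    by (rule finite_subset[OF _ fin[of a b]]) auto
  show ?thesis using assms(4-6)
  proof (induction "card (K \<inter> {a<..<b})" arbitrary: a b rule: less_induct)
    case less
    have sub: "{a..b} \<subseteq> J" using mem_is_interval_1_I[OF J less.prems(1,2)] by auto
    show ?case
    proof (cases "K \<inter> {a<..<b} = {}")
      case True
      from K[OF less.prems True] obtain v where
        v: "\<And>s. s \<in> {a..b} \<Longrightarrow> (\<gamma> has_vector_derivative v s) (at s within {a..b}) \<and> P (\<gamma> s) (v s)"
        by (elim exE conjE) (rule that, rule bspec)
      show ?thesis
        by (rule step[OF less.prems continuous_on_subset[OF cont sub], of v]) (use v sub im in blast)
    next
      case False
      then obtain k where k: "k \<in> K" "a < k" "k < b" by auto
      have kJ: "k \<in> J" using k sub by auto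
      have "K \<inter> {a<..<k} \<subset> K \<inter> {a<..<b}" "K \<inter> {k<..<b} \<subset> K \<inter> {a<..<b}" using k by auto
      then have "card (K \<inter> {a<..<k}) < card (K \<inter> {a<..<b})" "card (K \<inter> {k<..<b}) < card (K \<inter> {a<..<b})"
        by (simp_all add: psubset_card_mono fin')
      then show ?thesis using less.hyps less.prems k kJ trans[of a k b] by blast
    qed
  qed
qed

text \<open>
  The sign \<open>e\<close> is the time orientation; the condition \<open>0 \<le> e * b\<close> says that the warping
  function does not decrease after time \<open>0\<close>.
\<close>

locale nariai_future =
  fixes \<Lambda> a b e :: real
  assumes \<Lambda>: "\<Lambda> > 0" and a: "a > 0" and e: "e = 1 \<or> e = - 1" and eb: "0 \<le> e * b"
begin

abbreviation S where "S \<equiv> nariai_dir e \<Lambda> a b"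
abbreviation I where "I \<equiv> nariai_interval a b"
abbreviation w where "w \<equiv> nariai_warp a b"

section \<open>The warping function towards the future, and what causality bounds\<close>

lemma ee [simp]: "e * e = 1" "e * (e * x) = x" "e \<noteq> 0" "e\<^sup>2 = 1" "\<bar>e\<bar> = 1"
  using e by auto

lemma points_S [simp]: "points S = I \<times> UNIV \<times> sphere 0 1"
  by (simp add: nariai_dir_def points_nariai_cover)

lemma metric_S: "metric S p u v = 1 / \<Lambda> * (- (fst u * fst v) +
     (w (fst p))\<^sup>2 * (fst (snd u) * fst (snd v)) + snd (snd u) \<bullet> snd (snd v))"
  by (simp add: nariai_dir_def metric_nariai_cover)

lemma time_dir_S: "time_dir S p = (e, 0, 0)"
  by (simp add: nariai_dir_def)

lemma w_split: "w t = a * cosh t + (e * b) * (e * sinh t)"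
  using e by (auto simp: nariai_warp_def)

lemma sinh_sign: "0 \<le> e * t \<Longrightarrow> 0 \<le> e * sinh t"
  using e by auto

lemma w_ge: assumes "0 \<le> e * t" shows "w t \<ge> a * cosh t"
  unfolding w_split using mult_nonneg_nonneg[OF eb sinh_sign[OF assms]] by simp

lemma w_ge_a: assumes "0 \<le> e * t" shows "w t \<ge> a"
proof -
  have "a * 1 \<le> a * cosh t" using a by (intro mult_left_mono cosh_real_ge_1) auto
  then show ?thesis using w_ge[OF assms] by simp
qed

lemma w_ge_exp: assumes "0 \<le> e * t" shows "w t \<ge> a / 2 * exp (e * t)"
proof -
  have "exp (e * t) \<le> 2 * cosh t" using e by (auto simp: cosh_def)
  then have "a / 2 * exp (e * t) \<le> a / 2 * (2 * cosh t)" using a by (intro mult_left_mono) auto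
  then show ?thesis using w_ge[OF assms] by simp
qed

lemma zero_in_I: "0 \<in> I" using a by (rule zero_in_nariai_interval)

lemma nonneg_in_I: assumes "0 \<le> e * t" shows "t \<in> I"
proof -
  have "closed_segment 0 t \<subseteq> I"
  proof (rule subset_nariai_interval)
    fix u assume "u \<in> closed_segment 0 t"
    then have "0 \<le> e * u" using assms e by (auto simp: closed_segment_eq_real_ivl split: if_splits)
    then show "w u > 0" using w_ge_a a by fastforce
  qed auto
  then show ?thesis by auto
qed

text \<open>A possible end of the interval lies in the past: before time 0 the point sits between
  \<open>t\<close> and 0, afterwards the warping function is at least \<open>a\<close>.\<close>

lemma later_in_I: assumes "t \<in> I" "e * t \<le> e * t'" shows "t' \<in> I"
proof (cases "0 \<le> e * t'")
  case False
  then have "t \<le> t' \<and> t' \<le> 0 \<or> 0 \<le> t' \<and> t' \<le> t" using e assms(2) by auto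
  then show ?thesis using mem_is_interval_1_I[OF is_interval_nariai_interval] assms(1) zero_in_I by blast
qed (rule nonneg_in_I)

lemma w_pos: "t \<in> I \<Longrightarrow> w t > 0" by (rule nariai_warp_pos)

text \<open>A minimum exists on the compact segment from \<open>t0\<close> to 0, and
  \<open>a\<close> is a lower bound from then on. The bound holds on the entire future of
  \<open>t0\<close>, so it turns elapsed time into a bound for the \<rho>-distance.\<close>

lemma w_lower_bound:
  assumes t0: "t0 \<in> I"
  obtains \<delta> where "\<delta> > 0" "\<And>t. e * t0 \<le> e * t \<Longrightarrow> w t \<ge> \<delta>"
proof -
  have sub: "closed_segment t0 0 \<subseteq> I"
    using is_interval_nariai_interval t0 zero_in_I
    by (metis closed_segment_subset is_interval_convex)
  obtain m where m: "m \<in> closed_segment t0 0" "\<And>t. t \<in> closed_segment t0 0 \<Longrightarrow> w m \<le> w t"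
    using continuous_attains_inf[OF compact_segment _ continuous_on_nariai_warp[OF continuous_on_id], of t0 0 a b]
    by auto
  have "w t \<ge> min (w m) a" if "e * t0 \<le> e * t" for t
  proof (cases "0 \<le> e * t")
    case True then show ?thesis using w_ge_a by fastforce
  next
    case False
    then have "t \<in> closed_segment t0 0" using that e by (auto simp: closed_segment_eq_real_ivl)
    then show ?thesis using m by fastforce
  qed
  moreover have "min (w m) a > 0" using a w_pos m sub by auto
  ultimately show ?thesis using that by blast
qed

text \<open>Both spatial speeds are controlled by the speed of oriented time, since the two spatial
  terms of the metric are separately nonnegative.\<close>

lemma future_causal_vec_S:
  assumes p: "p \<in> points S" and v: "future_causal_vec S p v"
  shows "0 < e * fst v" "w (fst p) * \<bar>fst (snd v)\<bar> \<le> e * fst v" "norm (snd (snd v)) \<le> e * fst v"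
proof -
  have 1: "1 / \<Lambda> * (- (fst v * fst v) + (w (fst p))\<^sup>2 * (fst (snd v) * fst (snd v)) + snd (snd v) \<bullet> snd (snd v)) \<le> 0"
    and 2: "1 / \<Lambda> * (- (fst v * e)) < 0"
    using v by (auto simp: future_causal_vec_def causal_vec_def metric_S time_dir_S)
  have le: "(w (fst p) * \<bar>fst (snd v)\<bar>)\<^sup>2 + (norm (snd (snd v)))\<^sup>2 \<le> (fst v)\<^sup>2"
    using 1 \<Lambda> by (simp add: power_mult_distrib power2_norm_eq_inner field_simps) (simp add: power2_eq_square)
  show pos: "0 < e * fst v" using 2 \<Lambda> by (simp add: field_simps)
  have sq: "(fst v)\<^sup>2 = (e * fst v)\<^sup>2" by (simp add: power_mult_distrib)
  have "(w (fst p) * \<bar>fst (snd v)\<bar>)\<^sup>2 \<le> (e * fst v)\<^sup>2"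
    using le zero_le_power2[of "norm (snd (snd v))"] unfolding sq by linarith
  then show "w (fst p) * \<bar>fst (snd v)\<bar> \<le> e * fst v"
    using pos by (metis less_eq_real_def power2_le_imp_le)
  have "(norm (snd (snd v)))\<^sup>2 \<le> (e * fst v)\<^sup>2"
    using le zero_le_power2[of "w (fst p) * \<bar>fst (snd v)\<bar>"] unfolding sq by linarith
  then show "norm (snd (snd v)) \<le> e * fst v"
    using pos by (metis less_eq_real_def power2_le_imp_le)
qed

lemma future_timelike_imp_causal: "future_timelike_vec S p v \<Longrightarrow> future_causal_vec S p v"
  by (auto simp: future_timelike_vec_def future_causal_vec_def causal_vec_def metric_S)

lemma future_timelike_curve_imp_causal:
  assumes "future_timelike_curve S J \<gamma>" shows "future_causal_curve S J \<gamma>"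
proof -
  obtain K where K: "\<forall>a b. finite (K \<inter> {a..b})"
      "\<forall>a\<in>J. \<forall>b\<in>J. a < b \<and> K \<inter> {a<..<b} = {} \<longrightarrow>
           (\<exists>v. continuous_on {a..b} v \<and>
              (\<forall>s\<in>{a..b}. (\<gamma> has_vector_derivative v s) (at s within {a..b}) \<and> future_timelike_vec S (\<gamma> s) (v s)))"
    using assms unfolding piecewise_C1_curve_def by blast
  then have "\<forall>a\<in>J. \<forall>b\<in>J. a < b \<and> K \<inter> {a<..<b} = {} \<longrightarrow>
           (\<exists>v. continuous_on {a..b} v \<and>
              (\<forall>s\<in>{a..b}. (\<gamma> has_vector_derivative v s) (at s within {a..b}) \<and> future_causal_vec S (\<gamma> s) (v s)))"
    using future_timelike_imp_causal by meson
  with K(1) assms show ?thesis unfolding piecewise_C1_curve_def by blast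
qed

text \<open>Integrated form of causality between two parameters, chosen so that it composes across
  break points. The third clause is a Lipschitz bound for each lower bound \<delta> of \<Phi> on the
  future of the start; the last one integrates 1 / \<Phi> \<le> (2 / a) exp (- \<tau>) after time
  0.\<close>

definition causal_step :: "(real \<Rightarrow> real \<times> real \<times> (real^3)) \<Rightarrow> real \<Rightarrow> real \<Rightarrow> bool" where
  "causal_step \<gamma> s s' \<longleftrightarrow>
     e * fst (\<gamma> s) < e * fst (\<gamma> s') \<and>
     norm (snd (snd (\<gamma> s')) - snd (snd (\<gamma> s))) \<le> e * fst (\<gamma> s') - e * fst (\<gamma> s) \<and>
     (\<forall>\<delta>>0. (\<forall>t. e * fst (\<gamma> s) \<le> e * t \<longrightarrow> \<delta> \<le> w t) \<longrightarrow>
        \<bar>fst (snd (\<gamma> s')) - fst (snd (\<gamma> s))\<bar> \<le> (e * fst (\<gamma> s') - e * fst (\<gamma> s)) / \<delta>) \<and>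
     (0 \<le> e * fst (\<gamma> s) \<longrightarrow> \<bar>fst (snd (\<gamma> s')) - fst (snd (\<gamma> s))\<bar> \<le>
        2 / a * (exp (- (e * fst (\<gamma> s))) - exp (- (e * fst (\<gamma> s')))))"

lemma causal_step_trans:
  assumes "causal_step \<gamma> r s" "causal_step \<gamma> s u" shows "causal_step \<gamma> r u"
  unfolding causal_step_def
proof (intro conjI allI impI)
  show lt: "e * fst (\<gamma> r) < e * fst (\<gamma> u)" using assms unfolding causal_step_def by linarith
  show "norm (snd (snd (\<gamma> u)) - snd (snd (\<gamma> r))) \<le> e * fst (\<gamma> u) - e * fst (\<gamma> r)"
    using assms norm_triangle_ineq[of "snd (snd (\<gamma> u)) - snd (snd (\<gamma> s))" "snd (snd (\<gamma> s)) - snd (snd (\<gamma> r))"]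
    unfolding causal_step_def by simp
  fix \<delta> :: real assume \<delta>: "\<delta> > 0" "\<forall>t. e * fst (\<gamma> r) \<le> e * t \<longrightarrow> \<delta> \<le> w t"
  have rs: "e * fst (\<gamma> r) < e * fst (\<gamma> s)" using assms(1) by (simp add: causal_step_def)
  have "\<forall>t. e * fst (\<gamma> s) \<le> e * t \<longrightarrow> \<delta> \<le> w t" using \<delta>(2) rs by auto
  then have "\<bar>fst (snd (\<gamma> u)) - fst (snd (\<gamma> s))\<bar> \<le> (e * fst (\<gamma> u) - e * fst (\<gamma> s)) / \<delta>"
    using assms(2) \<delta>(1) by (simp add: causal_step_def)
  moreover have "\<bar>fst (snd (\<gamma> s)) - fst (snd (\<gamma> r))\<bar> \<le> (e * fst (\<gamma> s) - e * fst (\<gamma> r)) / \<delta>"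
    using assms(1) \<delta> by (simp add: causal_step_def)
  ultimately show "\<bar>fst (snd (\<gamma> u)) - fst (snd (\<gamma> r))\<bar> \<le> (e * fst (\<gamma> u) - e * fst (\<gamma> r)) / \<delta>"
    by (simp add: diff_divide_distrib)
next
  assume 0: "0 \<le> e * fst (\<gamma> r)"
  have "0 \<le> e * fst (\<gamma> s)" using 0 assms(1) unfolding causal_step_def by linarith
  then have 1: "\<bar>fst (snd (\<gamma> u)) - fst (snd (\<gamma> s))\<bar> \<le> 2 / a * (exp (- (e * fst (\<gamma> s))) - exp (- (e * fst (\<gamma> u))))"
    using assms(2) by (simp add: causal_step_def)
  have 2: "\<bar>fst (snd (\<gamma> s)) - fst (snd (\<gamma> r))\<bar> \<le> 2 / a * (exp (- (e * fst (\<gamma> r))) - exp (- (e * fst (\<gamma> s))))"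
    using 0 assms(1) by (simp add: causal_step_def)
  show "\<bar>fst (snd (\<gamma> u)) - fst (snd (\<gamma> r))\<bar> \<le> 2 / a * (exp (- (e * fst (\<gamma> r))) - exp (- (e * fst (\<gamma> u))))"
    using 1 2 unfolding right_diff_distrib by linarith
qed

text \<open>The mean value inequality on a smooth piece, with comparison functions \<tau>, \<tau> /
  \<delta> and -(2 / a) exp (- \<tau>), where \<tau> is oriented time.\<close>

lemma causal_step_C1:
  assumes st: "s < s'" and cont: "continuous_on {s..s'} \<gamma>"
    and v: "\<And>u. u \<in> {s..s'} \<Longrightarrow> \<gamma> u \<in> points S \<and> (\<gamma> has_vector_derivative v u) (at u within {s..s'}) \<and> future_causal_vec S (\<gamma> u) (v u)"
  shows "causal_step \<gamma> s s'"
proof -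
  define \<tau> where "\<tau> u = e * fst (\<gamma> u)" for u
  have vd: "(\<gamma> has_vector_derivative v u) (at u)" if "s < u" "u < s'" for u
    using v[of u] that by (simp add: at_within_Icc_at)
  have td: "(\<tau> has_vector_derivative e * fst (v u)) (at u)" if "s < u" "u < s'" for u
    unfolding \<tau>_def[abs_def] has_vector_derivative_def
    by (rule has_derivative_eq_rhs[OF has_derivative_mult_right[OF
          has_derivative_fst[OF vd[OF that, unfolded has_vector_derivative_def]]]]) (simp add: fun_eq_iff)
  have rd: "((\<lambda>u. fst (snd (\<gamma> u))) has_vector_derivative fst (snd (v u))) (at u)" if "s < u" "u < s'" for u
    using has_derivative_fst[OF has_derivative_snd[OF vd[OF that, unfolded has_vector_derivative_def]]]
    unfolding has_vector_derivative_def by simp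
  have yd: "((\<lambda>u. snd (snd (\<gamma> u))) has_vector_derivative snd (snd (v u))) (at u)" if "s < u" "u < s'" for u
    using has_derivative_snd[OF has_derivative_snd[OF vd[OF that, unfolded has_vector_derivative_def]]]
    unfolding has_vector_derivative_def by simp
  have cl: "0 < e * fst (v u)" "w (fst (\<gamma> u)) * \<bar>fst (snd (v u))\<bar> \<le> e * fst (v u)" "norm (snd (snd (v u))) \<le> e * fst (v u)"
    if "s < u" "u < s'" for u
    using future_causal_vec_S[of "\<gamma> u" "v u"] v[of u] that by auto
  have ct: "continuous_on T \<tau>" if "T \<subseteq> {s..s'}" for T
    unfolding \<tau>_def by (intro continuous_intros continuous_on_subset[OF cont that])
  have cr: "continuous_on {s..s'} (\<lambda>u. fst (snd (\<gamma> u)))" by (intro continuous_intros cont)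
  have cy: "continuous_on {s..s'} (\<lambda>u. snd (snd (\<gamma> u)))" by (intro continuous_intros cont)
  have less: "\<tau> x < \<tau> y" if "s \<le> x" "x < y" "y \<le> s'" for x y
  proof (rule DERIV_pos_imp_increasing_open[OF that(2)])
    show "\<exists>d. (\<tau> has_real_derivative d) (at u) \<and> 0 < d" if "x < u" "u < y" for u
      using td[of u] cl(1)[of u] that \<open>s \<le> x\<close> \<open>y \<le> s'\<close>
      by (auto simp: has_real_derivative_iff_has_vector_derivative)
  qed (rule ct, use that in auto)
  have "norm (snd (snd (\<gamma> s')) - snd (snd (\<gamma> s))) \<le> \<tau> s' - \<tau> s"
    by (rule differentiable_bound_general[OF st cy ct yd td cl(3)]) auto
  moreover have "\<bar>fst (snd (\<gamma> s')) - fst (snd (\<gamma> s))\<bar> \<le> (\<tau> s' - \<tau> s) / \<delta>"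
    if \<delta>: "\<delta> > 0" "\<forall>t. \<tau> s \<le> e * t \<longrightarrow> \<delta> \<le> w t" for \<delta>
  proof -
    have "norm (fst (snd (\<gamma> s')) - fst (snd (\<gamma> s))) \<le> \<tau> s' / \<delta> - \<tau> s / \<delta>"
    proof (rule differentiable_bound_general[OF st cr _ rd])
      show "continuous_on {s..s'} (\<lambda>u. \<tau> u / \<delta>)" using \<delta> by (intro continuous_intros ct) auto
      fix u assume u: "s < u" "u < s'"
      show "((\<lambda>u. \<tau> u / \<delta>) has_vector_derivative e * fst (v u) / \<delta>) (at u)"
        using td[OF u] unfolding has_real_derivative_iff_has_vector_derivative[symmetric]
        by (rule DERIV_cdivide)
      have "\<delta> \<le> w (fst (\<gamma> u))" using \<delta>(2) less[of s u] u by (auto simp: \<tau>_def)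
      then have "\<delta> * \<bar>fst (snd (v u))\<bar> \<le> w (fst (\<gamma> u)) * \<bar>fst (snd (v u))\<bar>" by (intro mult_right_mono) auto
      also have "\<dots> \<le> e * fst (v u)" by (rule cl(2)[OF u])
      finally show "norm (fst (snd (v u))) \<le> e * fst (v u) / \<delta>"
        using \<delta>(1) by (simp add: field_simps)
    qed
    then show ?thesis by (simp add: diff_divide_distrib)
  qed
  moreover have "\<bar>fst (snd (\<gamma> s')) - fst (snd (\<gamma> s))\<bar> \<le> 2 / a * (exp (- \<tau> s) - exp (- \<tau> s'))" if 0: "0 \<le> \<tau> s"
  proof -
    \<comment> \<open>The comparison function is the primitive, along the curve, of the bound (2 /
      a) exp (- \<tau>) for 1 / \<Phi>.\<close>
    have "norm (fst (snd (\<gamma> s')) - fst (snd (\<gamma> s))) \<le> - (2 / a * exp (- \<tau> s')) - - (2 / a * exp (- \<tau> s))"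
    proof (rule differentiable_bound_general[OF st cr _ rd])
      show "continuous_on {s..s'} (\<lambda>u. - (2 / a * exp (- \<tau> u)))" by (intro continuous_intros ct) auto
      fix u assume u: "s < u" "u < s'"
      show "((\<lambda>u. - (2 / a * exp (- \<tau> u))) has_vector_derivative 2 / a * exp (- \<tau> u) * (e * fst (v u))) (at u)"
        using td[OF u] a unfolding has_real_derivative_iff_has_vector_derivative[symmetric]
        by (auto intro!: derivative_eq_intros)
      have "0 \<le> e * fst (\<gamma> u)" using 0 less[of s u] u by (auto simp: \<tau>_def)
      from w_ge_exp[OF this] have "a / 2 * exp (\<tau> u) \<le> w (fst (\<gamma> u))" by (simp add: \<tau>_def)
      then have "a / 2 * exp (\<tau> u) * \<bar>fst (snd (v u))\<bar> \<le> w (fst (\<gamma> u)) * \<bar>fst (snd (v u))\<bar>"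
        by (intro mult_right_mono) auto
      also have "\<dots> \<le> e * fst (v u)" by (rule cl(2)[OF u])
      finally have "2 / a * exp (- \<tau> u) * (a / 2 * exp (\<tau> u) * \<bar>fst (snd (v u))\<bar>) \<le> 2 / a * exp (- \<tau> u) * (e * fst (v u))"
        using a by (intro mult_left_mono) auto
      moreover have "2 / a * exp (- \<tau> u) * (a / 2 * exp (\<tau> u) * \<bar>fst (snd (v u))\<bar>) = \<bar>fst (snd (v u))\<bar>"
        using a by (simp add: exp_minus field_simps)
      ultimately show "norm (fst (snd (v u))) \<le> 2 / a * exp (- \<tau> u) * (e * fst (v u))" by simp
    qed
    then show ?thesis unfolding right_diff_distrib by simp
  qed
  ultimately show ?thesis
    using less[of s s'] st unfolding causal_step_def \<tau>_def by auto
qed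

lemma future_causal_curve_step:
  assumes "future_causal_curve S J \<gamma>" "s \<in> J" "s' \<in> J" "s < s'"
  shows "causal_step \<gamma> s s'"
  by (rule piecewise_C1_curve_induct[OF assms(1) _ _ assms(2-4), where Q = "causal_step \<gamma>"])
     (blast intro: causal_step_C1 causal_step_trans)+

lemma future_causal_curve_points: "future_causal_curve S J \<gamma> \<Longrightarrow> s \<in> J \<Longrightarrow> \<gamma> s \<in> I \<times> UNIV \<times> sphere 0 1"
  by (auto simp: piecewise_C1_curve_def)

text \<open>Time and sphere component contribute 1 each to the Lipschitz constant, and \<rho>
  contributes 1 / \<delta>.\<close>

lemma causal_step_dist:
  assumes "causal_step \<gamma> s s'" "\<delta> > 0" "\<And>t. e * fst (\<gamma> s) \<le> e * t \<Longrightarrow> \<delta> \<le> w t"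
  shows "dist (\<gamma> s) (\<gamma> s') \<le> (2 + 1 / \<delta>) * (e * fst (\<gamma> s') - e * fst (\<gamma> s))"
proof -
  let ?D = "e * fst (\<gamma> s') - e * fst (\<gamma> s)"
  have "\<bar>fst (\<gamma> s') - fst (\<gamma> s)\<bar> = \<bar>e * (fst (\<gamma> s') - fst (\<gamma> s))\<bar>" by (simp add: abs_mult)
  then have "\<bar>fst (\<gamma> s') - fst (\<gamma> s)\<bar> = ?D" using assms(1) by (simp add: causal_step_def right_diff_distrib)
  moreover have "\<bar>fst (snd (\<gamma> s')) - fst (snd (\<gamma> s))\<bar> \<le> ?D / \<delta>"
    "norm (snd (snd (\<gamma> s')) - snd (snd (\<gamma> s))) \<le> ?D"
    using assms by (auto simp: causal_step_def)
  moreover have "dist (\<gamma> s) (\<gamma> s') \<le> \<bar>fst (\<gamma> s') - fst (\<gamma> s)\<bar> +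
     (\<bar>fst (snd (\<gamma> s')) - fst (snd (\<gamma> s))\<bar> + norm (snd (snd (\<gamma> s')) - snd (snd (\<gamma> s))))"
  proof -
    have "norm (\<gamma> s' - \<gamma> s) \<le> norm (fst (\<gamma> s' - \<gamma> s)) + norm (snd (\<gamma> s' - \<gamma> s))"
      using norm_Pair_le[of "fst (\<gamma> s' - \<gamma> s)" "snd (\<gamma> s' - \<gamma> s)"] by (simp only: prod.collapse)
    moreover have "norm (snd (\<gamma> s' - \<gamma> s)) \<le> norm (fst (snd (\<gamma> s' - \<gamma> s))) + norm (snd (snd (\<gamma> s' - \<gamma> s)))"
      using norm_Pair_le[of "fst (snd (\<gamma> s' - \<gamma> s))" "snd (snd (\<gamma> s' - \<gamma> s))"] by (simp only: prod.collapse)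
    ultimately show ?thesis by (simp add: dist_norm norm_minus_commute[of "\<gamma> s"])
  qed
  ultimately have "dist (\<gamma> s) (\<gamma> s') \<le> ?D + (?D / \<delta> + ?D)" by linarith
  then show ?thesis by (simp add: algebra_simps add_divide_distrib diff_divide_distrib)
qed

text \<open>With oriented time bounded the curve has finite length and converges; the limit is no
  earlier than the starting time, hence belongs to the manifold. So a future inextendible curve
  reaches every later time.\<close>

lemma converges_to_future:
  assumes \<gamma>: "future_causal_curve S J \<gamma>" and s0: "s0 \<in> J" and B: "\<And>s. s \<in> J \<Longrightarrow> e * fst (\<gamma> s) \<le> B"
  shows "\<not> upper_inextendible (points S) J \<gamma>"
proof -
  note pts = future_causal_curve_points[OF \<gamma>]
  obtain \<delta> where \<delta>: "\<delta> > 0" "\<And>t. e * fst (\<gamma> s0) \<le> e * t \<Longrightarrow> w t \<ge> \<delta>"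
    using w_lower_bound pts[OF s0] by (metis mem_Times_iff)
  have mono: "e * fst (\<gamma> s) \<le> e * fst (\<gamma> s')" if "s \<in> J" "s' \<in> J" "s \<le> s'" for s s'
    using future_causal_curve_step[OF \<gamma> that(1,2)] that(3) by (cases "s = s'") (auto simp: causal_step_def)
  have "dist (\<gamma> s) (\<gamma> s') \<le> (2 + 1 / \<delta>) * (e * fst (\<gamma> s') - e * fst (\<gamma> s))"
    if "s \<in> J" "s' \<in> J" "s0 \<le> s" "s \<le> s'" for s s'
  proof (cases "s = s'")
    case False
    then have "causal_step \<gamma> s s'" using future_causal_curve_step[OF \<gamma> that(1,2)] that(4) by simp
    then show ?thesis
      by (rule causal_step_dist) (use \<delta> mono[OF s0 that(1,3)] in \<open>auto intro: order_trans\<close>)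
  qed simp
  then have "\<exists>q. \<forall>U. open U \<and> q \<in> U \<longrightarrow> (\<exists>s0\<in>J. \<forall>s\<in>J. s0 \<le> s \<longrightarrow> \<gamma> s \<in> U)"
    by (intro curve_converges[OF s0, where g = "\<lambda>s. e * fst (\<gamma> s)" and K = "2 + 1 / \<delta>" and B = B])
       (use B mono \<delta> in auto)
  then obtain q where q: "\<forall>U. open U \<and> q \<in> U \<longrightarrow> (\<exists>s0\<in>J. \<forall>s\<in>J. s0 \<le> s \<longrightarrow> \<gamma> s \<in> U)" by blast
  have "q \<in> {p. e * fst (\<gamma> s0) \<le> e * fst p \<and> norm (snd (snd p)) = 1}"
  proof (rule limit_in_closed[OF q _ _ s0])
    show "closed {p :: real \<times> real \<times> (real^3). e * fst (\<gamma> s0) \<le> e * fst p \<and> norm (snd (snd p)) = 1}"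
      by (intro closed_Collect_conj closed_Collect_le closed_Collect_eq continuous_intros)
  qed (use pts mono[OF s0] in \<open>fastforce simp: mem_Times_iff\<close>)
  then have "q \<in> points S" using later_in_I pts[OF s0] by (auto simp: mem_Times_iff)
  with q show ?thesis unfolding upper_inextendible_def by blast
qed

text \<open>Reversing the parameter reduces this to a limit at an upper end. Staying at nonnegative
  oriented time provides the lower bound \<open>a\<close> for \<Phi> and keeps the limit away from a
  possible past end of the interval.\<close>

lemma converges_to_past:
  assumes \<gamma>: "future_causal_curve S J \<gamma>" and s0: "s0 \<in> J" and B: "\<And>s. s \<in> J \<Longrightarrow> 0 \<le> e * fst (\<gamma> s)"
  shows "\<not> lower_inextendible (points S) J \<gamma>"
proof -
  note pts = future_causal_curve_points[OF \<gamma>]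
  let ?J = "uminus ` J" and ?\<gamma> = "\<lambda>s. \<gamma> (- s)"
  have mono: "e * fst (\<gamma> s) \<le> e * fst (\<gamma> s')" if "s \<in> J" "s' \<in> J" "s \<le> s'" for s s'
    using future_causal_curve_step[OF \<gamma> that(1,2)] that(3) by (cases "s = s'") (auto simp: causal_step_def)
  have "dist (?\<gamma> s) (?\<gamma> s') \<le> (2 + 1 / a) * (- (e * fst (?\<gamma> s')) - - (e * fst (?\<gamma> s)))"
    if "s \<in> ?J" "s' \<in> ?J" "s \<le> s'" for s s'
  proof (cases "s = s'")
    case False
    have J: "- s' \<in> J" "- s \<in> J" using that by auto
    then have "causal_step \<gamma> (- s') (- s)" using future_causal_curve_step[OF \<gamma> J] that False by simp
    from causal_step_dist[OF this a] have "dist (\<gamma> (- s')) (\<gamma> (- s)) \<le> (2 + 1 / a) * (e * fst (\<gamma> (- s)) - e * fst (\<gamma> (- s')))"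
      using w_ge_a B[OF J(1)] by (meson order_trans)
    then show ?thesis by (simp add: dist_commute)
  qed simp
  then have "\<exists>q. \<forall>U. open U \<and> q \<in> U \<longrightarrow> (\<exists>s0\<in>?J. \<forall>s\<in>?J. s0 \<le> s \<longrightarrow> ?\<gamma> s \<in> U)"
    using a B mono
    by (intro curve_converges[where ?s0.0 = "- s0" and g = "\<lambda>s. - (e * fst (?\<gamma> s))" and K = "2 + 1 / a" and B = 0])
       (use s0 in auto)
  then obtain q where q: "\<forall>U. open U \<and> q \<in> U \<longrightarrow> (\<exists>s0\<in>?J. \<forall>s\<in>?J. s0 \<le> s \<longrightarrow> ?\<gamma> s \<in> U)" by blast
  have "q \<in> {p. 0 \<le> e * fst p \<and> norm (snd (snd p)) = 1}"
  proof (rule limit_in_closed[OF q])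
    show "closed {p :: real \<times> real \<times> (real^3). 0 \<le> e * fst p \<and> norm (snd (snd p)) = 1}"
      by (intro closed_Collect_conj closed_Collect_le closed_Collect_eq continuous_intros)
    show "- s0 \<in> ?J" using s0 by simp
  qed (use pts B in \<open>fastforce simp: mem_Times_iff\<close>)
  then have "q \<in> points S" using nonneg_in_I by (auto simp: mem_Times_iff)
  moreover have "\<forall>U. open U \<and> q \<in> U \<longrightarrow> (\<exists>s0\<in>J. \<forall>s\<in>J. s \<le> s0 \<longrightarrow> \<gamma> s \<in> U)"
  proof (intro allI impI)
    fix U assume "open U \<and> q \<in> U"
    then obtain s1 where s1: "s1 \<in> ?J" "\<forall>s\<in>?J. s1 \<le> s \<longrightarrow> ?\<gamma> s \<in> U" using q by blast
    have "\<gamma> s \<in> U" if "s \<in> J" "s \<le> - s1" for s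
      using s1(2)[rule_format, of "- s"] that by simp
    then show "\<exists>s0\<in>J. \<forall>s\<in>J. s \<le> s0 \<longrightarrow> \<gamma> s \<in> U" using s1(1) by (intro bexI[of _ "- s1"]) auto
  qed
  ultimately show ?thesis unfolding lower_inextendible_def by blast
qed

text \<open>The two convergence lemmas produce points of an inextendible curve on either side of
  time 0; the intermediate value theorem gives a crossing, and strict growth of oriented time makes
  it unique.\<close>

lemma cauchy_surface_zero: "cauchy_surface S ({0} \<times> UNIV \<times> sphere 0 1)"
  unfolding cauchy_surface_def
proof (intro conjI allI impI)
  show "{0} \<times> UNIV \<times> sphere 0 1 \<subseteq> points S" using zero_in_I by auto
  fix J \<gamma> assume "future_timelike_curve S J \<gamma> \<and> inextendible (points S) J \<gamma>"
  then have \<gamma>: "future_causal_curve S J \<gamma>"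
    and inext: "upper_inextendible (points S) J \<gamma>" "lower_inextendible (points S) J \<gamma>"
    using future_timelike_curve_imp_causal by (auto simp: inextendible_def)
  note pts = future_causal_curve_points[OF \<gamma>]
  have J: "is_interval J" "J \<noteq> {}" "continuous_on J \<gamma>" using \<gamma> by (auto simp: piecewise_C1_curve_def)
  then obtain s0 where s0: "s0 \<in> J" by blast
  have "is_interval ((\<lambda>s. e * fst (\<gamma> s)) ` J)"
    using J unfolding is_interval_connected_1 by (intro connected_continuous_image continuous_intros)
  then have ivt: "\<exists>s\<in>J. e * fst (\<gamma> s) = 0" if "s1 \<in> J" "s2 \<in> J" "e * fst (\<gamma> s1) \<le> 0" "0 \<le> e * fst (\<gamma> s2)" for s1 s2
    using that mem_is_interval_1_I[of "(\<lambda>s. e * fst (\<gamma> s)) ` J" "e * fst (\<gamma> s1)" "e * fst (\<gamma> s2)" 0] by force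
  have "\<exists>s\<in>J. 0 \<le> e * fst (\<gamma> s)"
    using converges_to_future[OF \<gamma> s0, of 0] inext by force
  moreover have "\<exists>s\<in>J. e * fst (\<gamma> s) \<le> 0"
    using converges_to_past[OF \<gamma> s0] inext by force
  ultimately obtain s where s: "s \<in> J" "e * fst (\<gamma> s) = 0" using ivt by blast
  have uniq: "u = s" if "u \<in> J" "e * fst (\<gamma> u) = 0" for u
    using future_causal_curve_step[OF \<gamma>, of u s] future_causal_curve_step[OF \<gamma>, of s u] that s
    by (cases u s rule: linorder_cases) (auto simp: causal_step_def)
  show "\<exists>!s. s \<in> J \<and> \<gamma> s \<in> {0} \<times> UNIV \<times> sphere 0 1"
  proof (rule ex1I[of _ s])
    show "s \<in> J \<and> \<gamma> s \<in> {0} \<times> UNIV \<times> sphere 0 1"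
      using s pts[OF s(1)] by (simp add: mem_Times_iff)
    show "u = s" if "u \<in> J \<and> \<gamma> u \<in> {0} \<times> UNIV \<times> sphere 0 1" for u
      using that by (intro uniq) (auto simp: mem_Times_iff)
  qed
qed

lemma globally_hyperbolic_S: "globally_hyperbolic S"
  unfolding globally_hyperbolic_def using cauchy_surface_zero by blast

text \<open>The whole \<rho>-distance available after time 0 is at most the integral of (2 / a) exp
  (- \<tau>) over \<tau> \<ge> 0.\<close>

lemma future_rho_bound:
  assumes "causal_step \<gamma> s s'" "0 \<le> e * fst (\<gamma> s)"
  shows "\<bar>fst (snd (\<gamma> s')) - fst (snd (\<gamma> s))\<bar> \<le> 2 / a"
proof -
  have "\<bar>fst (snd (\<gamma> s')) - fst (snd (\<gamma> s))\<bar> \<le> 2 / a * (exp (- (e * fst (\<gamma> s))) - exp (- (e * fst (\<gamma> s'))))"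
    using assms by (simp add: causal_step_def)
  also have "\<dots> \<le> 2 / a * 1"
  proof (intro mult_left_mono)
    have "exp (- (e * fst (\<gamma> s))) \<le> 1" using assms(2) by simp
    then show "exp (- (e * fst (\<gamma> s))) - exp (- (e * fst (\<gamma> s'))) \<le> 1"
      using exp_gt_zero[of "- (e * fst (\<gamma> s'))"] by linarith
  qed (use a in simp)
  finally show ?thesis by simp
qed

lemma oblivious_S: "oblivious_to_topology S"
  unfolding oblivious_to_topology_def
proof (intro exI conjI notI)
  let ?C = "{0 :: real} \<times> (UNIV :: real set) \<times> sphere (0 :: real^3) 1"
  show "cauchy_surface S ?C" by (rule cauchy_surface_zero)
  assume "\<exists>J \<gamma>. future_causal_curve S J \<gamma> \<and> inextendible (points S) J \<gamma> \<and> ?C \<subseteq> causal_past S (\<gamma> ` J)"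
  then obtain J \<gamma> where \<gamma>: "future_causal_curve S J \<gamma>" and C: "?C \<subseteq> causal_past S (\<gamma> ` J)" by blast
  have near: "\<exists>s\<in>J. 0 \<le> e * fst (\<gamma> s) \<and> \<bar>fst (snd (\<gamma> s)) - fst (snd p)\<bar> \<le> 2 / a" if p: "p \<in> ?C" for p
  proof -
    have "p \<in> causal_past S (\<gamma> ` J)" using p C by blast
    then consider s where "s \<in> J" "p = \<gamma> s"
      | c x y s where "x < y" "future_causal_curve S {x..y} c" "c x = p" "s \<in> J" "c y = \<gamma> s"
      unfolding causal_past_def by blast
    then show ?thesis
    proof cases
      case 1
      then show ?thesis using p a by (intro bexI[of _ s]) auto
    next
      case 2
      have st: "causal_step c x y" using future_causal_curve_step[OF 2(2)] 2(1) by simp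
      have 0: "e * fst (c x) = 0" using p 2(3) by auto
      show ?thesis using future_rho_bound[OF st] st 0 2 by (intro bexI[of _ s]) (auto simp: causal_step_def)
    qed
  qed
  have pair: "\<bar>fst (snd (\<gamma> s)) - fst (snd (\<gamma> s'))\<bar> \<le> 2 / a"
    if "s \<in> J" "s' \<in> J" "0 \<le> e * fst (\<gamma> s)" "0 \<le> e * fst (\<gamma> s')" for s s'
    using future_rho_bound[OF future_causal_curve_step[OF \<gamma>, of s s']] future_rho_bound[OF future_causal_curve_step[OF \<gamma>, of s' s]] that a
    by (cases s s' rule: linorder_cases) (auto simp: abs_minus_commute)
  have "axis 1 1 \<in> sphere (0::real^3) 1" by simp
  \<comment> \<open>Two points of the slice in the past of one observer are joined by three legs,
    down from each and along the observer, each of \<rho>-length at most \<open>2 / a\<close>. A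
    separation of \<open>6 / a + 1\<close> is too large.\<close>
  then have "(0, 0, axis 1 1) \<in> ?C" "(0, 6 / a + 1, axis 1 1) \<in> ?C" by auto
  from near[OF this(1)] near[OF this(2)] obtain s s' where
    "s \<in> J" "0 \<le> e * fst (\<gamma> s)" "\<bar>fst (snd (\<gamma> s)) - 0\<bar> \<le> 2 / a"
    "s' \<in> J" "0 \<le> e * fst (\<gamma> s')" "\<bar>fst (snd (\<gamma> s')) - (6 / a + 1)\<bar> \<le> 2 / a" by auto
  with pair[of s s'] have "6 / a + 1 \<le> 2 / a + 2 / a + 2 / a" by linarith
  then show False by (simp add: field_simps)
qed

end

subsection \<open>Failure of complete obliviousness, and completeness\<close>

text \<open>In general \<open>n\<close> is the normalised part of \<open>y'\<close> orthogonal to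
  \<open>y\<close>. If that part is zero, the sine vanishes and any unit vector orthogonal to
  \<open>y\<close> serves.\<close>

lemma great_circle:
  fixes y y' :: "real^3"
  assumes y: "norm y = 1" and y': "norm y' = 1"
  obtains n where "norm n = 1" "y \<bullet> n = 0"
    "y' = cos (arccos (y \<bullet> y')) *\<^sub>R y + sin (arccos (y \<bullet> y')) *\<^sub>R n"
proof -
  define c where "c = y \<bullet> y'"
  define p where "p = y' - c *\<^sub>R y"
  have yy: "y \<bullet> y = 1" "y' \<bullet> y' = 1" using y y' by (simp_all add: norm_eq_1)
  have c: "\<bar>c\<bar> \<le> 1" using Cauchy_Schwarz_ineq2[of y y'] y y' by (simp add: c_def)
  have cs: "cos (arccos c) = c" "sin (arccos c) = sqrt (1 - c\<^sup>2)"
    using c by (simp_all add: cos_arccos_abs sin_arccos_abs)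
  have yp: "y \<bullet> p = 0" by (simp add: p_def inner_diff_right yy c_def)
  have "p \<bullet> p = 1 - c\<^sup>2"
    by (simp add: p_def inner_diff_left inner_diff_right yy inner_commute[of y' y] flip: c_def)
       (simp add: power2_eq_square)
  then have np: "norm p = sqrt (1 - c\<^sup>2)" by (simp add: norm_eq_sqrt_inner)
  show ?thesis
  proof (cases "p = 0")
    case True
    have "\<exists>x. x \<noteq> 0 \<and> y \<bullet> x = 0"
    proof (rule ccontr)
      assume "\<not> (\<exists>x. x \<noteq> 0 \<and> y \<bullet> x = 0)"
      then have "{x. y \<bullet> x = 0} \<subseteq> {0}" by auto
      then have "dim {x. y \<bullet> x = 0} = 0" by (simp add: dim_eq_0)
      moreover have "y \<noteq> 0" using y by auto
      ultimately show False by (simp add: dim_hyperplane)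
    qed
    then obtain x where x: "x \<noteq> 0" "y \<bullet> x = 0" by blast
    show ?thesis
    proof (rule that[of "x /\<^sub>R norm x"])
      show "y' = cos (arccos (y \<bullet> y')) *\<^sub>R y + sin (arccos (y \<bullet> y')) *\<^sub>R (x /\<^sub>R norm x)"
        using True np by (simp add: cs flip: c_def) (simp add: p_def)
    qed (use x in auto)
  next
    case False
    show ?thesis
    proof (rule that[of "p /\<^sub>R norm p"])
      have "sin (arccos c) *\<^sub>R (p /\<^sub>R norm p) = p"
        unfolding cs(2) np[symmetric] using False by simp
      then show "y' = cos (arccos (y \<bullet> y')) *\<^sub>R y + sin (arccos (y \<bullet> y')) *\<^sub>R (p /\<^sub>R norm p)"
        unfolding c_def[symmetric] cs(1) by (simp add: p_def)
    qed (use False yp in auto)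
  qed
qed

context nariai_future
begin

text \<open>The time interval in oriented time; as \<open>e\<close> is its own inverse, the
  coordinate time at \<open>s\<close> is \<open>e * s\<close>.\<close>

definition times :: "real set" where "times = {s. e * s \<in> I}"

lemma open_times: "open times"
proof -
  have "open ((\<lambda>s. e * s) -` I)" by (intro open_vimage open_nariai_interval continuous_intros)
  then show ?thesis by (simp add: times_def vimage_def)
qed

lemma is_interval_times: "is_interval times"
  unfolding is_interval_1
proof (intro ballI allI impI)
  fix x y z assume xyz: "x \<in> times" "y \<in> times" "x \<le> z \<and> z \<le> y"
  then have I: "e * x \<in> I" "e * y \<in> I" by (simp_all add: times_def)
  have "e * z \<in> I"
    using e
  proof
    assume "e = 1"
    then show ?thesis
      using I xyz(3) mem_is_interval_1_I[OF is_interval_nariai_interval, of x a b y z] by simp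
  next
    assume "e = - 1"
    then show ?thesis
      using I xyz(3) mem_is_interval_1_I[OF is_interval_nariai_interval, of "- y" a b "- x" "- z"] by simp
  qed
  then show "z \<in> times" by (simp add: times_def)
qed

lemma interior_times: "interior times \<noteq> {}"
proof -
  have "0 \<in> times" using zero_in_I by (simp add: times_def)
  then show ?thesis using interior_open[OF open_times] by auto
qed

lemma later_in_times: "s \<in> times \<Longrightarrow> s \<le> s' \<Longrightarrow> s' \<in> times"
  unfolding times_def using later_in_I[of "e * s" "e * s'"] by simp

lemma inextendible_times:
  assumes "\<And>s. s \<in> times \<Longrightarrow> fst (c s) = e * s"
  shows "inextendible (points S) times c"
  unfolding inextendible_def
proof
  show "upper_inextendible (points S) times c"
  proof (rule upper_inextendible_if_time_unbounded[where T = "\<lambda>p. e * fst p"])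
    fix q assume "q \<in> points S"
    then have "e * fst q \<in> times" by (auto simp: times_def)
    then obtain d where d: "d > e * fst q" "d \<in> times" using open_greater_ex[OF open_times] by metis
    have "\<exists>s\<in>times. s0 \<le> s \<and> d \<le> e * fst (c s)" if "s0 \<in> times" for s0
      using that d assms[of "max s0 d"] by (intro bexI[of _ "max s0 d"]) (auto simp: max_def split: if_splits)
    then show "\<exists>d>e * fst q. \<forall>s0\<in>times. \<exists>s\<in>times. s0 \<le> s \<and> d \<le> e * fst (c s)" using d(1) by blast
  qed (intro continuous_intros)
  show "lower_inextendible (points S) times c"
  proof (rule lower_inextendible_if_time_unbounded[where T = "\<lambda>p. - (e * fst p)"])
    fix q assume "q \<in> points S"
    then have "e * fst q \<in> times" by (auto simp: times_def)
    then obtain d where d: "d < e * fst q" "d \<in> times" using open_less_ex[OF open_times] by metis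
    have "\<exists>s\<in>times. s \<le> s0 \<and> - d \<le> - (e * fst (c s))" if "s0 \<in> times" for s0
      using that d assms[of "min s0 d"] by (intro bexI[of _ "min s0 d"]) (auto simp: min_def split: if_splits)
    then show "\<exists>d>- (e * fst q). \<forall>s0\<in>times. \<exists>s\<in>times. s \<le> s0 \<and> d \<le> - (e * fst (c s))"
      using d(1) by (intro exI[of _ "- d"]) auto
  qed (intro continuous_intros)
qed

text \<open>
  The curve rests at \<open>y\<close> until time \<open>\<tau>1\<close>, follows the great circle at constant speed less than
  \<open>1\<close> and rests at \<open>y'\<close> after time \<open>\<tau>2\<close>.
\<close>

lemma timelike_curve_through:
  assumes y: "norm y = 1" and y': "norm y' = 1" and \<tau>: "arccos (y \<bullet> y') < \<tau>2 - \<tau>1" "\<tau>1 < \<tau>2"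
  obtains c :: "real \<Rightarrow> real \<times> real \<times> (real^3)" where "\<And>s. fst (c s) = e * s"
    "c \<tau>1 = (e * \<tau>1, 0, y)" "c \<tau>2 = (e * \<tau>2, 0, y')"
    "\<And>J. is_interval J \<Longrightarrow> interior J \<noteq> {} \<Longrightarrow> J \<subseteq> times \<Longrightarrow> future_timelike_curve S J c"
proof -
  define \<theta> where "\<theta> = arccos (y \<bullet> y')"
  obtain n where n: "norm n = 1" "y \<bullet> n = 0" "y' = cos \<theta> *\<^sub>R y + sin \<theta> *\<^sub>R n"
    using great_circle[OF y y'] unfolding \<theta>_def by blast
  have in1: "y \<bullet> y = 1" "n \<bullet> n = 1" "n \<bullet> y = 0" using y n by (simp_all add: norm_eq_1 inner_commute)
  have "\<bar>y \<bullet> y'\<bar> \<le> 1" using Cauchy_Schwarz_ineq2[of y y'] y y' by simp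
  then have \<theta>: "0 \<le> \<theta>" unfolding \<theta>_def by (intro arccos_lbound) auto
  define k where "k = \<theta> / (\<tau>2 - \<tau>1)"
  have k: "0 \<le> k" "k < 1" using \<theta> \<tau> by (auto simp: k_def \<theta>_def field_simps)
  define \<sigma> where "\<sigma> s = k * (min \<tau>2 (max \<tau>1 s) - \<tau>1)" for s
  define u where "u r = cos r *\<^sub>R y + sin r *\<^sub>R n" for r
  define c where "c s = (e * s, 0 :: real, u (\<sigma> s))" for s
  have nu: "norm (u r) = 1" for r
    by (simp add: norm_eq_1 u_def inner_add_left inner_add_right in1 n(2) flip: power2_eq_square)
  have cont: "continuous_on T c" for T
    unfolding c_def[abs_def] u_def \<sigma>_def by (intro continuous_intros)
  have "future_timelike_curve S J c" if J: "is_interval J" "interior J \<noteq> {}" "J \<subseteq> times" for J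
    unfolding piecewise_C1_curve_def
  proof (intro conjI J cont exI[of _ "{\<tau>1, \<tau>2}"] allI ballI impI)
    show "c ` J \<subseteq> points S" using J(3) by (auto simp: c_def times_def nu)
    fix p q assume "p \<in> J" "q \<in> J" and pq: "p < q \<and> {\<tau>1, \<tau>2} \<inter> {p<..<q} = {}"
    then have "q \<le> \<tau>1 \<or> \<tau>1 \<le> p \<and> q \<le> \<tau>2 \<or> \<tau>2 \<le> p" using \<tau>(2) by auto
    then have "\<exists>k' m. \<bar>k'\<bar> < 1 \<and> (\<forall>s\<in>{p..q}. \<sigma> s = k' * s + m)"
    proof (elim disjE)
      assume "q \<le> \<tau>1"
      then show ?thesis using \<tau>(2) by (intro exI[of _ 0] exI[of _ 0]) (auto simp: \<sigma>_def)
    next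
      assume "\<tau>1 \<le> p \<and> q \<le> \<tau>2"
      then show ?thesis using k by (intro exI[of _ k] exI[of _ "- k * \<tau>1"]) (auto simp: \<sigma>_def algebra_simps)
    next
      assume "\<tau>2 \<le> p"
      then show ?thesis using \<tau>(2) by (intro exI[of _ 0] exI[of _ "k * (\<tau>2 - \<tau>1)"]) (auto simp: \<sigma>_def)
    qed
    then obtain k' m where k': "\<bar>k'\<bar> < 1" and \<sigma>: "\<And>s. s \<in> {p..q} \<Longrightarrow> \<sigma> s = k' * s + m" by blast
    define v where "v s = (e, 0 :: real, k' *\<^sub>R (cos (k' * s + m) *\<^sub>R n - sin (k' * s + m) *\<^sub>R y))" for s
    have vd: "((\<lambda>s. (e * s, 0 :: real, u (k' * s + m))) has_vector_derivative v s) (at s within {p..q})" for s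
      unfolding u_def v_def
      by (auto intro!: derivative_eq_intros has_vector_derivative_Pair simp: algebra_simps
          has_real_derivative_iff_has_vector_derivative[symmetric])
    have "(c has_vector_derivative v s) (at s within {p..q})" if "s \<in> {p..q}" for s
      by (rule has_vector_derivative_transform[OF that _ vd]) (simp add: \<sigma> c_def)
    moreover have "future_timelike_vec S (c s) (v s)" for s
    proof -
      have unit: "(cos r *\<^sub>R n - sin r *\<^sub>R y) \<bullet> (cos r *\<^sub>R n - sin r *\<^sub>R y) = 1" for r
        by (simp add: inner_diff_left inner_diff_right in1 n(2) flip: power2_eq_square)
      have "snd (snd (v s)) \<bullet> snd (snd (v s)) = k'\<^sup>2"
        using unit by (simp add: v_def power2_eq_square)
      moreover have "k'\<^sup>2 < 1" using k' by (simp add: abs_square_less_1)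
      ultimately show ?thesis using \<Lambda>
        by (simp add: future_timelike_vec_def metric_S time_dir_S) (simp add: v_def divide_less_0_iff)
    qed
    moreover have "continuous_on {p..q} v" unfolding v_def[abs_def] by (intro continuous_intros)
    ultimately show "\<exists>v. continuous_on {p..q} v \<and> (\<forall>s\<in>{p..q}. (c has_vector_derivative v s) (at s within {p..q}) \<and>
        future_timelike_vec S (c s) (v s))" by blast
  qed auto
  moreover have "c \<tau>1 = (e * \<tau>1, 0, y)" using \<tau>(2) by (simp add: c_def u_def \<sigma>_def)
  moreover have "c \<tau>2 = (e * \<tau>2, 0, y')" using \<tau>(2) n(3) by (simp add: c_def u_def \<sigma>_def k_def)
  ultimately show ?thesis using that[of c] by (simp add: c_def)
qed

text \<open>Each comoving line at \<rho> = 0 meets \<open>C\<close>, which defines \<open>h\<close>.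
  If \<open>h y' - h y\<close> exceeded the angle between the points, a timelike curve through both
  would meet \<open>C\<close> twice; hence \<open>h\<close> is 1-Lipschitz for the angle and
  continuous.\<close>

lemma cauchy_surface_sphere_section:
  assumes C: "cauchy_surface S C"
  obtains h where "continuous_on (sphere 0 1) h" "\<And>y. y \<in> sphere 0 1 \<Longrightarrow> h y \<in> times"
    "\<And>y. y \<in> sphere 0 1 \<Longrightarrow> (e * h y, 0, y) \<in> C"
proof -
  have hit: "\<exists>!s. s \<in> times \<and> c s \<in> C"
    if "\<And>s. fst (c s) = e * s" "future_timelike_curve S times c" for c
    using C that inextendible_times[of c] unfolding cauchy_surface_def by blast
  have "\<exists>h. h \<in> times \<and> (e * h, 0, y) \<in> C" if y: "y \<in> sphere 0 1" for y :: "real^3"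
  proof -
    let ?c = "\<lambda>s. (e * s, 0 :: real, y)"
    have "future_timelike_curve S times ?c"
      unfolding piecewise_C1_curve_def
    proof (intro conjI is_interval_times interior_times exI[of _ "{}"] allI ballI impI)
      show "continuous_on times ?c" by (intro continuous_intros)
      show "?c ` times \<subseteq> points S" using y by (auto simp: times_def)
      fix p q
      have "(?c has_vector_derivative (e, 0, 0)) (at s within {p..q})" for s
        by (auto intro!: derivative_eq_intros has_vector_derivative_Pair
            simp: zero_prod_def has_real_derivative_iff_has_vector_derivative[symmetric])
      moreover have "future_timelike_vec S (?c s) (e, 0, 0)" for s
        using \<Lambda> by (simp add: future_timelike_vec_def metric_S time_dir_S)
      ultimately show "\<exists>v. continuous_on {p..q} v \<and> (\<forall>s\<in>{p..q}. (?c has_vector_derivative v s) (at s within {p..q}) \<and>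
        future_timelike_vec S (?c s) (v s))"
        by (intro exI[of _ "\<lambda>_. (e, 0, 0)"]) auto
    qed auto
    from hit[OF _ this] show ?thesis by auto
  qed
  then obtain h where h: "\<And>y. y \<in> sphere 0 1 \<Longrightarrow> h y \<in> times" "\<And>y :: real^3. y \<in> sphere 0 1 \<Longrightarrow> (e * h y, 0, y) \<in> C"
    by metis
  have le: "h y' - h y \<le> arccos (y \<bullet> y')" if y: "y \<in> sphere 0 1" "y' \<in> sphere 0 1" for y y'
  proof (rule ccontr)
    assume "\<not> ?thesis"
    then have lt: "arccos (y \<bullet> y') < h y' - h y" by simp
    have n1: "norm y = 1" "norm y' = 1" using y by auto
    have "\<bar>y \<bullet> y'\<bar> \<le> 1" using Cauchy_Schwarz_ineq2[of y y'] n1 by simp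
    then have "0 \<le> arccos (y \<bullet> y')" by (intro arccos_lbound) auto
    then have lt': "h y < h y'" using lt by simp
    obtain c where c: "\<And>s. fst (c s) = e * s" "c (h y) = (e * h y, 0, y)" "c (h y') = (e * h y', 0, y')"
      "\<And>J. is_interval J \<Longrightarrow> interior J \<noteq> {} \<Longrightarrow> J \<subseteq> times \<Longrightarrow> future_timelike_curve S J c"
      using timelike_curve_through[OF n1 lt lt'] by metis
    have "\<exists>!s. s \<in> times \<and> c s \<in> C"
      by (rule hit[OF c(1) c(4)]) (use is_interval_times interior_times in auto)
    then have "h y = h y'" using h c(2,3) y by metis
    then show False using lt' by simp
  qed
  have "continuous_on (sphere 0 1) h"
    unfolding continuous_on_def
  proof
    fix y :: "real^3" assume y: "y \<in> sphere 0 1"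
    have "y \<bullet> y' \<in> {-1..1}" if "y' \<in> sphere 0 1" for y'
      using Cauchy_Schwarz_ineq2[of y y'] that y by (simp add: abs_le_iff)
    then have "continuous_on (sphere 0 1) (\<lambda>y'. arccos (y \<bullet> y'))"
      by (intro continuous_on_compose2[OF continuous_on_arccos'] continuous_intros) blast
    then have "((\<lambda>y'. arccos (y \<bullet> y')) \<longlongrightarrow> arccos (y \<bullet> y)) (at y within sphere 0 1)"
      using y unfolding continuous_on_def by blast
    moreover have "y \<bullet> y = 1" using y by (simp add: norm_eq_1)
    ultimately have lim: "((\<lambda>y'. arccos (y \<bullet> y')) \<longlongrightarrow> 0) (at y within sphere 0 1)" by simp
    have "\<forall>\<^sub>F y' in at y within sphere 0 1. norm (h y' - h y) \<le> arccos (y \<bullet> y')"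
      using le[OF y] le[OF _ y] by (auto simp: eventually_at_filter inner_commute abs_le_iff)
    from Lim_null_comparison[OF this lim] show "(h \<longlongrightarrow> h y) (at y within sphere 0 1)"
      by (simp add: LIM_zero_iff)
  qed
  with h that show ?thesis by blast
qed

text \<open>The identity of the 2-sphere factors through \<open>B\<close> as \<open>r\<close> after
  \<open>i\<close>, and every map through a contractible space is null-homotopic.\<close>

lemma not_contractible_sphere_factor:
  fixes B :: "'b::real_normed_vector set"
  assumes B: "B homeomorphic ball (0::real^3) 1 \<or> B homeomorphic cball (0::real^3) 1"
    and i: "continuous_on (sphere (0::real^3) 1) i" "i ` sphere 0 1 \<subseteq> B"
    and r: "continuous_on B r" "r ` B \<subseteq> sphere 0 1" "\<And>y. y \<in> sphere 0 1 \<Longrightarrow> r (i y) = y"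
  shows False
proof -
  have "contractible B"
    using B homeomorphic_contractible_eq convex_imp_contractible[OF convex_ball] convex_imp_contractible[OF convex_cball]
    by metis
  then obtain x where x: "homotopic_with_canon (\<lambda>h. True) (sphere (0::real^3) 1) (sphere 0 1) (r \<circ> i) (\<lambda>_. x)"
    using nullhomotopic_through_contractible[OF i(1) _ r(1)] i(2) r(2) by (metis image_subset_iff_funcset)
  have "homotopic_with_canon (\<lambda>h. True) (sphere (0::real^3) 1) (sphere 0 1) id (\<lambda>_. x)"
    by (rule homotopic_with_eq[OF x]) (use r(3) in auto)
  then have "contractible (sphere (0::real^3) 1)" unfolding contractible_def by blast
  then show False by (simp add: contractible_sphere)
qed

lemma not_completely_oblivious_S: "\<not> completely_oblivious_to_topology S"
proof
  assume "completely_oblivious_to_topology S"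
  then obtain C where C: "cauchy_surface S C" and obl: "\<And>J \<gamma>. future_causal_curve S J \<gamma> \<Longrightarrow>
      upper_inextendible (points S) J \<gamma> \<Longrightarrow>
      \<exists>B\<subseteq>C. (B homeomorphic ball (0::real^3) 1 \<or> B homeomorphic cball (0::real^3) 1) \<and>
              C \<inter> causal_past S (\<gamma> ` J) \<subseteq> B"
    unfolding completely_oblivious_to_topology_def by blast
  obtain h where h: "continuous_on (sphere 0 1) h" "\<And>y. y \<in> sphere 0 1 \<Longrightarrow> h y \<in> times"
    "\<And>y. y \<in> sphere 0 1 \<Longrightarrow> (e * h y, 0, y) \<in> C"
    using cauchy_surface_sphere_section[OF C] by metis
  define y0 :: "real^3" where "y0 = axis 1 1"
  have y0: "norm y0 = 1" by (simp add: y0_def)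
  define \<gamma> where "\<gamma> s = (e * s, 0 :: real, y0)" for s
  have \<gamma>: "future_causal_curve S times \<gamma>"
    unfolding piecewise_C1_curve_def
  proof (intro conjI is_interval_times interior_times exI[of _ "{}"] allI ballI impI)
    show "continuous_on times \<gamma>" unfolding \<gamma>_def[abs_def] by (intro continuous_intros)
    show "\<gamma> ` times \<subseteq> points S" using y0 by (auto simp: times_def \<gamma>_def)
    fix p q
    have "(\<gamma> has_vector_derivative (e, 0, 0)) (at s within {p..q})" for s
      unfolding \<gamma>_def[abs_def] by (auto intro!: derivative_eq_intros has_vector_derivative_Pair
          simp: zero_prod_def has_real_derivative_iff_has_vector_derivative[symmetric])
    moreover have "future_causal_vec S (\<gamma> s) (e, 0, 0)" for s
      using \<Lambda> by (simp add: future_causal_vec_def causal_vec_def metric_S time_dir_S zero_prod_def)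
    ultimately show "\<exists>v. continuous_on {p..q} v \<and> (\<forall>s\<in>{p..q}. (\<gamma> has_vector_derivative v s) (at s within {p..q}) \<and>
        future_causal_vec S (\<gamma> s) (v s))"
      by (intro exI[of _ "\<lambda>_. (e, 0, 0)"]) auto
  qed auto
  have "upper_inextendible (points S) times \<gamma>"
    using inextendible_times[of \<gamma>] by (simp add: \<gamma>_def inextendible_def)
  from obl[OF \<gamma> this] obtain B where B: "B \<subseteq> C" "B homeomorphic ball (0::real^3) 1 \<or> B homeomorphic cball (0::real^3) 1"
    and past: "C \<inter> causal_past S (\<gamma> ` times) \<subseteq> B" by blast
  have "(e * h y, 0, y) \<in> B" if y: "y \<in> sphere 0 1" for y
  proof -
    have ny: "norm y = 1" using y by simp
    \<comment> \<open>Waiting longer than the angle leaves time to reach \<open>y0\<close> at a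
      speed below that of light; the extra 1 makes this strict.\<close>
    define s where "s = h y + arccos (y \<bullet> y0) + 1"
    have "\<bar>y \<bullet> y0\<bar> \<le> 1" using Cauchy_Schwarz_ineq2[of y y0] ny y0 by simp
    then have "0 \<le> arccos (y \<bullet> y0)" by (intro arccos_lbound) auto
    then have lt: "arccos (y \<bullet> y0) < s - h y" "h y < s" by (auto simp: s_def)
    have times: "{h y..s} \<subseteq> times" using later_in_times[OF h(2)[OF y]] by auto
    obtain c where c: "c (h y) = (e * h y, 0, y)" "c s = (e * s, 0, y0)"
      "\<And>J. is_interval J \<Longrightarrow> interior J \<noteq> {} \<Longrightarrow> J \<subseteq> times \<Longrightarrow> future_timelike_curve S J c"
      using timelike_curve_through[OF ny y0 lt] by metis
    have "future_causal_curve S {h y..s} c"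
      by (intro future_timelike_curve_imp_causal c(3) times) (use lt in auto)
    moreover have "c s \<in> \<gamma> ` times" using c(2) times lt by (intro image_eqI[of _ _ s]) (auto simp: \<gamma>_def)
    moreover have "(e * h y, 0, y) \<in> points S" using h(2)[OF y] y by (auto simp: times_def)
    ultimately have "(e * h y, 0, y) \<in> causal_past S (\<gamma> ` times)"
      unfolding causal_past_def using c(1) lt(2) by blast
    then show ?thesis using past h(3)[OF y] by blast
  qed
  then have sub: "(\<lambda>y. (e * h y, 0, y)) ` sphere 0 1 \<subseteq> B" by blast
  show False
  proof (rule not_contractible_sphere_factor[OF B(2) _ sub])
    show "continuous_on (sphere 0 1) (\<lambda>y. (e * h y, 0 :: real, y))"
      by (intro continuous_intros h)
    show "continuous_on B (\<lambda>p. snd (snd p))" by (intro continuous_intros)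
    show "(\<lambda>p. snd (snd p)) ` B \<subseteq> sphere 0 1"
      using B(1) C unfolding cauchy_surface_def points_S by force
  qed simp
qed

section \<open>Completeness of future causal geodesics\<close>

lemma complete_S: "future_causal_geodesically_complete S"
  unfolding future_causal_geodesically_complete_def
proof (intro allI impI notI)
  fix J \<gamma>
  assume *: "geodesic S J \<gamma> \<and> (\<forall>s\<in>J. future_causal_vec S (\<gamma> s) (vector_derivative \<gamma> (at s))) \<and>
        upper_inextendible (points S) J \<gamma>" and bdd: "bdd_above J"
  define v where "v s = vector_derivative \<gamma> (at s)" for s
  define t where "t s = fst (\<gamma> s)" for s
  define t' where "t' s = e * fst (v s)" for s
  \<comment> \<open>The derivative of \<Phi> in oriented time. Along the geodesic it never
    decreases, so its sign changes at most once, from negative to positive, and the two estimates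
    need to be joined at most once.\<close>
  define W where "W s = e * nariai_warp b a (t s)" for s
  have geo: "geodesic (nariai_cover \<Lambda> a b) J \<gamma>" using * by (simp add: nariai_dir_def geodesic_time_dir)
  have J: "open J" "is_interval J" "J \<noteq> {}" using geo by (simp_all add: geodesic_def)
  have pts: "\<gamma> s \<in> points S" if "s \<in> J" for s using geo that unfolding geodesic_def points_nariai_cover points_S by blast
  have tI: "t s \<in> I" if "s \<in> J" for s using pts[OF that] by (auto simp: t_def mem_Times_iff)
  have \<gamma>': "(\<gamma> has_vector_derivative v s) (at s)"
    and v': "((\<lambda>s. fst (v s)) has_real_derivative - (w (t s) * nariai_warp b a (t s) * (fst (snd (v s)))\<^sup>2)) (at s)"
    if "s \<in> J" for s
    using geodesic_nariai_time_equation[OF \<Lambda> geo that] by (simp_all add: v_def[abs_def] t_def)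
  have cl: "0 < t' s" "w (t s) * \<bar>fst (snd (v s))\<bar> \<le> t' s" "norm (snd (snd (v s))) \<le> t' s" if "s \<in> J" for s
    using future_causal_vec_S[OF pts[OF that], of "v s"] * that by (simp_all add: v_def t'_def t_def)
  have dt: "(t has_real_derivative fst (v s)) (at s)" if "s \<in> J" for s
    unfolding t_def[abs_def] has_real_derivative_iff_has_vector_derivative has_vector_derivative_def
    by (rule has_derivative_eq_rhs[OF has_derivative_fst[OF \<gamma>'[OF that, unfolded has_vector_derivative_def]]])
       (simp add: fun_eq_iff)
  have dt': "(t' has_real_derivative - (w (t s) * W s * (fst (snd (v s)))\<^sup>2)) (at s)" if "s \<in> J" for s
    unfolding t'_def[abs_def] W_def
    by (rule DERIV_cong[OF DERIV_cmult[OF v'[OF that]]]) (simp add: algebra_simps)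
  have dw: "((\<lambda>s. nariai_warp x z (t s)) has_real_derivative nariai_warp z x (t s) * fst (v s)) (at s)" if "s \<in> J" for s x z
    by (rule DERIV_chain2[OF has_real_derivative_nariai_warp dt[OF that]])
  have dW: "(W has_real_derivative w (t s) * t' s) (at s)" if "s \<in> J" for s
    unfolding W_def[abs_def] t'_def by (rule DERIV_cong[OF DERIV_cmult[OF dw[OF that]]]) (simp add: algebra_simps)
  have sub: "{s1..s2} \<subseteq> J" if "s1 \<in> J" "s2 \<in> J" for s1 s2
    using mem_is_interval_1_I[OF J(2) that] by auto
  have monoW: "W s1 \<le> W s2" if s: "s1 \<in> J" "s2 \<in> J" "s1 \<le> s2" for s1 s2
  proof (rule DERIV_nonneg_imp_nondecreasing[OF s(3)])
    fix u assume "s1 \<le> u" "u \<le> s2"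
    then have "u \<in> J" using sub[OF s(1,2)] by auto
    then show "\<exists>y. (W has_real_derivative y) (at u) \<and> 0 \<le> y"
      using dW cl(1) w_pos[OF tI] by (intro exI[of _ "w (t u) * t' u"]) (simp add: less_imp_le)
  qed
  have mono: "e * t s1 \<le> e * t s2" if s: "s1 \<in> J" "s2 \<in> J" "s1 \<le> s2" for s1 s2
  proof (rule DERIV_nonneg_imp_nondecreasing[OF s(3)])
    fix u assume "s1 \<le> u" "u \<le> s2"
    then have "u \<in> J" using sub[OF s(1,2)] by auto
    then show "\<exists>y. ((\<lambda>s. e * t s) has_real_derivative y) (at u) \<and> 0 \<le> y"
      using DERIV_cmult[OF dt, of u e] cl(1) by (intro exI[of _ "t' u"]) (simp add: t'_def less_imp_le)
  qed
  have A: "t' s2 \<le> t' s1" if s: "s1 \<in> J" "s2 \<in> J" "s1 \<le> s2" "0 \<le> W s1" for s1 s2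
  proof (rule DERIV_nonpos_imp_nonincreasing[OF s(3)])
    fix u assume u: "s1 \<le> u" "u \<le> s2"
    then have uJ: "u \<in> J" using sub[OF s(1,2)] by auto
    have "0 \<le> W u" using monoW[OF s(1) uJ u(1)] s(4) by simp
    then show "\<exists>y. (t' has_real_derivative y) (at u) \<and> y \<le> 0"
      using dt'[OF uJ] w_pos[OF tI[OF uJ]]
      by (intro exI[of _ "- (w (t u) * W u * (fst (snd (v u)))\<^sup>2)"]) simp
  qed
  \<comment> \<open>The derivative of \<Phi> t' is \<open>W\<close> times t'^2 - (\<Phi> \<rho>')^2,
    and the bracket is nonnegative because the velocity is causal.\<close>
  have B: "t' s2 * w (t s2) \<le> t' s1 * w (t s1)" if s: "s1 \<in> J" "s2 \<in> J" "s1 \<le> s2" "W s2 \<le> 0" for s1 s2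
  proof (rule DERIV_nonpos_imp_nonincreasing[OF s(3)])
    fix u assume u: "s1 \<le> u" "u \<le> s2"
    then have uJ: "u \<in> J" using sub[OF s(1,2)] by auto
    have W: "W u \<le> 0" using monoW[OF uJ s(2) u(2)] s(4) by simp
    have "((\<lambda>s. t' s * w (t s)) has_real_derivative W u * ((t' u)\<^sup>2 - (w (t u) * \<bar>fst (snd (v u))\<bar>)\<^sup>2)) (at u)"
      by (rule DERIV_cong[OF DERIV_mult[OF dt'[OF uJ] dw[OF uJ]]])
         (simp add: t'_def W_def power2_eq_square algebra_simps)
    moreover have "(w (t u) * \<bar>fst (snd (v u))\<bar>)\<^sup>2 \<le> (t' u)\<^sup>2"
      using cl(2)[OF uJ] w_pos[OF tI[OF uJ]] by (intro power_mono) auto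
    ultimately show "\<exists>y. ((\<lambda>s. t' s * w (t s)) has_real_derivative y) (at u) \<and> y \<le> 0"
      using W by (intro exI[of _ "W u * ((t' u)\<^sup>2 - (w (t u) * \<bar>fst (snd (v u))\<bar>)\<^sup>2)"])
        (simp add: mult_nonpos_nonneg)
  qed
  obtain s0 where s0: "s0 \<in> J" using J by blast
  obtain \<delta> where \<delta>: "\<delta> > 0" "\<And>u. e * t s0 \<le> e * u \<Longrightarrow> w u \<ge> \<delta>" using w_lower_bound[OF tI[OF s0]] by metis
  \<comment> \<open>Bound for t' while \<open>W\<close> is nonpositive: the product \<Phi> t' is at
    most its initial value and \<Phi> is at least \<delta>.\<close>
  define D where "D = t' s0 * w (t s0) / \<delta>"
  have D0: "t' s0 \<le> D" using \<delta>(1) \<delta>(2)[of "t s0"] cl(1)[OF s0] by (simp add: D_def field_simps)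
  have neg: "t' s \<le> D" if "s \<in> J" "s0 \<le> s" "W s \<le> 0" for s
  proof -
    have "t' s * \<delta> \<le> t' s * w (t s)" using \<delta>(2)[OF mono[OF s0 that(1,2)]] cl(1)[OF that(1)] by (intro mult_left_mono) auto
    also have "\<dots> \<le> t' s0 * w (t s0)" by (rule B[OF s0 that])
    finally show ?thesis using \<delta>(1) by (simp add: D_def field_simps)
  qed
  have bound: "t' s \<le> D" if s: "s \<in> J" "s0 \<le> s" for s
  proof (cases "W s \<le> 0 \<or> 0 \<le> W s0")
    case True
    then show ?thesis using neg[OF s] A[OF s0 s] D0 by linarith
  next
    case False
    have "continuous_on {s0..s} W"
      using sub[OF s0 s(1)] by (intro continuous_at_imp_continuous_on ballI DERIV_isCont[OF dW]) blast
    \<comment> \<open>At the zero of \<open>W\<close> both estimates are valid: the first bounds t'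
      up to \<open>s1\<close>, the second says that it does not grow afterwards.\<close>
    then obtain s1 where s1: "s0 \<le> s1" "s1 \<le> s" "W s1 = 0"
      using IVT'[of W s0 0 s] False s(2) by auto
    then have "s1 \<in> J" using sub[OF s0 s(1)] by auto
    then show ?thesis using A[of s1 s] neg[of s1] s s1 by force
  qed
  \<comment> \<open>The velocity has time and sphere parts at most \<open>D\<close> and \<rho> part
    at most \<open>D / \<delta>\<close>, whence the constant. On bounded \<open>J\<close> the curve
    therefore converges.\<close>
  have lip: "dist (\<gamma> s) (\<gamma> s') \<le> (2 * D + D / \<delta>) * (s' - s)" if s: "s \<in> J" "s' \<in> J" "s0 \<le> s" "s \<le> s'" for s s'
  proof (cases "s = s'")
    case False
    then have lt: "s < s'" using s(4) by simp
    have vJ: "u \<in> J" "s0 \<le> u" if "s \<le> u" "u \<le> s'" for u using sub[OF s(1,2)] that s(3) by auto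
    have "norm (\<gamma> s' - \<gamma> s) \<le> (2 * D + D / \<delta>) * s' - (2 * D + D / \<delta>) * s"
    proof (rule differentiable_bound_general[OF lt])
      show "continuous_on {s..s'} \<gamma>"
        using vJ by (intro continuous_at_imp_continuous_on ballI has_vector_derivative_continuous[OF \<gamma>']) simp
      show "continuous_on {s..s'} (\<lambda>u. (2 * D + D / \<delta>) * u)" by (intro continuous_intros)
      fix u assume "s < u" "u < s'"
      then have u: "u \<in> J" "s0 \<le> u" using vJ[of u] by auto
      show "(\<gamma> has_vector_derivative v u) (at u)" by (rule \<gamma>'[OF u(1)])
      show "((\<lambda>u. (2 * D + D / \<delta>) * u) has_vector_derivative (2 * D + D / \<delta>)) (at u)"
        unfolding has_real_derivative_iff_has_vector_derivative[symmetric]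
        by (auto intro!: derivative_eq_intros)
      have "\<bar>fst (v u)\<bar> = t' u" using cl(1)[OF u(1)] e by (auto simp: t'_def)
      then have 1: "\<bar>fst (v u)\<bar> \<le> D" using bound[OF u] by simp
      have "\<delta> * \<bar>fst (snd (v u))\<bar> \<le> w (t u) * \<bar>fst (snd (v u))\<bar>"
        using \<delta>(2)[OF mono[OF s0 u]] by (intro mult_right_mono) auto
      also have "\<dots> \<le> D" using cl(2)[OF u(1)] bound[OF u] by simp
      finally have 2: "\<bar>fst (snd (v u))\<bar> \<le> D / \<delta>" using \<delta>(1) by (simp add: field_simps)
      have 3: "norm (snd (snd (v u))) \<le> D" using cl(3)[OF u(1)] bound[OF u] by simp
      have "norm (v u) \<le> norm (fst (v u)) + norm (snd (v u))"
        using norm_Pair_le[of "fst (v u)" "snd (v u)"] by simp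
      moreover have "norm (snd (v u)) \<le> norm (fst (snd (v u))) + norm (snd (snd (v u)))"
        using norm_Pair_le[of "fst (snd (v u))" "snd (snd (v u))"] by simp
      ultimately show "norm (v u) \<le> 2 * D + D / \<delta>" using 1 2 3 by simp
    qed
    then show ?thesis by (simp add: dist_norm norm_minus_commute right_diff_distrib)
  qed simp
  obtain U where U: "\<And>s. s \<in> J \<Longrightarrow> s \<le> U" using bdd by (auto simp: bdd_above_def)
  have "0 \<le> D" using D0 cl(1)[OF s0] by simp
  then have K: "0 \<le> 2 * D + D / \<delta>" using \<delta>(1) by simp
  have "\<exists>q. \<forall>U. open U \<and> q \<in> U \<longrightarrow> (\<exists>s0\<in>J. \<forall>s\<in>J. s0 \<le> s \<longrightarrow> \<gamma> s \<in> U)"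
    by (rule curve_converges[OF s0, where g = "\<lambda>s. s" and B = U, OF _ K lip]) (use U in auto)
  then obtain q where q: "\<forall>U. open U \<and> q \<in> U \<longrightarrow> (\<exists>s0\<in>J. \<forall>s\<in>J. s0 \<le> s \<longrightarrow> \<gamma> s \<in> U)" by blast
  have "q \<in> {p. e * t s0 \<le> e * fst p \<and> norm (snd (snd p)) = 1}"
  proof (rule limit_in_closed[OF q _ _ s0])
    show "closed {p :: real \<times> real \<times> (real^3). e * t s0 \<le> e * fst p \<and> norm (snd (snd p)) = 1}"
      by (intro closed_Collect_conj closed_Collect_le closed_Collect_eq continuous_intros)
    show "\<gamma> s \<in> {p. e * t s0 \<le> e * fst p \<and> norm (snd (snd p)) = 1}" if "s \<in> J" "s0 \<le> s" for s
      using mono[OF s0 that] pts[OF that(1)] by (auto simp: t_def)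
  qed
  then have "q \<in> points S" using later_in_I[OF tI[OF s0]] by (auto simp: mem_Times_iff)
  with q * show False unfolding upper_inextendible_def by blast
qed

theorem nariai_asymptotics_S: "nariai_asymptotics S"
  unfolding nariai_asymptotics_def
  using complete_S globally_hyperbolic_S oblivious_S not_completely_oblivious_S by blast

end

subsection \<open>Embedding into the standard solution\<close>

lemma real_analytic_on_divide:
  fixes f g :: "'a::euclidean_space \<Rightarrow> real"
  assumes "real_analytic_on f U" "real_analytic_on g U" "\<And>x. x \<in> U \<Longrightarrow> g x \<noteq> 0"
  shows "real_analytic_on (\<lambda>x. f x / g x) U"
proof -
  have "real_analytic_on (\<lambda>x. inverse (g x)) U"
    by (rule real_analytic_on_compose[OF assms(2) real_analytic_on_inverse]) (use assms(3) in auto)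
  from real_analytic_on_mult[OF assms(1) this] show ?thesis by (simp add: divide_inverse)
qed

lemma real_analytic_on_cmult:
  fixes f :: "'a::euclidean_space \<Rightarrow> real"
  shows "real_analytic_on f U \<Longrightarrow> real_analytic_on (\<lambda>x. c * f x) U"
  by (erule real_analytic_on_linear_compose) (auto simp: linear_iff algebra_simps)

lemma real_analytic_on_unary:
  fixes f :: "'a::euclidean_space \<Rightarrow> real"
  assumes f: "real_analytic_on f U"
  shows real_analytic_on_exp': "real_analytic_on (\<lambda>x. exp (f x)) U"
    and real_analytic_on_sin': "real_analytic_on (\<lambda>x. sin (f x)) U"
    and real_analytic_on_cos': "real_analytic_on (\<lambda>x. cos (f x)) U"
    and real_analytic_on_arctan': "real_analytic_on (\<lambda>x. arctan (f x)) U"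
  by (rule real_analytic_on_compose[OF f real_analytic_on_exp] real_analytic_on_compose[OF f real_analytic_on_sin]
      real_analytic_on_compose[OF f real_analytic_on_cos] real_analytic_on_compose[OF f real_analytic_on_arctan]; simp)+

lemma real_analytic_on_unary_pos:
  fixes f :: "'a::euclidean_space \<Rightarrow> real"
  assumes f: "real_analytic_on f U" and pos: "\<And>x. x \<in> U \<Longrightarrow> f x > 0"
  shows real_analytic_on_ln': "real_analytic_on (\<lambda>x. ln (f x)) U"
    and real_analytic_on_sqrt': "real_analytic_on (\<lambda>x. sqrt (f x)) U"
  by (rule real_analytic_on_compose[OF f real_analytic_on_ln] real_analytic_on_compose[OF f real_analytic_on_sqrt];
      use pos in auto)+

lemma real_analytic_on_hyperbolic:
  fixes f :: "'a::euclidean_space \<Rightarrow> real"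
  assumes f: "real_analytic_on f U"
  shows real_analytic_on_cosh: "real_analytic_on (\<lambda>x. cosh (f x)) U"
    and real_analytic_on_sinh: "real_analytic_on (\<lambda>x. sinh (f x)) U"
    and real_analytic_on_arsinh: "real_analytic_on (\<lambda>x. arsinh (f x)) U"
proof -
  have e: "real_analytic_on (\<lambda>x. exp (f x)) U" "real_analytic_on (\<lambda>x. exp (- f x)) U"
    using f by (auto intro!: real_analytic_on_exp' real_analytic_on_minus)
  show "real_analytic_on (\<lambda>x. cosh (f x)) U"
    using real_analytic_on_cmult[OF real_analytic_on_add[OF e], of "1/2"] by (simp add: cosh_def)
  show "real_analytic_on (\<lambda>x. sinh (f x)) U"
    using real_analytic_on_cmult[OF real_analytic_on_diff[OF e], of "1/2"] by (simp add: sinh_def)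
  have pos: "x\<^sup>2 + 1 > 0" for x :: real by (simp add: add_nonneg_pos)
  have "real_analytic_on (\<lambda>x. ln (f x + sqrt ((f x)\<^sup>2 + 1))) U"
    by (intro real_analytic_on_ln' real_analytic_on_add real_analytic_on_sqrt' real_analytic_on_power f
        real_analytic_on_const real_analytic_on_open[OF f] pos arsinh_real_aux)
  then show "real_analytic_on (\<lambda>x. arsinh (f x)) U" by (simp add: arsinh_real_def)
qed

text \<open>
  With \<open>\<kappa> = k\<^sup>2\<close> these are \<open>S x = sinh (k x) / k\<close>, \<open>D x = (cosh (k x) - 1) / k\<^sup>2\<close> and the inverse \<open>R\<close> of \<open>S\<close>,
  read as \<open>x\<close>, \<open>x\<^sup>2 / 2\<close> and \<open>x\<close> if \<open>\<kappa> = 0\<close>.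
\<close>

lemma hyperbolic_functions:
  fixes \<kappa> :: real
  assumes "\<kappa> \<ge> 0"
  obtains S D R :: "real \<Rightarrow> real" where
    "real_analytic_on S UNIV" "real_analytic_on D UNIV" "real_analytic_on R UNIV"
    "\<And>x. R (S x) = x" "S 0 = 0" "\<And>x. 0 \<le> D x" "\<And>x. (S x)\<^sup>2 = 2 * D x + \<kappa> * (D x)\<^sup>2"
    "\<And>x. (S has_real_derivative 1 + \<kappa> * D x) (at x)" "\<And>x. (D has_real_derivative S x) (at x)"
proof (cases "\<kappa> = 0")
  case True
  have id: "real_analytic_on (\<lambda>x::real. x) UNIV" by (rule real_analytic_on_id[OF open_UNIV])
  have "real_analytic_on (\<lambda>x::real. 1 / 2 * x ^ 2) UNIV"
    by (intro real_analytic_on_cmult real_analytic_on_power id)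
  then show ?thesis
    by (rule that[of "\<lambda>x. x" "\<lambda>x. 1 / 2 * x ^ 2" "\<lambda>x. x", OF id _ id])
       (use True in \<open>auto intro!: derivative_eq_intros\<close>)
next
  case False
  define k where "k = sqrt \<kappa>"
  have k: "k > 0" "k\<^sup>2 = \<kappa>" using assms False by (auto simp: k_def)
  have id: "real_analytic_on (\<lambda>x::real. k * x) UNIV"
    by (intro real_analytic_on_cmult real_analytic_on_id open_UNIV)
  show ?thesis
  proof (rule that[of "\<lambda>x. 1 / k * sinh (k * x)" "\<lambda>x. 1 / k\<^sup>2 * (cosh (k * x) - 1)" "\<lambda>x. 1 / k * arsinh (k * x)"])
    show "real_analytic_on (\<lambda>x. 1 / k * sinh (k * x)) UNIV" "real_analytic_on (\<lambda>x. 1 / k * arsinh (k * x)) UNIV"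
      "real_analytic_on (\<lambda>x. 1 / k\<^sup>2 * (cosh (k * x) - 1)) UNIV"
      by (intro real_analytic_on_cmult real_analytic_on_diff real_analytic_on_const open_UNIV
          real_analytic_on_sinh real_analytic_on_cosh real_analytic_on_arsinh id)+
    show "0 \<le> 1 / k\<^sup>2 * (cosh (k * x) - 1)" for x using cosh_real_ge_1[of "k * x"] by simp
    show "(1 / k * sinh (k * x))\<^sup>2 = 2 * (1 / k\<^sup>2 * (cosh (k * x) - 1)) + \<kappa> * (1 / k\<^sup>2 * (cosh (k * x) - 1))\<^sup>2" for x
    proof -
      have "(1 / k * sinh (k * x))\<^sup>2 = 1 / k\<^sup>2 * ((cosh (k * x))\<^sup>2 - 1)"
        by (simp add: power_mult_distrib power_divide sinh_square_eq)
      also have "\<dots> = 2 * (1 / k\<^sup>2 * (cosh (k * x) - 1)) + k\<^sup>2 * (1 / k\<^sup>2 * (cosh (k * x) - 1))\<^sup>2"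
        using k(1) by (simp add: power2_eq_square field_simps)
      finally show ?thesis by (simp only: k(2))
    qed
    show "((\<lambda>x. 1 / k * sinh (k * x)) has_real_derivative 1 + \<kappa> * (1 / k\<^sup>2 * (cosh (k * x) - 1))) (at x)" for x
      using k by (auto intro!: derivative_eq_intros simp: field_simps)
    show "((\<lambda>x. 1 / k\<^sup>2 * (cosh (k * x) - 1)) has_real_derivative 1 / k * sinh (k * x)) (at x)" for x
      using k by (auto intro!: derivative_eq_intros simp: power2_eq_square)
  qed (use k in \<open>auto simp: arsinh_sinh_real\<close>)
qed

text \<open>The target carries the metric -dT^2 + cosh^2 T dR^2. An explicit analytic inverse is
  included so that both the embedding of the cover and the local isometries of the circle version
  can be built from it.\<close>

definition nariai_2d_isometry ::
  "real \<Rightarrow> real \<Rightarrow> (real \<times> real \<Rightarrow> real \<times> real) \<Rightarrow> (real \<times> real \<Rightarrow> real \<times> real) \<Rightarrow> bool" where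
  "nariai_2d_isometry a b F H \<longleftrightarrow>
     real_analytic_on F (nariai_interval a b \<times> UNIV) \<and>
     real_analytic_on H (F ` (nariai_interval a b \<times> UNIV)) \<and>
     (\<forall>p\<in>nariai_interval a b \<times> UNIV. H (F p) = p) \<and>
     (\<forall>p\<in>nariai_interval a b \<times> UNIV. \<exists>D. (F has_derivative D) (at p) \<and>
        (\<forall>u v. - (fst (D u) * fst (D v)) + (cosh (fst (F p)))\<^sup>2 * (snd (D u) * snd (D v)) =
               - (fst u * fst v) + (nariai_warp a b (fst p))\<^sup>2 * (snd u * snd v)))"

lemma nariai_2d_isometry_elliptic:
  assumes a: "a > 0" and \<sigma>: "a\<^sup>2 - b\<^sup>2 > 0"
  shows "\<exists>F H. nariai_2d_isometry a b F H \<and> F ` (nariai_interval a b \<times> UNIV) = UNIV"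
proof -
  define k where "k = sqrt (a\<^sup>2 - b\<^sup>2)"
  \<comment> \<open>Chosen so that \<open>a = k * cosh c\<close> and \<open>b = k * sinh c\<close>;
    the addition theorem then makes \<Phi> equal to k cosh (t + c).\<close>
  define c where "c = arsinh (b / k)"
  have k: "k > 0" "k\<^sup>2 = a\<^sup>2 - b\<^sup>2" using \<sigma> by (auto simp: k_def)
  have "cosh c = sqrt ((b / k)\<^sup>2 + 1)" by (simp add: c_def cosh_arsinh_real)
  also have "(b / k)\<^sup>2 + 1 = (a / k)\<^sup>2" using k by (simp add: power_divide field_simps)
  finally have cosh: "k * cosh c = a" using k a by simp
  have sinh: "k * sinh c = b" using k by (simp add: c_def)
  have w: "nariai_warp a b t = k * cosh (t + c)" for t
    unfolding nariai_warp_def cosh[symmetric] sinh[symmetric] cosh_add by (simp add: algebra_simps)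
  have I: "nariai_interval a b = UNIV" using k by (intro nariai_interval_UNIV) (simp add: w)
  define F where "F p = (fst p + c, k * snd p)" for p :: "real \<times> real"
  define H where "H p = (fst p - c, 1 / k * snd p)" for p :: "real \<times> real"
  have HF: "H (F p) = p" "F (H p) = p" for p using k by (auto simp: F_def H_def)
  have surj: "F ` UNIV = UNIV" by (metis HF(2) surj_def)
  have id: "real_analytic_on (\<lambda>p::real \<times> real. p) UNIV" by (rule real_analytic_on_id[OF open_UNIV])
  have an: "real_analytic_on F UNIV" "real_analytic_on H UNIV"
    unfolding F_def[abs_def] H_def[abs_def]
    by (intro real_analytic_on_Pair real_analytic_on_add real_analytic_on_diff real_analytic_on_cmult
        real_analytic_on_const real_analytic_on_fst real_analytic_on_snd id open_UNIV)+
  have "(F has_derivative (\<lambda>h. (fst h, k * snd h))) (at p)" for p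
    unfolding F_def[abs_def] by (auto intro!: derivative_eq_intros)
  then have "\<exists>D. (F has_derivative D) (at p) \<and>
        (\<forall>u v. - (fst (D u) * fst (D v)) + (cosh (fst (F p)))\<^sup>2 * (snd (D u) * snd (D v)) =
               - (fst u * fst v) + (nariai_warp a b (fst p))\<^sup>2 * (snd u * snd v))" for p
    by (intro exI[of _ "\<lambda>h. (fst h, k * snd h)"]) (simp add: F_def w power2_eq_square mult_ac)
  then show ?thesis
    unfolding nariai_2d_isometry_def using an HF(1) surj by (intro exI[of _ F] exI[of _ H]) (simp add: I)
qed

text \<open>Minkowski products of the two coordinate tangent vectors of the embedded surface: the
  t-vector is unit timelike (\<open>E11\<close>), orthogonal to the \<rho>-vector
  (\<open>E12\<close>), whose square is w^2 (\<open>E22\<close>).\<close>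

lemma embedded_metric_identity:
  fixes a b c s w w' D S C u1 u2 v1 v2 :: real
  assumes cs: "c\<^sup>2 - s\<^sup>2 = 1" and w: "w = a * c + b * s" and w': "w' = a * s + b * c"
    and S: "S\<^sup>2 = 2 * D + (b\<^sup>2 - a\<^sup>2) * D\<^sup>2" and C: "C = 1 + (b\<^sup>2 - a\<^sup>2) * D"
  shows "- (((c + b * D * w') * u1 + b * w * S * u2) * ((c + b * D * w') * v1 + b * w * S * v2))
    + ((s - a * D * w') * u1 - a * w * S * u2) * ((s - a * D * w') * v1 - a * w * S * v2)
    + (w' * S * u1 + w * C * u2) * (w' * S * v1 + w * C * v2) = - (u1 * v1) + w\<^sup>2 * (u2 * v2)"
proof -
  have "- (c + b * D * w')\<^sup>2 + (s - a * D * w')\<^sup>2 + (w' * S)\<^sup>2 =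
      - (c\<^sup>2 - s\<^sup>2) - 2 * D * w' * (a * s + b * c) + w'\<^sup>2 * (S\<^sup>2 - (b\<^sup>2 - a\<^sup>2) * D\<^sup>2)"
    by algebra
  also have "\<dots> = - 1" unfolding cs w'[symmetric] S by algebra
  finally have E11: "- (c + b * D * w')\<^sup>2 + (s - a * D * w')\<^sup>2 + (w' * S)\<^sup>2 = - 1" .
  have "- (c + b * D * w') * (b * w * S) - (s - a * D * w') * (a * w * S) + w' * S * (w * C) =
      w * S * (w' * C - (a * s + b * c) - (b\<^sup>2 - a\<^sup>2) * D * w')" by algebra
  also have "\<dots> = 0" unfolding w'[symmetric] C by algebra
  finally have E12: "- (c + b * D * w') * (b * w * S) - (s - a * D * w') * (a * w * S) + w' * S * (w * C) = 0" .
  have "- (b * w * S)\<^sup>2 + (a * w * S)\<^sup>2 + (w * C)\<^sup>2 = w\<^sup>2 * (C\<^sup>2 - (b\<^sup>2 - a\<^sup>2) * S\<^sup>2)" by algebra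
  also have "\<dots> = w\<^sup>2" unfolding C S by algebra
  finally have E22: "- (b * w * S)\<^sup>2 + (a * w * S)\<^sup>2 + (w * C)\<^sup>2 = w\<^sup>2" .
  have "- (((c + b * D * w') * u1 + b * w * S * u2) * ((c + b * D * w') * v1 + b * w * S * v2))
    + ((s - a * D * w') * u1 - a * w * S * u2) * ((s - a * D * w') * v1 - a * w * S * v2)
    + (w' * S * u1 + w * C * u2) * (w' * S * v1 + w * C * v2) =
    (- (c + b * D * w')\<^sup>2 + (s - a * D * w')\<^sup>2 + (w' * S)\<^sup>2) * (u1 * v1)
    + (- (c + b * D * w') * (b * w * S) - (s - a * D * w') * (a * w * S) + w' * S * (w * C)) * (u1 * v2 + u2 * v1)
    + (- (b * w * S)\<^sup>2 + (a * w * S)\<^sup>2 + (w * C)\<^sup>2) * (u2 * v2)"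
    by algebra
  then show ?thesis unfolding E11 E12 E22 by simp
qed

text \<open>The half-angle formula gives one analytic branch of the polar angle on the whole plane
  minus the closed negative axis.\<close>

lemma cos_sin_double_arctan:
  fixes x y r :: real
  assumes r: "r\<^sup>2 = x\<^sup>2 + y\<^sup>2" and pos: "r > 0" "r + x > 0"
  shows "r * cos (2 * arctan (y / (r + x))) = x" "r * sin (2 * arctan (y / (r + x))) = y"
proof -
  define q where "q = y / (r + x)"
  have y: "y = q * (r + x)" using pos by (simp add: q_def)
  have "(r - x) * (r + x) = q\<^sup>2 * (r + x) * (r + x)" using r unfolding y by algebra
  then have x: "r - x = q\<^sup>2 * (r + x)" using pos by simp
  have q: "1 + q\<^sup>2 > 0" by (simp add: add_pos_nonneg)
  have sq: "(sqrt (1 + q\<^sup>2))\<^sup>2 = 1 + q\<^sup>2" using q by simp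
  have "cos (2 * arctan q) = (1 - q\<^sup>2) / (1 + q\<^sup>2)"
    unfolding cos_double cos_arctan sin_arctan power_divide sq by (simp add: diff_divide_distrib)
  moreover have "sin (2 * arctan q) = 2 * q / (1 + q\<^sup>2)"
    unfolding sin_double cos_arctan sin_arctan using sq by (simp add: power2_eq_square)
  moreover have "r * (1 - q\<^sup>2) = x * (1 + q\<^sup>2)" using x by (simp add: algebra_simps)
  moreover have "r * (2 * q) = y * (1 + q\<^sup>2)" using x unfolding y by algebra
  ultimately show "r * cos (2 * arctan (y / (r + x))) = x" "r * sin (2 * arctan (y / (r + x))) = y"
    using q unfolding q_def[symmetric] by (simp_all add: nonzero_divide_eq_eq less_imp_neq[symmetric])
qed

text \<open>
  The two-dimensional factor is mapped into the de Sitter hyperboloid \<open>-X0\<^sup>2 + X1\<^sup>2 + X2\<^sup>2 = 1\<close>, where it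
  avoids the half plane \<open>X2 = 0, X1 \<le> 0\<close>, so that the angle \<open>R\<close> of the global coordinates is defined.
\<close>

lemma nariai_2d_isometry_hyperbolic:
  assumes a: "a > 0" and \<sigma>: "a\<^sup>2 - b\<^sup>2 \<le> 0"
  shows "\<exists>F H. nariai_2d_isometry a b F H"
proof -
  define \<kappa> where "\<kappa> = b\<^sup>2 - a\<^sup>2"
  have \<kappa>: "\<kappa> \<ge> 0" using \<sigma> by (simp add: \<kappa>_def)
  obtain S D Q :: "real \<Rightarrow> real" where
    an: "real_analytic_on S UNIV" "real_analytic_on D UNIV" "real_analytic_on Q UNIV"
    and QS: "\<And>x. Q (S x) = x" and S0: "S 0 = 0" and D0: "\<And>x. 0 \<le> D x" and SD: "\<And>x. (S x)\<^sup>2 = 2 * D x + \<kappa> * (D x)\<^sup>2"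
    and dS: "\<And>x. (S has_real_derivative 1 + \<kappa> * D x) (at x)" and dD: "\<And>x. (D has_real_derivative S x) (at x)"
    using hyperbolic_functions[OF \<kappa>] by metis
  let ?w = "nariai_warp a b" and ?w' = "nariai_warp b a"
  define U where "U = nariai_interval a b \<times> (UNIV :: real set)"
  have oU: "open U" unfolding U_def by (intro open_Times open_nariai_interval open_UNIV)
  have w: "?w (fst p) > 0" if "p \<in> U" for p using that by (auto simp: U_def intro: nariai_warp_pos)
  \<comment> \<open>The point is cosh t P + sinh t N with P = (a b D, 1 - a^2 D, a S) and N = (1 +
    b^2 D, - a b D, b S). With the unit vector E = (b S, - a S, 1 + \<kappa> D) the frame satisfies
    P' = a E, N' = b E, E' = b N - a P. Hence the \<rho>-derivative of the point is \<Phi>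
    E.\<close>
  define X0 where "X0 p = sinh (fst p) + b * D (snd p) * ?w (fst p)" for p
  define X1 where "X1 p = cosh (fst p) - a * D (snd p) * ?w (fst p)" for p
  define X2 where "X2 p = ?w (fst p) * S (snd p)" for p
  define r where "r p = sqrt (1 + (X0 p)\<^sup>2)" for p
  have r: "r p > 0" "(r p)\<^sup>2 = 1 + (X0 p)\<^sup>2" for p by (auto simp: r_def add_pos_nonneg)
  have hyp: "(r p)\<^sup>2 = (X1 p)\<^sup>2 + (X2 p)\<^sup>2" for p
  proof -
    define t where "t = fst p"
    define x where "x = snd p"
    have "(X1 p)\<^sup>2 + (X2 p)\<^sup>2 - (X0 p)\<^sup>2 = ((cosh t)\<^sup>2 - (sinh t)\<^sup>2) - 2 * D x * ?w t * (a * cosh t + b * sinh t)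
        + (?w t)\<^sup>2 * ((S x)\<^sup>2 - \<kappa> * (D x)\<^sup>2)"
      unfolding X0_def X1_def X2_def t_def[symmetric] x_def[symmetric] \<kappa>_def by algebra
    also have "\<dots> = 1"
      unfolding SD nariai_warp_def[symmetric] by (simp add: cosh_square_eq power2_eq_square[of "?w t"])
    finally show ?thesis using r(2)[of p] by simp
  qed
  \<comment> \<open>The excluded half plane is avoided: \<open>X2 = 0\<close> forces \<rho> = 0,
    where \<open>X1\<close> is cosh t; otherwise \<open>X1\<close> is smaller than \<open>r\<close>
    in absolute value.\<close>
  have rX: "r p + X1 p > 0" if p: "p \<in> U" for p
  proof (cases "X2 p = 0")
    case True
    then have "S (snd p) = S 0" using w[OF p] S0 by (simp add: X2_def)
    then have "snd p = 0" using QS by metis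
    moreover have "D 0 = 0"
    proof -
      have "D 0 * (2 + \<kappa> * D 0) = 0" using SD[of 0] S0 by (simp add: power2_eq_square algebra_simps)
      moreover have "2 + \<kappa> * D 0 > 0" using \<kappa> D0[of 0] by (simp add: add_pos_nonneg)
      ultimately show ?thesis by auto
    qed
    ultimately have "X1 p > 0" by (simp add: X1_def)
    then show ?thesis using r(1)[of p] by simp
  next
    case False
    then have "(X1 p)\<^sup>2 < (r p)\<^sup>2" using hyp[of p] by simp
    then have "\<bar>X1 p\<bar> < r p" using r(1)[of p] by (metis abs_le_square_iff abs_of_pos not_le)
    then show ?thesis by linarith
  qed
  define F where "F p = (arsinh (X0 p), 2 * arctan (X2 p / (r p + X1 p)))" for p
  have sinhF: "sinh (fst (F p)) = X0 p" for p by (simp add: F_def)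
  have coshF: "cosh (fst (F p)) = r p" for p by (simp add: F_def r_def cosh_arsinh_real add.commute)
  have cosF: "cosh (fst (F p)) * cos (snd (F p)) = X1 p" "cosh (fst (F p)) * sin (snd (F p)) = X2 p" if "p \<in> U" for p
    using cos_sin_double_arctan[OF hyp r(1) rX[OF that]] unfolding coshF by (simp_all add: F_def)
  have id: "real_analytic_on (\<lambda>p::real \<times> real. p) U" by (rule real_analytic_on_id[OF oU])
  note fs = real_analytic_on_fst[OF id] real_analytic_on_snd[OF id]
  have anD: "real_analytic_on (\<lambda>p. D (snd p)) U" "real_analytic_on (\<lambda>p. S (snd p)) U"
    by (rule real_analytic_on_compose[OF fs(2) an(2)] real_analytic_on_compose[OF fs(2) an(1)]; simp)+
  have anw: "real_analytic_on (\<lambda>p. ?w (fst p)) U"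
    unfolding nariai_warp_def by (intro real_analytic_on_add real_analytic_on_cmult real_analytic_on_cosh real_analytic_on_sinh fs)
  have anX: "real_analytic_on X0 U" "real_analytic_on X1 U" "real_analytic_on X2 U"
    unfolding X0_def[abs_def] X1_def[abs_def] X2_def[abs_def]
    by (intro real_analytic_on_add real_analytic_on_diff real_analytic_on_mult real_analytic_on_cmult
        real_analytic_on_cosh real_analytic_on_sinh fs anD anw)+
  have anr: "real_analytic_on r U"
    unfolding r_def[abs_def]
    by (intro real_analytic_on_sqrt' real_analytic_on_add real_analytic_on_power real_analytic_on_const oU anX)
       (simp add: add_pos_nonneg)
  have anF: "real_analytic_on F U"
    unfolding F_def[abs_def]
    by (intro real_analytic_on_Pair real_analytic_on_arsinh real_analytic_on_cmult real_analytic_on_arctan'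
        real_analytic_on_divide real_analytic_on_add anX anr) (use rX in force)
  \<comment> \<open>The sign selects the exponential whose coefficient in \<Phi> + \<epsilon>
    \<Phi>' is a + |b| > 0; with a fixed sign it could vanish in the degenerate case.\<close>
  define \<epsilon> where "\<epsilon> = (if b \<ge> 0 then 1 else - 1 :: real)"
  have \<epsilon>: "\<epsilon> * \<epsilon> = 1" "\<epsilon> * b = \<bar>b\<bar>" "\<epsilon> = 1 \<or> \<epsilon> = -1" by (auto simp: \<epsilon>_def)
  \<comment> \<open>The linear form a X0 + b X1, invariant under the group since it annihilates E.
    On the image it is \<Phi>', so \<open>V\<close> is \<Phi> by the constancy of \<Phi>^2 -
    \<Phi>'^2.\<close>
  define u where "u q = a * sinh (fst q) + b * (cosh (fst q) * cos (snd q))" for q :: "real \<times> real"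
  define V where "V q = sqrt ((u q)\<^sup>2 - \<kappa>)" for q
  \<comment> \<open>Time comes from \<Phi> + \<epsilon> \<Phi>' = (a + |b|) exp (\<epsilon> t), and
    \<rho> from X2 / \<Phi> = S \<rho>.\<close>
  define H where "H q = (\<epsilon> * ln (1 / (a + \<bar>b\<bar>) * (V q + \<epsilon> * u q)), Q (cosh (fst q) * sin (snd q) / V q))" for q
  have uF: "u (F p) = ?w' (fst p)" if "p \<in> U" for p
    unfolding u_def sinhF cosF[OF that] X0_def X1_def nariai_warp_def by (simp add: algebra_simps)
  have radF: "(u (F p))\<^sup>2 - \<kappa> = (?w (fst p))\<^sup>2" if "p \<in> U" for p
    unfolding uF[OF that] \<kappa>_def using nariai_warp_square_diff[of a b "fst p"] by simp
  have VF: "V (F p) = ?w (fst p)" if "p \<in> U" for p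
    unfolding V_def radF[OF that] using w[OF that] by simp
  have expF: "1 / (a + \<bar>b\<bar>) * (V (F p) + \<epsilon> * u (F p)) = exp (\<epsilon> * fst p)" if "p \<in> U" for p
  proof -
    have "V (F p) + \<epsilon> * u (F p) = (a + \<bar>b\<bar>) * exp (\<epsilon> * fst p)"
      unfolding VF[OF that] uF[OF that] \<epsilon>(2)[symmetric] using \<epsilon>(3)
      by (auto simp: nariai_warp_exp field_simps)
    then show ?thesis using a by (simp add: add_pos_nonneg)
  qed
  have HF: "H (F p) = p" if "p \<in> U" for p
    unfolding H_def expF[OF that]
    unfolding VF[OF that] cosF[OF that] X2_def using w[OF that] QS \<epsilon>(1)
    by (simp add: prod_eq_iff mult.assoc[symmetric])
  have oF: "open (F ` U)"
    by (rule invariance_of_domain[OF real_analytic_on_imp_continuous_on[OF anF] oU]) (metis HF inj_onI)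
  have id': "real_analytic_on (\<lambda>p::real \<times> real. p) (F ` U)" by (rule real_analytic_on_id[OF oF])
  note fs' = real_analytic_on_fst[OF id'] real_analytic_on_snd[OF id']
  have anu: "real_analytic_on u (F ` U)"
    unfolding u_def[abs_def]
    by (intro real_analytic_on_add real_analytic_on_cmult real_analytic_on_mult real_analytic_on_cosh
        real_analytic_on_sinh real_analytic_on_cos' fs')
  have anV: "real_analytic_on V (F ` U)"
    unfolding V_def[abs_def]
  proof (intro real_analytic_on_sqrt' real_analytic_on_diff real_analytic_on_power real_analytic_on_const oF anu)
    fix q assume "q \<in> F ` U"
    then show "0 < (u q)\<^sup>2 - \<kappa>" using radF w by force
  qed
  have "real_analytic_on (\<lambda>q. cosh (fst q) * sin (snd q) / V q) (F ` U)"
    by (intro real_analytic_on_divide real_analytic_on_mult real_analytic_on_cosh real_analytic_on_sin' fs' anV)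
       (use VF w in force)
  then have anQ: "real_analytic_on (\<lambda>q. Q (cosh (fst q) * sin (snd q) / V q)) (F ` U)"
    by (rule real_analytic_on_compose[OF _ an(3)]) simp
  have anH: "real_analytic_on H (F ` U)"
    unfolding H_def[abs_def]
  proof (intro real_analytic_on_Pair anQ real_analytic_on_cmult real_analytic_on_ln' real_analytic_on_add anV anu)
    fix q assume "q \<in> F ` U"
    then obtain p where "p \<in> U" "q = F p" by blast
    then show "0 < 1 / (a + \<bar>b\<bar>) * (V q + \<epsilon> * u q)" using expF by simp
  qed
  have "\<exists>E. (F has_derivative E) (at p) \<and>
        (\<forall>u v. - (fst (E u) * fst (E v)) + (cosh (fst (F p)))\<^sup>2 * (snd (E u) * snd (E v)) =
               - (fst u * fst v) + (?w (fst p))\<^sup>2 * (snd u * snd v))" if p: "p \<in> U" for p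
  proof -
    obtain E where E: "(F has_derivative E) (at p)"
      using real_analytic_on_C2[OF anF] p by metis
    let ?T = "fst (F p)" and ?R = "snd (F p)"
    have fst': "((\<lambda>p. f (fst p)) has_derivative (\<lambda>h. f' * fst h)) (at p)"
      if "(f has_real_derivative f') (at (fst p))" for f f'
      using has_derivative_compose[OF has_derivative_fst[OF has_derivative_ident] that[unfolded has_field_derivative_def]] .
    have snd': "((\<lambda>p. f (snd p)) has_derivative (\<lambda>h. f' * snd h)) (at p)"
      if "(f has_real_derivative f') (at (snd p))" for f f'
      using has_derivative_compose[OF has_derivative_snd[OF has_derivative_ident] that[unfolded has_field_derivative_def]] .
    have hyp_d: "(sinh has_real_derivative cosh t) (at t)" "(cosh has_real_derivative sinh t) (at t)" for t :: real
      by (auto intro!: derivative_eq_intros)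
    note d = fst'[OF has_real_derivative_nariai_warp[of a b]] snd'[OF dD] snd'[OF dS]
      fst'[OF hyp_d(1)] fst'[OF hyp_d(2)]
    let ?c = "cosh (fst p)" and ?s = "sinh (fst p)" and ?Dp = "D (snd p)" and ?Sp = "S (snd p)"
    have dX0: "(X0 has_derivative (\<lambda>h. (?c + b * ?Dp * ?w' (fst p)) * fst h + b * ?w (fst p) * ?Sp * snd h)) (at p)"
      unfolding X0_def[abs_def]
      by (rule has_derivative_eq_rhs[OF has_derivative_add[OF d(4) has_derivative_mult[OF has_derivative_mult_right[OF d(2)] d(1)]]])
         (simp add: fun_eq_iff algebra_simps)
    have dX1: "(X1 has_derivative (\<lambda>h. (?s - a * ?Dp * ?w' (fst p)) * fst h - a * ?w (fst p) * ?Sp * snd h)) (at p)"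
      unfolding X1_def[abs_def]
      by (rule has_derivative_eq_rhs[OF has_derivative_diff[OF d(5) has_derivative_mult[OF has_derivative_mult_right[OF d(2)] d(1)]]])
         (simp add: fun_eq_iff algebra_simps)
    have dX2: "(X2 has_derivative (\<lambda>h. ?w' (fst p) * ?Sp * fst h + ?w (fst p) * (1 + \<kappa> * ?Dp) * snd h)) (at p)"
      unfolding X2_def[abs_def]
      by (rule has_derivative_eq_rhs[OF has_derivative_mult[OF d(1) d(3)]]) (simp add: fun_eq_iff algebra_simps)
    have comp: "((\<lambda>p. f (g (F p))) has_derivative (\<lambda>h. f' * g (E h))) (at p)"
      if "(f has_real_derivative f') (at (g (F p)))" "bounded_linear g" for f f' and g :: "real \<times> real \<Rightarrow> real"
      using has_derivative_compose[OF bounded_linear.has_derivative[OF that(2) E] that(1)[unfolded has_field_derivative_def]] .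
    note k = comp[OF hyp_d(1) bounded_linear_fst]
      comp[OF hyp_d(2) bounded_linear_fst]
      comp[OF DERIV_cos bounded_linear_snd] comp[OF DERIV_sin bounded_linear_snd]
    \<comment> \<open>The hyperboloid coordinates are differentiated a second time, through the
      global coordinates of \<open>F p\<close>. Comparison determines the derivative
      \<open>E\<close> implicitly, without differentiating \<open>arsinh\<close> or
      \<open>arctan\<close>.\<close>
    have "(X0 has_derivative (\<lambda>h. cosh ?T * fst (E h))) (at p)"
      using k(1) unfolding sinhF by simp
    from has_derivative_unique[OF dX0 this]
    have e0: "cosh ?T * fst (E h) = (?c + b * ?Dp * ?w' (fst p)) * fst h + b * ?w (fst p) * ?Sp * snd h" for h
      by (simp add: fun_eq_iff)
    have "(X1 has_derivative (\<lambda>h. cosh ?T * (- sin ?R * snd (E h)) + sinh ?T * fst (E h) * cos ?R)) (at p)"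
      by (rule has_derivative_transform_within_open[OF has_derivative_mult[OF k(2) k(3)] oU p]) (rule cosF)
    from has_derivative_unique[OF dX1 this]
    have e1: "cosh ?T * (- sin ?R * snd (E h)) + sinh ?T * fst (E h) * cos ?R =
        (?s - a * ?Dp * ?w' (fst p)) * fst h - a * ?w (fst p) * ?Sp * snd h" for h
      by (simp add: fun_eq_iff)
    have "(X2 has_derivative (\<lambda>h. cosh ?T * (cos ?R * snd (E h)) + sinh ?T * fst (E h) * sin ?R)) (at p)"
      by (rule has_derivative_transform_within_open[OF has_derivative_mult[OF k(2) k(4)] oU p]) (rule cosF)
    from has_derivative_unique[OF dX2 this]
    have e2: "cosh ?T * (cos ?R * snd (E h)) + sinh ?T * fst (E h) * sin ?R =
        ?w' (fst p) * ?Sp * fst h + ?w (fst p) * (1 + \<kappa> * ?Dp) * snd h" for h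
      by (simp add: fun_eq_iff)
    have "- (fst (E u) * fst (E v)) + (cosh (fst (F p)))\<^sup>2 * (snd (E u) * snd (E v)) =
               - (fst u * fst v) + (?w (fst p))\<^sup>2 * (snd u * snd v)" for u v
    proof -
      \<comment> \<open>In global coordinates the metric is the pullback of the Minkowski form under
        (sinh T, cosh T cos R, cosh T sin R).\<close>
      have "- (fst (E u) * fst (E v)) + (cosh ?T)\<^sup>2 * (snd (E u) * snd (E v)) =
        - ((cosh ?T * fst (E u)) * (cosh ?T * fst (E v)))
        + (cosh ?T * (- sin ?R * snd (E u)) + sinh ?T * fst (E u) * cos ?R) * (cosh ?T * (- sin ?R * snd (E v)) + sinh ?T * fst (E v) * cos ?R)
        + (cosh ?T * (cos ?R * snd (E u)) + sinh ?T * fst (E u) * sin ?R) * (cosh ?T * (cos ?R * snd (E v)) + sinh ?T * fst (E v) * sin ?R)"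
        using cosh_square_eq[of ?T] sin_cos_squared_add[of ?R] by algebra
      also have "\<dots> = - (fst u * fst v) + (?w (fst p))\<^sup>2 * (snd u * snd v)"
        unfolding e0 e1 e2
        by (rule embedded_metric_identity)
           (use SD[of "snd p"] in \<open>auto simp: cosh_square_eq nariai_warp_def \<kappa>_def\<close>)
      finally show ?thesis .
    qed
    with E show ?thesis by blast
  qed
  then show ?thesis
    unfolding nariai_2d_isometry_def U_def[symmetric] using anF anH HF by blast
qed

section \<open>Lifting the two-dimensional isometry to the universal covers\<close>

lemma nariai_interval_standard: "nariai_interval 1 0 = UNIV"
  by (rule nariai_interval_UNIV) (simp add: nariai_warp_def)

lemma nariai_2d_isometry_ex: "a > 0 \<Longrightarrow> \<exists>F H. nariai_2d_isometry a b F H"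
  using nariai_2d_isometry_elliptic nariai_2d_isometry_hyperbolic by (cases "a\<^sup>2 - b\<^sup>2 > 0") (force, simp)

lemma nariai_2d_isometry_open_image:
  assumes F: "nariai_2d_isometry a b F H" and W: "open W" "W \<subseteq> nariai_interval a b \<times> UNIV"
  shows "open (F ` W)"
proof (rule invariance_of_domain[OF _ W(1)])
  have "continuous_on (nariai_interval a b \<times> UNIV) F"
    using F by (intro real_analytic_on_imp_continuous_on) (simp add: nariai_2d_isometry_def)
  then show "continuous_on W F" using W(2) by (rule continuous_on_subset)
  show "inj_on F W" using F W(2) unfolding nariai_2d_isometry_def by (metis inj_onI subsetD)
qed

context
  fixes a b :: real and F H :: "real \<times> real \<Rightarrow> real \<times> real"
  assumes F: "nariai_2d_isometry a b F H"
begin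

definition lift2d :: "(real \<times> real \<Rightarrow> real \<times> real) \<Rightarrow> real \<times> real \<times> (real^3) \<Rightarrow> real \<times> real \<times> (real^3)" where
  "lift2d G p = (fst (G (fst p, fst (snd p))), snd (G (fst p, fst (snd p))), snd (snd p))"

lemma real_analytic_on_lift2d:
  assumes G: "real_analytic_on G W"
  shows "real_analytic_on (lift2d G) {p. (fst p, fst (snd p)) \<in> W}"
proof -
  let ?U = "{p :: real \<times> real \<times> (real^3). (fst p, fst (snd p)) \<in> W}"
  have "open ((\<lambda>p. (fst p, fst (snd p))) -` W)"
    by (intro open_vimage real_analytic_on_open[OF G] continuous_intros)
  then have id: "real_analytic_on (\<lambda>p. p) ?U" by (intro real_analytic_on_id) (simp add: vimage_def)
  note fs = real_analytic_on_fst[OF id] real_analytic_on_fst[OF real_analytic_on_snd[OF id]]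
    real_analytic_on_snd[OF real_analytic_on_snd[OF id]]
  have "real_analytic_on (\<lambda>p. G (fst p, fst (snd p))) ?U"
    by (rule real_analytic_on_compose[OF real_analytic_on_Pair[OF fs(1,2)] G]) auto
  then show ?thesis
    unfolding lift2d_def[abs_def]
    by (intro real_analytic_on_Pair real_analytic_on_fst real_analytic_on_snd fs)
qed

lemma lift2d_inverse:
  assumes "p \<in> points (nariai_cover \<Lambda> a b)" shows "lift2d H (lift2d F p) = p"
proof -
  have "H (F (fst p, fst (snd p))) = (fst p, fst (snd p))"
    using F assms unfolding nariai_2d_isometry_def points_nariai_cover by auto
  then show ?thesis by (simp add: lift2d_def)
qed

lemma analytic_map_lift2d: "analytic_map (points (nariai_cover \<Lambda> a b)) (points (nariai_cover \<Lambda> 1 0)) (lift2d F)"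
  unfolding analytic_map_def
proof (intro conjI ballI)
  show "lift2d F ` points (nariai_cover \<Lambda> a b) \<subseteq> points (nariai_cover \<Lambda> 1 0)"
    by (auto simp: points_nariai_cover nariai_interval_standard lift2d_def)
  have an: "real_analytic_on F (nariai_interval a b \<times> UNIV)" using F by (simp add: nariai_2d_isometry_def)
  fix p assume "p \<in> points (nariai_cover \<Lambda> a b)"
  then show "\<exists>U G. p \<in> U \<and> real_analytic_on G U \<and> (\<forall>q\<in>U \<inter> points (nariai_cover \<Lambda> a b). G q = lift2d F q)"
    using real_analytic_on_lift2d[OF an]
    by (intro exI[of _ "{p. (fst p, fst (snd p)) \<in> nariai_interval a b \<times> UNIV}"] exI[of _ "lift2d F"])
       (auto simp: points_nariai_cover)
qed

lemma preserves_metric_lift2d: "preserves_metric (nariai_cover \<Lambda> a b) (nariai_cover \<Lambda> 1 0) (lift2d F)"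
  unfolding preserves_metric_def
proof
  fix p assume p: "p \<in> points (nariai_cover \<Lambda> a b)"
  let ?q = "(fst p, fst (snd p))"
  have "?q \<in> nariai_interval a b \<times> UNIV" using p by (auto simp: points_nariai_cover)
  then obtain D where D: "(F has_derivative D) (at ?q)"
    and iso: "\<And>u v. - (fst (D u) * fst (D v)) + (cosh (fst (F ?q)))\<^sup>2 * (snd (D u) * snd (D v)) =
               - (fst u * fst v) + (nariai_warp a b (fst ?q))\<^sup>2 * (snd u * snd v)"
    using F unfolding nariai_2d_isometry_def by blast
  have "((\<lambda>p. (fst p, fst (snd p))) has_derivative (\<lambda>h. (fst h, fst (snd h)))) (at p)"
    by (auto intro!: derivative_eq_intros)
  from has_derivative_compose[OF this, of F D] D
  have FD: "((\<lambda>p. F (fst p, fst (snd p))) has_derivative (\<lambda>h. D (fst h, fst (snd h)))) (at p)" by simp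
  have "(lift2d F has_derivative (\<lambda>h. (fst (D (fst h, fst (snd h))), snd (D (fst h, fst (snd h))), snd (snd h)))) (at p)"
    unfolding lift2d_def[abs_def]
    by (intro has_derivative_Pair has_derivative_fst has_derivative_snd FD has_derivative_ident)
  then have der: "(lift2d F has_derivative (\<lambda>h. (fst (D (fst h, fst (snd h))), snd (D (fst h, fst (snd h))), snd (snd h))))
      (at p within points (nariai_cover \<Lambda> a b))"
    by (rule has_derivative_at_withinI)
  have "metric (nariai_cover \<Lambda> 1 0) (lift2d F p)
      (fst (D (fst v, fst (snd v))), snd (D (fst v, fst (snd v))), snd (snd v))
      (fst (D (fst u, fst (snd u))), snd (D (fst u, fst (snd u))), snd (snd u)) = metric (nariai_cover \<Lambda> a b) p v u" for u v
    using iso[of "(fst v, fst (snd v))" "(fst u, fst (snd u))"]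
    by (simp add: metric_nariai_cover lift2d_def nariai_warp_def[of 1 0])
  with der show "\<exists>D. (lift2d F has_derivative D) (at p within points (nariai_cover \<Lambda> a b)) \<and>
      (\<forall>v\<in>tangent_space (points (nariai_cover \<Lambda> a b)) p. \<forall>w\<in>tangent_space (points (nariai_cover \<Lambda> a b)) p.
         metric (nariai_cover \<Lambda> 1 0) (lift2d F p) (D v) (D w) = metric (nariai_cover \<Lambda> a b) p v w)"
    by blast
qed

lemma analytic_isometric_embedding_lift2d:
  "analytic_isometric_embedding (nariai_cover \<Lambda> a b) (nariai_cover \<Lambda> 1 0) (lift2d F)"
  unfolding analytic_isometric_embedding_def
proof (intro conjI analytic_map_lift2d preserves_metric_lift2d exI)
  let ?M = "points (nariai_cover \<Lambda> a b)" and ?U = "nariai_interval a b \<times> (UNIV :: real set)"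
  have "real_analytic_on F ?U" "real_analytic_on H (F ` ?U)" using F by (simp_all add: nariai_2d_isometry_def)
  note c = this[THEN real_analytic_on_lift2d, THEN real_analytic_on_imp_continuous_on]
  show "homeomorphism ?M (lift2d F ` ?M) (lift2d F) (lift2d H)"
    unfolding homeomorphism_def
  proof (intro conjI ballI)
    show "lift2d H (lift2d F p) = p" if "p \<in> ?M" for p using lift2d_inverse[OF that] .
    then show "lift2d H ` lift2d F ` ?M = ?M" by (auto simp: image_image)
    show "lift2d F (lift2d H q) = q" if "q \<in> lift2d F ` ?M" for q using that lift2d_inverse by force
    show "continuous_on ?M (lift2d F)"
      by (rule continuous_on_subset[OF c(1)]) (auto simp: points_nariai_cover)
    show "continuous_on (lift2d F ` ?M) (lift2d H)"
      by (rule continuous_on_subset[OF c(2)]) (auto simp: points_nariai_cover lift2d_def)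
  qed simp
qed

lemma analytic_isometry_lift2d:
  assumes surj: "F ` (nariai_interval a b \<times> UNIV) = UNIV"
  shows "analytic_isometry (nariai_cover \<Lambda> a b) (nariai_cover \<Lambda> 1 0) (lift2d F)"
  unfolding analytic_isometry_def
proof (intro conjI analytic_map_lift2d preserves_metric_lift2d)
  let ?M = "points (nariai_cover \<Lambda> a b)" and ?N = "points (nariai_cover \<Lambda> 1 0)"
  have inj: "inj_on (lift2d F) ?M" by (metis inj_onI lift2d_inverse)
  have M: "lift2d H q \<in> ?M \<and> lift2d F (lift2d H q) = q" if "q \<in> ?N" for q
  proof -
    have "(fst q, fst (snd q)) \<in> F ` (nariai_interval a b \<times> UNIV)" using surj by simp
    then obtain r where r: "r \<in> nariai_interval a b \<times> UNIV" "F r = (fst q, fst (snd q))" by (metis imageE)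
    then have "H (fst q, fst (snd q)) = r" using F unfolding nariai_2d_isometry_def by metis
    then show ?thesis using r that by (auto simp: lift2d_def points_nariai_cover)
  qed
  have sub: "lift2d F ` ?M \<subseteq> ?N" using analytic_map_lift2d by (simp add: analytic_map_def)
  then show bij: "bij_betw (lift2d F) ?M ?N" unfolding bij_betw_def using inj M by (auto simp: image_iff) metis
  have inv: "the_inv_into ?M (lift2d F) q = lift2d H q" if "q \<in> ?N" for q
    using M[OF that] inj by (intro the_inv_into_f_eq) auto
  show "analytic_map ?N ?M (the_inv_into ?M (lift2d F))"
    unfolding analytic_map_def
  proof (intro conjI ballI)
    show "the_inv_into ?M (lift2d F) ` ?N \<subseteq> ?M" using inv M by auto
    have "real_analytic_on H UNIV" using F surj by (simp add: nariai_2d_isometry_def)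
    from real_analytic_on_lift2d[OF this] have "real_analytic_on (lift2d H) UNIV" by simp
    then show "\<exists>U G. p \<in> U \<and> real_analytic_on G U \<and> (\<forall>q\<in>U \<inter> ?N. G q = the_inv_into ?M (lift2d F) q)" for p
      using inv by (intro exI[of _ UNIV] exI[of _ "lift2d H"]) auto
  qed
qed

end

lemma nariai_cover_embedding:
  "a > 0 \<Longrightarrow> \<exists>f. analytic_isometric_embedding (nariai_cover \<Lambda> a b) (nariai_cover \<Lambda> 1 0) f"
  using nariai_2d_isometry_ex analytic_isometric_embedding_lift2d by blast

lemma nariai_cover_isometry:
  "a > 0 \<Longrightarrow> a\<^sup>2 - b\<^sup>2 > 0 \<Longrightarrow> \<exists>f. analytic_isometry (nariai_cover \<Lambda> a b) (nariai_cover \<Lambda> 1 0) f"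
  using nariai_2d_isometry_elliptic analytic_isometry_lift2d by blast

section \<open>Angles on the unit circle and local isometry of the solutions on the circle\<close>

definition circ_angle :: "complex \<Rightarrow> complex \<Rightarrow> real" where
  "circ_angle z0 z = arctan (Im (z * cnj z0) / Re (z * cnj z0))"

definition half_plane :: "complex \<Rightarrow> complex set" where
  "half_plane z0 = {z. 0 < Re (z * cnj z0)}"

lemma open_half_plane: "open (half_plane z0)"
  unfolding half_plane_def by (intro open_Collect_less continuous_intros)

text \<open>Off the circle the function is still the argument of \<open>z * cnj z0\<close>; the open
  half plane is the ambient neighbourhood that \<open>analytic_map\<close> requires.\<close>

lemma real_analytic_on_circ_angle: "real_analytic_on (circ_angle z0) (half_plane z0)"
proof -
  have "linear (\<lambda>z. Im (z * cnj z0))" "linear (\<lambda>z. Re (z * cnj z0))"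
    by (auto simp: linear_iff algebra_simps)
  then have "real_analytic_on (\<lambda>z. Im (z * cnj z0)) (half_plane z0)" "real_analytic_on (\<lambda>z. Re (z * cnj z0)) (half_plane z0)"
    by (auto intro: real_analytic_on_linear open_half_plane)
  then show ?thesis
    unfolding circ_angle_def[abs_def]
    by (intro real_analytic_on_arctan' real_analytic_on_divide) (auto simp: half_plane_def)
qed

lemma circ_angle_cis:
  assumes "cmod z0 = 1" "cmod z = 1" "z \<in> half_plane z0"
  shows "z0 * cis (circ_angle z0 z) = z"
proof -
  define \<zeta> where "\<zeta> = z * cnj z0"
  have pos: "Re \<zeta> > 0" using assms(3) by (simp add: half_plane_def \<zeta>_def)
  have "cmod \<zeta> = 1" using assms by (simp add: \<zeta>_def norm_mult)
  then have "(Re \<zeta>)\<^sup>2 + (Im \<zeta>)\<^sup>2 = 1" by (simp add: cmod_def)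
  then have "1 + (Im \<zeta> / Re \<zeta>)\<^sup>2 = (1 / Re \<zeta>)\<^sup>2" using pos by (simp add: power_divide field_simps)
  then have sq: "sqrt (1 + (Im \<zeta> / Re \<zeta>)\<^sup>2) = 1 / Re \<zeta>" using pos by simp
  have "cis (circ_angle z0 z) = \<zeta>"
    using pos by (simp add: circ_angle_def complex_eq_iff cos_arctan sin_arctan sq flip: \<zeta>_def)
  then show ?thesis using assms(1) complex_norm_square[of z0] by (simp add: \<zeta>_def mult_ac)
qed

lemma circ_angle_mult_cis:
  assumes "cmod z0 = 1" "\<bar>x\<bar> < pi / 2"
  shows "z0 * cis x \<in> half_plane z0" "circ_angle z0 (z0 * cis x) = x"
proof -
  have eq: "z0 * cis x * cnj z0 = cis x" using assms(1) complex_norm_square[of z0] by (simp add: mult_ac)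
  have "cos x > 0" using assms(2) by (intro cos_gt_zero_pi) auto
  then show "z0 * cis x \<in> half_plane z0" "circ_angle z0 (z0 * cis x) = x"
    unfolding half_plane_def circ_angle_def mem_Collect_eq eq
    using assms(2) arctan_tan[of x] by (simp_all add: tan_def)
qed

text \<open>On the circle the angular derivative does not depend on the base point
  \<open>z0\<close>, because changing it only adds a constant to the angle.\<close>

lemma has_derivative_circ_angle:
  assumes z0: "cmod z0 = 1" and z: "cmod z = 1" "z \<in> half_plane z0"
  shows "(circ_angle z0 has_derivative (\<lambda>h. Im (h * cnj z))) (at z)"
proof -
  let ?A = "Re (z * cnj z0)" and ?B = "Im (z * cnj z0)"
  have pos: "?A > 0" using z(2) by (simp add: half_plane_def)
  have "cmod (z * cnj z0) = 1" using assms by (simp add: norm_mult)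
  then have AB: "?A\<^sup>2 + ?B\<^sup>2 = 1" by (simp add: cmod_def)
  have dA: "((\<lambda>z. Re (z * cnj z0)) has_derivative (\<lambda>h. Re (h * cnj z0))) (at z)"
    and dB: "((\<lambda>z. Im (z * cnj z0)) has_derivative (\<lambda>h. Im (h * cnj z0))) (at z)"
    by (intro has_derivative_Re has_derivative_Im has_derivative_mult_left has_derivative_ident)+
  have "((\<lambda>z. Im (z * cnj z0) / Re (z * cnj z0)) has_derivative
      (\<lambda>h. (Im (h * cnj z0) * ?A - ?B * Re (h * cnj z0)) / (?A * ?A))) (at z)"
    by (rule has_derivative_divide'[OF dB dA]) (use pos in simp)
  from has_derivative_compose[OF this, of arctan "\<lambda>y. inverse (1 + (?B / ?A)\<^sup>2) * y"]
  have "(circ_angle z0 has_derivative (\<lambda>h. inverse (1 + (?B / ?A)\<^sup>2) *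
      ((Im (h * cnj z0) * ?A - ?B * Re (h * cnj z0)) / (?A * ?A)))) (at z)"
    using DERIV_arctan[of "?B / ?A"] unfolding circ_angle_def[abs_def] has_field_derivative_def by simp
  moreover have "inverse (1 + (?B / ?A)\<^sup>2) * (y / (?A * ?A)) = y" for y
  proof -
    have "1 + (y / x)\<^sup>2 = 1 / (x * x)" if "x > 0" "x\<^sup>2 + y\<^sup>2 = 1" for x y :: real
      using that by (simp add: power_divide power2_eq_square field_simps)
    from this[OF pos AB] have "1 + (?B / ?A)\<^sup>2 = 1 / (?A * ?A)" .
    then show ?thesis using pos by simp
  qed
  moreover have "Im (h * cnj z0) * ?A - ?B * Re (h * cnj z0) = Im (h * cnj z)" for h
  proof -
    have "Im (h * cnj z0) * ?A - ?B * Re (h * cnj z0) = ((Re z0)\<^sup>2 + (Im z0)\<^sup>2) * Im (h * cnj z)"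
      by (simp add: power2_eq_square algebra_simps)
    then show ?thesis using z0 by (simp add: cmod_def)
  qed
  ultimately show ?thesis by simp
qed

text \<open>Obtained by differentiating the constant norm of the circle component. The angular
  derivative sees only the tangential part of a vector, so tangency must be extracted before metrics
  are compared.\<close>

lemma tangent_space_circle:
  assumes v: "v \<in> tangent_space U p"
    and sub: "U \<subseteq> T \<times> sphere (0::complex) 1 \<times> Y"
  shows "fst (snd p) \<bullet> fst (snd v) = 0"
proof -
  obtain \<gamma> e where \<gamma>: "\<gamma> 0 = p" "e > 0" "\<And>s. \<bar>s\<bar> < e \<Longrightarrow> \<gamma> s \<in> T \<times> sphere (0::complex) 1 \<times> Y"
    "(\<gamma> has_vector_derivative v) (at 0)"
    using v sub unfolding tangent_space_def by blast
  have "((\<lambda>s. fst (snd (\<gamma> s))) has_derivative (\<lambda>h. h *\<^sub>R fst (snd v))) (at 0)"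
    using has_derivative_fst[OF has_derivative_snd[OF \<gamma>(4)[unfolded has_vector_derivative_def]]] by simp
  from has_derivative_inner[OF this this] \<gamma>(1)
  have "((\<lambda>s. fst (snd (\<gamma> s)) \<bullet> fst (snd (\<gamma> s))) has_derivative (\<lambda>h. 2 * h * (fst (snd p) \<bullet> fst (snd v)))) (at 0)"
    by (simp add: inner_commute algebra_simps)
  moreover have "((\<lambda>s. fst (snd (\<gamma> s)) \<bullet> fst (snd (\<gamma> s))) has_derivative (\<lambda>h. 0)) (at 0)"
  proof (rule has_derivative_transform_within_open[OF has_derivative_const open_ball])
    show "0 \<in> ball (0::real) e" using \<gamma>(2) by simp
    show "1 = fst (snd (\<gamma> s)) \<bullet> fst (snd (\<gamma> s))" if "s \<in> ball 0 e" for s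
      using \<gamma>(3)[of s] that by (force simp: norm_eq_1)
  qed
  ultimately have "(\<lambda>h. 2 * h * (fst (snd p) \<bullet> fst (snd v))) = (\<lambda>h. 0)" by (rule has_derivative_unique)
  from fun_cong[OF this, of 1] show ?thesis by simp
qed

lemma real_analytic_on_cis:
  assumes "real_analytic_on f U" shows "real_analytic_on (\<lambda>x. cis (f x)) U"
proof -
  have "real_analytic_on (\<lambda>x. cos (f x) *\<^sub>R 1 + sin (f x) *\<^sub>R \<i>) U"
    by (intro real_analytic_on_add real_analytic_on_scaleR_const real_analytic_on_cos' real_analytic_on_sin' assms)
  moreover have "cis y = cos y *\<^sub>R 1 + sin y *\<^sub>R \<i>" for y by (simp add: complex_eq_iff)
  ultimately show ?thesis by simp
qed

lemma points_nariai: "points (nariai \<Lambda> a b) = nariai_interval a b \<times> sphere 0 1 \<times> sphere 0 1"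
  by (simp add: nariai_def nariai_on_def)

lemma metric_nariai: "metric (nariai \<Lambda> a b) p u v = 1 / \<Lambda> * (- (fst u * fst v) +
     (nariai_warp a b (fst p))\<^sup>2 * (fst (snd u) \<bullet> fst (snd v)) + snd (snd u) \<bullet> snd (snd v))"
  by (simp add: nariai_def nariai_on_def split_beta)

text \<open>Around \<open>p\<close> the circle is unrolled by an angle based at \<open>z0\<close>,
  the map \<open>F\<close> is applied, and the new angle is rolled up around
  \<open>\<zeta>0\<close>; \<open>g\<close> performs the same steps backwards.\<close>

lemma nariai_locally_isometric:
  assumes a: "a > 0"
  shows "locally_isometric (nariai \<Lambda> a b) (nariai \<Lambda> 1 0)"
  unfolding locally_isometric_def
proof
  let ?S = "nariai \<Lambda> a b" and ?S' = "nariai \<Lambda> 1 0" let ?I = "nariai_interval a b"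
  fix p assume p: "p \<in> points ?S"
  obtain F H where F: "nariai_2d_isometry a b F H" using nariai_2d_isometry_ex[OF a] by blast
  have anF: "real_analytic_on F (?I \<times> UNIV)" and anH: "real_analytic_on H (F ` (?I \<times> UNIV))"
    and HF: "\<And>q. q \<in> ?I \<times> UNIV \<Longrightarrow> H (F q) = q"
    using F by (auto simp: nariai_2d_isometry_def)
  define z0 where "z0 = fst (snd p)"
  have z0: "cmod z0 = 1" and t0: "fst p \<in> ?I" using p by (auto simp: z0_def points_nariai)
  define R0 where "R0 = snd (F (fst p, 0))"
  define \<zeta>0 where "\<zeta>0 = cis R0"
  have \<zeta>0: "cmod \<zeta>0 = 1" by (simp add: \<zeta>0_def)
  define E where "E q = F (fst q, circ_angle z0 (fst (snd q)))" for q :: "real \<times> complex \<times> (real^3)"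
  define A where "A = {q :: real \<times> complex \<times> (real^3). fst q \<in> ?I \<and> fst (snd q) \<in> half_plane z0}"
  have "A = ?I \<times> half_plane z0 \<times> UNIV" by (auto simp: A_def)
  then have oA: "open A"
    by (simp add: open_Times open_nariai_interval open_half_plane)
  have idA: "real_analytic_on (\<lambda>q. q) A" by (rule real_analytic_on_id[OF oA])
  note fsA = real_analytic_on_fst[OF idA] real_analytic_on_fst[OF real_analytic_on_snd[OF idA]]
    real_analytic_on_snd[OF real_analytic_on_snd[OF idA]]
  have "real_analytic_on (\<lambda>q. circ_angle z0 (fst (snd q))) A"
    by (rule real_analytic_on_compose[OF fsA(2) real_analytic_on_circ_angle]) (auto simp: A_def)
  then have anE: "real_analytic_on E A"
    unfolding E_def[abs_def]
    by (intro real_analytic_on_compose[OF real_analytic_on_Pair[OF fsA(1)] anF]) (auto simp: A_def)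
  \<comment> \<open>The bound 1 lies below pi / 2, so the new angle can be read off again from its
    point on the circle.\<close>
  define U where "U = points ?S \<inter> {q \<in> A. \<bar>snd (E q) - R0\<bar> < 1}"
  define f where "f q = (fst (E q), cis (snd (E q)), snd (snd q))" for q
  have anf: "real_analytic_on f A"
    unfolding f_def[abs_def]
    by (intro real_analytic_on_Pair real_analytic_on_cis real_analytic_on_fst real_analytic_on_snd anE fsA)
  define Box where "Box = ?I \<times> {- (pi / 2)<..<pi / 2}"
  have Box: "Box \<subseteq> ?I \<times> UNIV" by (auto simp: Box_def)
  have o\<Omega>: "open (F ` Box)"
    by (rule nariai_2d_isometry_open_image[OF F _ Box]) (simp add: Box_def open_Times open_nariai_interval)
  define B where "B = {q :: real \<times> complex \<times> (real^3). fst (snd q) \<in> half_plane \<zeta>0}"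
  have oB: "open B"
    using open_vimage[OF open_half_plane, of "\<lambda>q :: real \<times> complex \<times> (real^3). fst (snd q)" \<zeta>0]
    by (simp add: B_def vimage_def continuous_on_fst continuous_on_snd continuous_on_id)
  have idB: "real_analytic_on (\<lambda>q. q) B" by (rule real_analytic_on_id[OF oB])
  note fsB = real_analytic_on_fst[OF idB] real_analytic_on_fst[OF real_analytic_on_snd[OF idB]]
    real_analytic_on_snd[OF real_analytic_on_snd[OF idB]]
  define G where "G q = (fst q, R0 + circ_angle \<zeta>0 (fst (snd q)))" for q :: "real \<times> complex \<times> (real^3)"
  have "real_analytic_on (\<lambda>q. circ_angle \<zeta>0 (fst (snd q))) B"
    by (rule real_analytic_on_compose[OF fsB(2) real_analytic_on_circ_angle]) (auto simp: B_def)
  then have anG: "real_analytic_on G B"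
    unfolding G_def[abs_def]
    by (intro real_analytic_on_Pair real_analytic_on_add real_analytic_on_const oB fsB(1))
  define B' where "B' = {q \<in> B. G q \<in> F ` Box \<inter> {r. \<bar>snd r - R0\<bar> < 1}}"
  have oB': "open B'"
  proof -
    have "open (F ` Box \<inter> {r. \<bar>snd r - R0\<bar> < 1})"
      by (intro open_Int o\<Omega> open_Collect_less continuous_intros)
    from continuous_open_preimage[OF real_analytic_on_imp_continuous_on[OF anG] oB this]
    show ?thesis by (simp add: B'_def Collect_conj_eq vimage_def)
  qed
  define V where "V = points ?S' \<inter> B'"
  define g where "g q = (fst (H (G q)), z0 * cis (snd (H (G q))), snd (snd q))" for q
  have ang: "real_analytic_on g B'"
  proof -
    have HG: "real_analytic_on (\<lambda>q. H (G q)) B'"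
      by (rule real_analytic_on_compose[OF real_analytic_on_subset[OF anG oB'] anH])
         (use Box in \<open>auto simp: B'_def\<close>)
    have "linear ((*) z0)" by (auto simp: linear_iff algebra_simps)
    note cis = real_analytic_on_linear_compose[OF real_analytic_on_cis[OF real_analytic_on_snd[OF HG]] this]
    have "real_analytic_on (\<lambda>q :: real \<times> complex \<times> (real^3). snd (snd q)) B'"
      by (rule real_analytic_on_subset[OF fsB(3) oB']) (auto simp: B'_def)
    then show ?thesis
      unfolding g_def[abs_def] by (intro real_analytic_on_Pair real_analytic_on_fst[OF HG] cis)
  qed
  have pi1: "1 < pi / 2" using pi_gt3 by simp
  have fU: "f q \<in> V \<and> g (f q) = q" if q: "q \<in> U" for q
  proof -
    obtain t z y where tzy: "q = (t, z, y)" by (cases q) auto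
    have tz: "t \<in> ?I" "cmod z = 1" "norm y = 1" "z \<in> half_plane z0" "\<bar>snd (E q) - R0\<bar> < 1"
      using q by (auto simp: U_def A_def tzy points_nariai)
    define x where "x = circ_angle z0 z"
    have x: "(t, x) \<in> Box" using arctan_bounded tz(1) by (simp add: Box_def x_def circ_angle_def)
    have zx: "z0 * cis x = z" unfolding x_def by (rule circ_angle_cis[OF z0 tz(2,4)])
    have Eq: "E q = F (t, x)" by (simp add: E_def tzy x_def)
    have c: "cis (snd (E q)) = \<zeta>0 * cis (snd (E q) - R0)" by (simp add: \<zeta>0_def cis_mult)
    have ang: "\<bar>snd (E q) - R0\<bar> < pi / 2" using tz(5) pi1 by linarith
    have G: "G (f q) = E q"
      unfolding G_def f_def c using circ_angle_mult_cis(2)[OF \<zeta>0 ang] by (simp add: prod_eq_iff)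
    have "f q \<in> B" unfolding B_def f_def c using circ_angle_mult_cis(1)[OF \<zeta>0 ang] by simp
    moreover have "G (f q) \<in> F ` Box" unfolding G Eq using x by blast
    moreover have "f q \<in> points ?S'" using tz by (simp add: points_nariai nariai_interval_standard f_def tzy)
    ultimately have "f q \<in> V" using tz(5) by (simp add: V_def B'_def G)
    moreover have "H (E q) = (t, x)" unfolding Eq using HF x Box by blast
    ultimately show ?thesis unfolding g_def G by (simp add: zx f_def tzy)
  qed
  have gV: "g q \<in> U \<and> f (g q) = q" if q: "q \<in> V" for q
  proof -
    obtain T \<zeta> y where tzy: "q = (T, \<zeta>, y)" by (cases q) auto
    have tz: "cmod \<zeta> = 1" "norm y = 1" "\<zeta> \<in> half_plane \<zeta>0" "G q \<in> F ` Box" "\<bar>snd (G q) - R0\<bar> < 1"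
      using q by (auto simp: V_def B'_def B_def tzy points_nariai)
    obtain t x where tx: "(t, x) \<in> Box" "G q = F (t, x)" using tz(4) by auto
    have H: "H (G q) = (t, x)" unfolding tx(2) using HF tx(1) Box by blast
    have x: "\<bar>x\<bar> < pi / 2" and t: "t \<in> ?I" using tx(1) by (auto simp: Box_def)
    note cx = circ_angle_mult_cis[OF z0 x]
    have gq: "g q = (t, z0 * cis x, y)" unfolding g_def H by (simp add: tzy)
    have Eg: "E (g q) = G q" by (simp add: E_def gq cx tx(2))
    have "g q \<in> U" using t cx(1) z0 tz Eg by (simp add: U_def A_def gq points_nariai norm_mult)
    moreover have "cis (R0 + circ_angle \<zeta>0 \<zeta>) = \<zeta>"
      using circ_angle_cis[OF \<zeta>0 tz(1,3)] by (simp add: \<zeta>0_def cis_mult)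
    ultimately show ?thesis unfolding f_def Eg unfolding gq by (simp add: G_def tzy)
  qed
  have inj: "inj_on f U" using fU by (metis inj_onI)
  have bij: "bij_betw f U V"
    by (rule bij_betw_byWitness[where f' = g]) (use fU gV in auto)
  have inv: "the_inv_into U f q = g q" if "q \<in> V" for q
    using gV[OF that] inj by (intro the_inv_into_f_eq) auto
  have UA: "U \<subseteq> A" by (auto simp: U_def)
  have pres: "preserves_metric (?S\<lparr>points := U\<rparr>) (?S'\<lparr>points := V\<rparr>) f"
    unfolding preserves_metric_def
  proof
    fix q assume "q \<in> points (?S\<lparr>points := U\<rparr>)"
    then have q: "q \<in> U" by simp
    define t where "t = fst q"
    define z where "z = fst (snd q)"
    have tz: "t \<in> ?I" "cmod z = 1" "z \<in> half_plane z0"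
      using q by (auto simp: U_def A_def t_def z_def points_nariai)
    let ?q = "(t, circ_angle z0 z)"
    obtain D where D: "(F has_derivative D) (at ?q)"
      and iso: "\<And>u v. - (fst (D u) * fst (D v)) + (cosh (fst (F ?q)))\<^sup>2 * (snd (D u) * snd (D v)) =
               - (fst u * fst v) + (nariai_warp a b (fst ?q))\<^sup>2 * (snd u * snd v)"
      using F tz(1) unfolding nariai_2d_isometry_def by blast
    define L where "L h = (fst h, Im (fst (snd h) * cnj z))" for h :: "real \<times> complex \<times> (real^3)"
    have "((\<lambda>q. circ_angle z0 (fst (snd q))) has_derivative (\<lambda>h. Im (fst (snd h) * cnj z))) (at q)"
      using has_derivative_compose[OF has_derivative_fst[OF has_derivative_snd[OF has_derivative_ident]]
          has_derivative_circ_angle[OF z0 tz(2,3), unfolded z_def]] by (simp add: z_def)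
    then have "((\<lambda>q. (fst q, circ_angle z0 (fst (snd q)))) has_derivative L) (at q)"
      unfolding L_def[abs_def] by (intro has_derivative_Pair has_derivative_fst has_derivative_ident)
    from has_derivative_compose[OF this, of F D] D
    have dE: "(E has_derivative (\<lambda>h. D (L h))) (at q)" by (simp add: E_def[abs_def] t_def z_def)
    have "((\<lambda>q. cis (snd (E q))) has_derivative (\<lambda>h. snd (D (L h)) *\<^sub>R (\<i> * cis (snd (E q))))) (at q)"
      by (rule has_derivative_cis[OF has_derivative_snd[OF dE]])
    then have "(f has_derivative (\<lambda>h. (fst (D (L h)), snd (D (L h)) *\<^sub>R (\<i> * cis (snd (E q))), snd (snd h)))) (at q)"
      unfolding f_def[abs_def]
      by (intro has_derivative_Pair has_derivative_fst[OF dE] has_derivative_snd has_derivative_ident)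
    then have df: "(f has_derivative (\<lambda>h. (fst (D (L h)), snd (D (L h)) *\<^sub>R (\<i> * cis (snd (E q))), snd (snd h)))) (at q within U)"
      by (rule has_derivative_at_withinI)
    have "metric ?S' (f q) (fst (D (L u)), snd (D (L u)) *\<^sub>R (\<i> * cis (snd (E q))), snd (snd u))
         (fst (D (L v)), snd (D (L v)) *\<^sub>R (\<i> * cis (snd (E q))), snd (snd v)) = metric ?S q u v"
      if uv: "u \<in> tangent_space U q" "v \<in> tangent_space U q" for u v
    proof -
      have sub: "U \<subseteq> ?I \<times> sphere 0 1 \<times> sphere 0 1" by (auto simp: U_def points_nariai)
      have tan: "z \<bullet> fst (snd u) = 0" "z \<bullet> fst (snd v) = 0"
        using tangent_space_circle[OF uv(1) sub] tangent_space_circle[OF uv(2) sub] by (simp_all add: z_def)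
      have unit: "(\<i> * cis r) \<bullet> (\<i> * cis r) = 1" for r by (simp add: norm_mult flip: norm_eq_1)
      have "fst (snd u) \<bullet> fst (snd v) = Im (fst (snd u) * cnj z) * Im (fst (snd v) * cnj z)"
      proof -
        have zz: "(Re z)\<^sup>2 + (Im z)\<^sup>2 = 1" using tz(2) by (simp add: cmod_def)
        \<comment> \<open>Lagrange's identity: an inner product splits into the tangential and the
          radial products with respect to \<open>z\<close>; the latter vanishes by tangency.\<close>
        have "((Re z)\<^sup>2 + (Im z)\<^sup>2) * (fst (snd u) \<bullet> fst (snd v)) =
            Im (fst (snd u) * cnj z) * Im (fst (snd v) * cnj z) + (z \<bullet> fst (snd u)) * (z \<bullet> fst (snd v))"
          by (simp add: inner_complex_def power2_eq_square algebra_simps)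
        then show ?thesis by (simp add: zz tan)
      qed
      then show ?thesis
        using iso[of "L u" "L v"] unit
        by (simp add: metric_nariai f_def E_def nariai_warp_def[of 1 0] t_def[symmetric] z_def[symmetric])
           (simp add: L_def mult_ac)
    qed
    with df show "\<exists>D. (f has_derivative D) (at q within points (?S\<lparr>points := U\<rparr>)) \<and>
      (\<forall>v\<in>tangent_space (points (?S\<lparr>points := U\<rparr>)) q. \<forall>w\<in>tangent_space (points (?S\<lparr>points := U\<rparr>)) q.
         metric (?S'\<lparr>points := V\<rparr>) (f q) (D v) (D w) = metric (?S\<lparr>points := U\<rparr>) q v w)"
      by (intro exI[of _ "\<lambda>h. (fst (D (L h)), snd (D (L h)) *\<^sub>R (\<i> * cis (snd (E q))), snd (snd h))"]) simp
  qed
  have "analytic_isometry (?S\<lparr>points := U\<rparr>) (?S'\<lparr>points := V\<rparr>) f"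
    unfolding analytic_isometry_def
  proof (intro conjI pres)
    show "bij_betw f (points (?S\<lparr>points := U\<rparr>)) (points (?S'\<lparr>points := V\<rparr>))" using bij by simp
    show "analytic_map (points (?S\<lparr>points := U\<rparr>)) (points (?S'\<lparr>points := V\<rparr>)) f"
      unfolding analytic_map_def using anf UA fU by auto
    show "analytic_map (points (?S'\<lparr>points := V\<rparr>)) (points (?S\<lparr>points := U\<rparr>)) (the_inv_into (points (?S\<lparr>points := U\<rparr>)) f)"
      unfolding analytic_map_def
    proof (intro conjI ballI)
      show "the_inv_into (points (?S\<lparr>points := U\<rparr>)) f ` points (?S'\<lparr>points := V\<rparr>) \<subseteq> points (?S\<lparr>points := U\<rparr>)"
        using inv gV by auto
      fix q assume "q \<in> points (?S'\<lparr>points := V\<rparr>)"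
      then show "\<exists>W G. q \<in> W \<and> real_analytic_on G W \<and>
          (\<forall>r\<in>W \<inter> points (?S'\<lparr>points := V\<rparr>). G r = the_inv_into (points (?S\<lparr>points := U\<rparr>)) f r)"
        using ang inv by (intro exI[of _ B'] exI[of _ g]) (auto simp: V_def)
    qed
  qed
  moreover have "p \<in> U"
  proof -
    have "circ_angle z0 z0 = 0" "z0 \<in> half_plane z0" using circ_angle_mult_cis[OF z0, of 0] by simp_all
    then show ?thesis using p t0 by (simp add: U_def A_def E_def R0_def flip: z0_def)
  qed
  moreover have "openin (top_of_set (points ?S)) U"
  proof -
    have "open {q \<in> A. \<bar>snd (E q) - R0\<bar> < 1}"
    proof -
      have "open {r :: real \<times> real. \<bar>snd r - R0\<bar> < 1}" by (intro open_Collect_less continuous_intros)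
      from continuous_open_preimage[OF real_analytic_on_imp_continuous_on[OF anE] oA this]
      show ?thesis by (simp add: Collect_conj_eq vimage_def)
    qed
    then show ?thesis unfolding U_def by (rule openin_open_Int)
  qed
  moreover have "openin (top_of_set (points ?S')) V" unfolding V_def by (rule openin_open_Int[OF oB'])
  ultimately show "\<exists>U V f. p \<in> U \<and> openin (top_of_set (points ?S)) U \<and> openin (top_of_set (points ?S')) V \<and>
        analytic_isometry (?S\<lparr>points := U\<rparr>) (?S'\<lparr>points := V\<rparr>) f" by blast
qed

theorem mainTheorem2:
  fixes \<Lambda> \<Phi>\<^sub>0 \<Phi>\<^sub>0' \<sigma>\<^sub>0 :: real
  assumes "\<Lambda> > 0" and "\<Phi>\<^sub>0 > 0" and "\<sigma>\<^sub>0 = \<Phi>\<^sub>0\<^sup>2 - \<Phi>\<^sub>0'\<^sup>2"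
  shows
    "((\<exists>f. analytic_isometric_embedding (nariai_cover \<Lambda> \<Phi>\<^sub>0 \<Phi>\<^sub>0') (nariai_cover \<Lambda> 1 0) f) \<and>
      (\<sigma>\<^sub>0 > 0 \<longrightarrow> (\<exists>f. analytic_isometry (nariai_cover \<Lambda> \<Phi>\<^sub>0 \<Phi>\<^sub>0') (nariai_cover \<Lambda> 1 0) f)) \<and>
      locally_isometric (nariai \<Lambda> \<Phi>\<^sub>0 \<Phi>\<^sub>0') (nariai \<Lambda> 1 0)) \<and>
     (\<sigma>\<^sub>0 \<le> 0 \<longrightarrow> causal_geodesically_incomplete (nariai_cover \<Lambda> \<Phi>\<^sub>0 \<Phi>\<^sub>0')) \<and>
     (nariai_asymptotics (nariai_cover \<Lambda> \<Phi>\<^sub>0 \<Phi>\<^sub>0') \<or>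
      nariai_asymptotics (reverse_time (nariai_cover \<Lambda> \<Phi>\<^sub>0 \<Phi>\<^sub>0')))"
proof (intro conjI impI)
  show "\<exists>f. analytic_isometric_embedding (nariai_cover \<Lambda> \<Phi>\<^sub>0 \<Phi>\<^sub>0') (nariai_cover \<Lambda> 1 0) f"
    by (rule nariai_cover_embedding[OF assms(2)])
  show "\<exists>f. analytic_isometry (nariai_cover \<Lambda> \<Phi>\<^sub>0 \<Phi>\<^sub>0') (nariai_cover \<Lambda> 1 0) f" if "\<sigma>\<^sub>0 > 0"
    using nariai_cover_isometry[OF assms(2)] that assms(3) by simp
  show "locally_isometric (nariai \<Lambda> \<Phi>\<^sub>0 \<Phi>\<^sub>0') (nariai \<Lambda> 1 0)"
    by (rule nariai_locally_isometric[OF assms(2)])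
  show "causal_geodesically_incomplete (nariai_cover \<Lambda> \<Phi>\<^sub>0 \<Phi>\<^sub>0')" if "\<sigma>\<^sub>0 \<le> 0"
    using nariai_incomplete[OF assms(1,2)] that assms(3) by simp
  show "nariai_asymptotics (nariai_cover \<Lambda> \<Phi>\<^sub>0 \<Phi>\<^sub>0') \<or> nariai_asymptotics (reverse_time (nariai_cover \<Lambda> \<Phi>\<^sub>0 \<Phi>\<^sub>0'))"
  proof (cases "0 \<le> \<Phi>\<^sub>0'")
    case True
    interpret nariai_future \<Lambda> \<Phi>\<^sub>0 \<Phi>\<^sub>0' 1 using assms(1,2) True by unfold_locales auto
    show ?thesis using nariai_asymptotics_S by (simp add: nariai_dir_def nariai_cover_def nariai_on_def)
  next
    case False
    interpret nariai_future \<Lambda> \<Phi>\<^sub>0 \<Phi>\<^sub>0' "- 1" using assms(1,2) False by unfold_locales auto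
    show ?thesis using nariai_asymptotics_S
      by (simp add: nariai_dir_def nariai_cover_def nariai_on_def reverse_time_def)
  qed
qed

end
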